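(* Fix $Ek>0$ and let $(\boldsymbol u,\boldsymbol B,P,T)$ be a smooth solution of the viscous inertialess model (see context). Suppose that the magnetic flux is exact, and let $\tau=\tau(z)$ be the conductive state for heating $Q=Q(z)$ and boundary temperatures $T_\pm$; set $\theta=T-\tau$. Let $3\le p\le\infty$. Suppose that at some instant of time the fields $(\boldsymbol B,\theta)$ are nontrivial, that $Pe\,C_{\mathrm S,0}\|\boldsymbol u\|_{L^3}<1$, and that the combined energy does not decay: $$\frac{\mathrm d}{\mathrm dt}\left(\frac\Lambda2\int_V|\boldsymbol B|^2\,\mathrm dV+\frac{Pe}2\int_V|\nabla\theta|^2\,\mathrm dV\right)\ge0.$$ Then at that instant $$ Ra\,A_p\,\|\nabla_{x,y}\overline T\|_{L^p}\ \ge\ \frac1{Rm} $$ or $$ \frac{C_{\mathrm P,2}\,Ra\sqrt{Ek}}2+\frac{Pe\,\|\tau'\|_{L^2_z}}{2\sqrt{Ek}}\ \ge\ \sqrt{1-Pe\,C_{\mathrm S,0}\|\boldsymbol u\|_{L^3}} . $$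
   Context: Domain: $V=[0,L_x]\times[0,L_y]\times[0,1]$ with $L_x,L_y>0$; all fields are periodic in $x$ and $y$. $S_-=\{z=0\}$, $S_+=\{z=1\}$, $\boldsymbol n_\pm=\pm\boldsymbol e_z$. $L^p$ norms are over $V$; $\|\tau'\|_{L^2_z}=(\int_0^1|\tau'(z)|^2\,\mathrm dz)^{1/2}$. Viscous inertialess model, with positive parameters $Ek,\Lambda,Ra,Rm,Pe$ and heat source $Q$: velocity $\boldsymbol u$, pressure $P$, magnetic field $\boldsymbol B$, temperature $T$ satisfy $$\boldsymbol e_z\times\boldsymbol u+\nabla P-Ek\nabla^2\boldsymbol u=\Lambda(\nabla\times\boldsymbol B)\times\boldsymbol B+Ra\,T\boldsymbol e_z,\quad\nabla\cdot\boldsymbol u=0,$$ $$\partial_t\boldsymbol B-\nabla\times(\boldsymbol u\times\boldsymbol B)=\tfrac1{Rm}\nabla^2\boldsymbol B,\quad\nabla\cdot\boldsymbol B=0,\quad \partial_tT+\nabla\cdot(\boldsymbol uT)=\tfrac1{Pe}\nabla^2T+\tfrac{Q}{Pe},$$ with boundary conditions on $S_\pm$: $\boldsymbol u\cdot\boldsymbol n_\pm=0$ (no penetration), $(\nabla\times\boldsymbol u)\times\boldsymbol n_\pm=0$ (stress-free), $\boldsymbol B\times\boldsymbol n_\pm=0$ (ferromagnetic), $T=T_\pm$ with $T_\pm$ constants (isothermal). Magnetic flux is exact if $\int_{S_\pm}\boldsymbol n_\pm\cdot\boldsymbol B\,\mathrm dS_\pm=0$. Conductive state: $\tau''+Q=0$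 on $[0,1]$, $\tau=T_\pm$ on $S_\pm$. $\overline T(x,y,z)=\int_0^zT(x,y,z')\,\mathrm dz'$, $\nabla_{x,y}=(\partial_x,\partial_y)$. Constants: $\lambda_1=\min\{\pi,2\pi/L_x,2\pi/L_y\}$, $C_{\mathrm P}=1/\lambda_1$, $b_2=2/\pi$, $C_{\mathrm P,2}=C_{\mathrm P}+b_2$, $C_3=\frac{2^{2/3}}{\pi^{2/3}\sqrt3}$, $C_{\mathrm S}=2\sqrt2\,C_3\Big(1+\frac{\sqrt{1+L_x^{-2}+L_y^{-2}}}{\lambda_1}\Big)$, $A_p=C_{\mathrm P}^{(p-3)/p}C_{\mathrm S}^{3/p}$ (so $A_\infty=C_{\mathrm P}$). $C_{\mathrm S,0}>0$ is a Sobolev–elliptic constant (depending only on $L_x,L_y$) such that $\|\nabla\theta\|_{L^6}\le C_{\mathrm S,0}\|\nabla^2\theta\|_{L^2}$ for all $\theta\in H^2(V)$ periodic in $x,y$ with $\theta=0$ on $S_\pm$. *)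

theory Defs
  imports "HOL-Analysis.Analysis" "HOL-Probability.Essential_Supremum"
begin

section \<open>Smoothness up to the boundary\<close>

text \<open>The derivative is taken within the set, hence one-sided at boundary points: with
  \<open>D = slab\<close> below, the partial derivatives make sense on the walls as well.\<close>

definition partial :: "'a::euclidean_space set \<Rightarrow> 'a \<Rightarrow> ('a \<Rightarrow> 'b::real_normed_vector) \<Rightarrow> 'a \<Rightarrow> 'b" where
  "partial D b f x = vector_derivative (\<lambda>s. f (x + s *\<^sub>R b)) (at 0 within {s. x + s *\<^sub>R b \<in> D})"

fun iter_partial :: "'a::euclidean_space set \<Rightarrow> 'a list \<Rightarrow> ('a \<Rightarrow> 'b::real_normed_vector) \<Rightarrow> 'a \<Rightarrow> 'b" where
  "iter_partial D [] f = f"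
| "iter_partial D (b # bs) f = partial D b (iter_partial D bs f)"

text \<open>Partial derivatives of all orders exist and are continuous on \<open>D\<close>.\<close>

definition smooth_on :: "'a::euclidean_space set \<Rightarrow> ('a \<Rightarrow> 'b::real_normed_vector) \<Rightarrow> bool" where
  "smooth_on D f \<longleftrightarrow>
     (\<forall>bs\<in>lists Basis. continuous_on D (iter_partial D bs f) \<and>
        (\<forall>b\<in>Basis. \<forall>x\<in>D. (\<lambda>s. iter_partial D bs f (x + s *\<^sub>R b))
            differentiable (at 0 within {s. x + s *\<^sub>R b \<in> D})))"

section \<open>Domain and differential operators\<close>

text \<open>A field on \<open>V\<close> that is periodic in \<open>x\<close> and \<open>y\<close> is represented by its periodic extension
  to the slab; its values outside the slab are irrelevant. Integrals and norms are over \<open>V\<close>.\<close>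

definition box_V :: "real \<Rightarrow> real \<Rightarrow> (real^3) set" where
  "box_V Lx Ly = cbox 0 (vector [Lx, Ly, 1])"

definition slab :: "(real^3) set" where
  "slab = {x. 0 \<le> x $ 3 \<and> x $ 3 \<le> 1}"

definition open_slab :: "(real^3) set" where
  "open_slab = {x. 0 < x $ 3 \<and> x $ 3 < 1}"

definition S_minus :: "(real^3) set" where "S_minus = {x. x $ 3 = 0}"
definition S_plus :: "(real^3) set" where "S_plus = {x. x $ 3 = 1}"

abbreviation e_z :: "real^3" where "e_z \<equiv> axis 3 1"

definition periodic_xy :: "real \<Rightarrow> real \<Rightarrow> (real^3 \<Rightarrow> 'b) \<Rightarrow> bool" where
  "periodic_xy Lx Ly f \<longleftrightarrow>
     (\<forall>x\<in>slab. f (x + axis 1 Lx) = f x \<and> f (x + axis 2 Ly) = f x)"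

definition pd :: "3 \<Rightarrow> (real^3 \<Rightarrow> 'b::real_normed_vector) \<Rightarrow> real^3 \<Rightarrow> 'b" where
  "pd i = partial slab (axis i 1)"

definition grad :: "(real^3 \<Rightarrow> real) \<Rightarrow> real^3 \<Rightarrow> real^3" where
  "grad f x = (\<chi> i. pd i f x)"

definition grad_xy :: "(real^3 \<Rightarrow> real) \<Rightarrow> real^3 \<Rightarrow> real^2" where
  "grad_xy f x = vector [pd 1 f x, pd 2 f x]"

definition divergence :: "(real^3 \<Rightarrow> real^3) \<Rightarrow> real^3 \<Rightarrow> real" where
  "divergence f x = (\<Sum>i\<in>UNIV. pd i f x $ i)"

definition curl :: "(real^3 \<Rightarrow> real^3) \<Rightarrow> real^3 \<Rightarrow> real^3" where
  "curl f x = vector [pd 2 f x $ 3 - pd 3 f x $ 2,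
                      pd 3 f x $ 1 - pd 1 f x $ 3,
                      pd 1 f x $ 2 - pd 2 f x $ 1]"

definition laplacian :: "(real^3 \<Rightarrow> 'b::real_normed_vector) \<Rightarrow> real^3 \<Rightarrow> 'b" where
  "laplacian f x = (\<Sum>i\<in>UNIV. pd i (pd i f) x)"

definition time_deriv :: "real set \<Rightarrow> (real \<Rightarrow> real^3 \<Rightarrow> 'b::real_normed_vector) \<Rightarrow> real \<Rightarrow> real^3 \<Rightarrow> 'b" where
  "time_deriv I f t x = vector_derivative (\<lambda>s. f s x) (at t within I)"

definition z_deriv :: "(real \<Rightarrow> real) \<Rightarrow> real \<Rightarrow> real" where
  "z_deriv f z = vector_derivative f (at z within {0..1})"

definition smooth_field :: "real \<Rightarrow> real \<Rightarrow> real set \<Rightarrow> (real \<Rightarrow> real^3 \<Rightarrow> 'b::real_normed_vector) \<Rightarrow> bool" where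
  "smooth_field Lx Ly I f \<longleftrightarrow>
     smooth_on (I \<times> slab) (\<lambda>(t, x). f t x) \<and> (\<forall>t\<in>I. periodic_xy Lx Ly (f t))"

section \<open>Norms\<close>

definition in_Lp :: "real \<Rightarrow> 'a::euclidean_space set \<Rightarrow> ('a \<Rightarrow> 'b::real_normed_vector) \<Rightarrow> bool" where
  "in_Lp p S f \<longleftrightarrow>
     f \<in> borel_measurable (lebesgue_on S) \<and> integrable (lebesgue_on S) (\<lambda>x. norm (f x) powr p)"

definition Lp_norm :: "ereal \<Rightarrow> 'a::euclidean_space set \<Rightarrow> ('a \<Rightarrow> 'b::real_normed_vector) \<Rightarrow> real" where
  "Lp_norm p S f =
     (if p = \<infinity> then real_of_ereal (esssup (lebesgue_on S) (\<lambda>x. ereal (norm (f x))))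
      else (LINT x|lebesgue_on S. norm (f x) powr real_of_ereal p) powr (1 / real_of_ereal p))"

section \<open>The viscous inertialess model\<close>

definition viscous_inertialess_solution ::
  "real \<Rightarrow> real \<Rightarrow> real \<Rightarrow> real \<Rightarrow> real \<Rightarrow> real \<Rightarrow> real \<Rightarrow> (real \<Rightarrow> real) \<Rightarrow> real \<Rightarrow> real \<Rightarrow> real set \<Rightarrow>
   (real \<Rightarrow> real^3 \<Rightarrow> real^3) \<Rightarrow> (real \<Rightarrow> real^3 \<Rightarrow> real^3) \<Rightarrow>
   (real \<Rightarrow> real^3 \<Rightarrow> real) \<Rightarrow> (real \<Rightarrow> real^3 \<Rightarrow> real) \<Rightarrow> bool" where
  "viscous_inertialess_solution Lx Ly Ek \<Lambda> Ra Rm Pe Q Tm Tp I u B P T \<longleftrightarrow>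
     smooth_field Lx Ly I u \<and> smooth_field Lx Ly I B \<and>
     smooth_field Lx Ly I P \<and> smooth_field Lx Ly I T \<and>
     (\<forall>t\<in>I.
       (\<forall>x\<in>slab.
          cross3 e_z (u t x) + grad (P t) x - Ek *\<^sub>R laplacian (u t) x
            = \<Lambda> *\<^sub>R cross3 (curl (B t) x) (B t x) + (Ra * T t x) *\<^sub>R e_z \<and>
          divergence (u t) x = 0 \<and>
          time_deriv I B t x - curl (\<lambda>y. cross3 (u t y) (B t y)) x
            = (1 / Rm) *\<^sub>R laplacian (B t) x \<and>
          divergence (B t) x = 0 \<and>
          time_deriv I T t x + divergence (\<lambda>y. T t y *\<^sub>R u t y) x
            = (1 / Pe) * laplacian (T t) x + Q (x $ 3) / Pe) \<and>
       (\<forall>(S, n) \<in> {(S_minus, - e_z), (S_plus, e_z)}. \<forall>x\<in>S.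
          u t x \<bullet> n = 0 \<and> cross3 (curl (u t) x) n = 0 \<and> cross3 (B t x) n = 0) \<and>
       (\<forall>x\<in>S_minus. T t x = Tm) \<and> (\<forall>x\<in>S_plus. T t x = Tp))"

definition wall_flux :: "real \<Rightarrow> real \<Rightarrow> real \<Rightarrow> real^3 \<Rightarrow> (real^3 \<Rightarrow> real^3) \<Rightarrow> real" where
  "wall_flux Lx Ly z n b =
     integral (cbox 0 (vector [Lx, Ly])) (\<lambda>y :: real^2. n \<bullet> b (vector [y $ 1, y $ 2, z]))"

definition exact_flux :: "real \<Rightarrow> real \<Rightarrow> (real^3 \<Rightarrow> real^3) \<Rightarrow> bool" where
  "exact_flux Lx Ly b \<longleftrightarrow> wall_flux Lx Ly 0 (- e_z) b = 0 \<and> wall_flux Lx Ly 1 e_z b = 0"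

definition conductive_state :: "(real \<Rightarrow> real) \<Rightarrow> real \<Rightarrow> real \<Rightarrow> (real \<Rightarrow> real) \<Rightarrow> bool" where
  "conductive_state Q Tm Tp \<tau> \<longleftrightarrow>
     (\<forall>z\<in>{0..1}. \<tau> differentiable (at z within {0..1}) \<and>
        z_deriv \<tau> differentiable (at z within {0..1}) \<and>
        z_deriv (z_deriv \<tau>) z + Q z = 0) \<and>
     \<tau> 0 = Tm \<and> \<tau> 1 = Tp"

definition combined_energy ::
  "real \<Rightarrow> real \<Rightarrow> real \<Rightarrow> real \<Rightarrow> (real^3 \<Rightarrow> real^3) \<Rightarrow> (real^3 \<Rightarrow> real) \<Rightarrow> real" where
  "combined_energy Lx Ly \<Lambda> Pe b \<theta> =
     \<Lambda> / 2 * (LINT x|lebesgue_on (box_V Lx Ly). (norm (b x))\<^sup>2) +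
     Pe / 2 * (LINT x|lebesgue_on (box_V Lx Ly). (norm (grad \<theta> x))\<^sup>2)"

definition vertical_primitive :: "(real^3 \<Rightarrow> real) \<Rightarrow> real^3 \<Rightarrow> real" where
  "vertical_primitive f x = integral {0..x $ 3} (\<lambda>s. f (vector [x $ 1, x $ 2, s]))"

section \<open>Constants\<close>

definition lambda1 :: "real \<Rightarrow> real \<Rightarrow> real" where
  "lambda1 Lx Ly = Min {pi, 2 * pi / Lx, 2 * pi / Ly}"

definition C_P :: "real \<Rightarrow> real \<Rightarrow> real" where
  "C_P Lx Ly = 1 / lambda1 Lx Ly"

definition b_2 :: real where
  "b_2 = 2 / pi"

definition C_P2 :: "real \<Rightarrow> real \<Rightarrow> real" where
  "C_P2 Lx Ly = C_P Lx Ly + b_2"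

definition C_3 :: real where
  "C_3 = 2 powr (2/3) / (pi powr (2/3) * sqrt 3)"

definition C_S :: "real \<Rightarrow> real \<Rightarrow> real" where
  "C_S Lx Ly = 2 * sqrt 2 * C_3 * (1 + sqrt (1 + 1 / Lx\<^sup>2 + 1 / Ly\<^sup>2) / lambda1 Lx Ly)"

definition A_const :: "real \<Rightarrow> real \<Rightarrow> ereal \<Rightarrow> real" where
  "A_const Lx Ly p =
     (if p = \<infinity> then C_P Lx Ly
      else (let q = real_of_ereal p in C_P Lx Ly powr ((q - 3) / q) * C_S Lx Ly powr (3 / q)))"

section \<open>The Sobolev--elliptic constant\<close>

definition weak_partial :: "3 \<Rightarrow> (real^3 \<Rightarrow> real) \<Rightarrow> (real^3 \<Rightarrow> real) \<Rightarrow> bool" where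
  "weak_partial i f g \<longleftrightarrow>
     (\<forall>\<phi> :: real^3 \<Rightarrow> real. smooth_on UNIV \<phi> \<and>
        (\<exists>K. compact K \<and> K \<subseteq> open_slab \<and> (\<forall>x. x \<notin> K \<longrightarrow> \<phi> x = 0)) \<longrightarrow>
        (LINT x|lebesgue_on open_slab. f x * partial UNIV (axis i 1) \<phi> x)
          = - (LINT x|lebesgue_on open_slab. g x * \<phi> x))"

text \<open>\<open>\<theta>\<close> belongs to the space of \<open>H\<^sup>2\<close> functions periodic in \<open>x, y\<close>, has weak gradient \<open>g\<close> and
  weak Hessian \<open>H\<close>, and vanishes on both walls. Weak derivatives are taken on the open slab and
  not on the interior of \<open>V\<close>, so that the periodic extension is \<open>H\<^sup>2\<close> across the lateral faces.
  In dimension three every \<open>H\<^sup>2\<close> class has a representative continuous on the closed slab, whose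
  wall values are the traces; \<open>\<theta>\<close> is that representative.\<close>

definition H2_periodic_zero ::
  "real \<Rightarrow> real \<Rightarrow> (real^3 \<Rightarrow> real) \<Rightarrow> (real^3 \<Rightarrow> real^3) \<Rightarrow> (real^3 \<Rightarrow> real^3^3) \<Rightarrow> bool" where
  "H2_periodic_zero Lx Ly \<theta> g H \<longleftrightarrow>
     continuous_on slab \<theta> \<and> (\<forall>x\<in>S_minus \<union> S_plus. \<theta> x = 0) \<and>
     periodic_xy Lx Ly \<theta> \<and> periodic_xy Lx Ly g \<and> periodic_xy Lx Ly H \<and>
     in_Lp 2 (box_V Lx Ly) \<theta> \<and> in_Lp 2 (box_V Lx Ly) g \<and> in_Lp 2 (box_V Lx Ly) H \<and>
     (\<forall>i. weak_partial i \<theta> (\<lambda>x. g x $ i)) \<and>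
     (\<forall>i j. weak_partial j (\<lambda>x. g x $ i) (\<lambda>x. H x $ i $ j))"

definition sobolev_elliptic_constant :: "real \<Rightarrow> real \<Rightarrow> real \<Rightarrow> bool" where
  "sobolev_elliptic_constant Lx Ly C \<longleftrightarrow> C > 0 \<and>
     (\<forall>\<theta> g H. H2_periodic_zero Lx Ly \<theta> g H \<longrightarrow>
        in_Lp 6 (box_V Lx Ly) g \<and>
        Lp_norm 6 (box_V Lx Ly) g
          \<le> C * Lp_norm 2 (box_V Lx Ly) (\<lambda>x. \<Sum>i\<in>UNIV. H x $ i $ i))"

end

theory Submission
  imports Defs
begin

text \<open>Write \<open>\<psi>\<close> for the vertical primitive of \<open>T\<close>. Buoyancy and Coriolis force are balanced, up to a
  gradient, by the thermal wind \<open>Ra (- \<partial>\<^sub>2\<psi>, \<partial>\<^sub>1\<psi>, 0)\<close>, so the momentum equation is tested not with \<open>u\<close> but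
  with \<open>u\<close> minus the thermal wind. Adding the induction equation tested with \<open>\<Lambda> B\<close> and the heat equation
  tested with \<open>- Pe \<Delta>\<theta>\<close> gives, for \<open>N = \<parallel>\<nabla>u\<parallel>\<close>, \<open>M = \<parallel>\<Delta>\<theta>\<parallel>\<close>, \<open>K = \<parallel>\<nabla>B\<parallel>\<close>,
  that the time derivative of the energy is at most
  \<open>- Ek N\<^sup>2 - (1 - Pe C \<parallel>u\<parallel>\<^sub>3) M\<^sup>2 + (Ek Ra C\<^sub>P\<^sub>2 + Pe \<parallel>\<tau>'\<parallel>) N M - \<Lambda> (1/Rm - Ra A\<^sub>p \<parallel>\<nabla>\<^sub>x\<^sub>y\<psi>\<parallel>\<^sub>p) K\<^sup>2\<close>.
  If both alternatives fail, this form is negative definite in \<open>(M, K)\<close>.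

  The work of the Lorentz force against the thermal wind is where \<open>A\<^sub>p\<close> enters: by Hoelder it suffices
  to have \<open>\<parallel>B\<parallel>\<^sub>2 \<le> C\<^sub>P K\<close>, which comes from the sharp Wirtinger inequalities (the flux condition makes the
  horizontal means of \<open>B\<^sub>3\<close> vanish), and \<open>\<parallel>B\<parallel>\<^sub>6 \<le> C\<^sub>S K\<close>, which follows from the elementary
  Gagliardo--Nirenberg argument since \<open>C\<^sub>S\<close> exceeds the optimal constant by a factor \<open>2 \<surd>2\<close>.\<close>

section \<open>One-dimensional inequalities\<close>

text \<open>Let w be the thermal wind. Then e_z x w = Ra T e_z - grad (Ra psi), so in the pairing
  with u - w the Coriolis term reproduces the work of buoyancy on u. A direct estimate of Ra T u_3
  would leave a cross term without the factor Ek; the viscous coupling Ek grad u : grad w that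
  replaces it carries this factor. Completing the square against Ek N^2 turns it into Ra sqrt Ek,
  and turns the forcing Pe \<tau>' u_3 into Pe / sqrt Ek: these are the two terms of the second
  alternative. As grad w contains second derivatives of psi, the thermal energy has to dissipate
  second derivatives of \<theta>, which is why it is built on grad \<theta>. Two obstacles shape the
  calculus. At the walls derivatives are one-sided, and each integration by parts in z needs a
  boundary condition of its own. The conductive state is assumed only twice differentiable, so
  \<theta> need not be smooth; derivatives are therefore handled by the relation
  \<open>has_pd\<close> between continuous functions, and \<open>smooth_on\<close> serves only to
  supply instances of it.\<close>

lemma integral_square_mult_le:
  fixes f g :: "'a::euclidean_space \<Rightarrow> real"
  assumes "continuous_on (cbox a b) f" "continuous_on (cbox a b) g"
  shows "(integral (cbox a b) (\<lambda>x. f x * g x))\<^sup>2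
    \<le> integral (cbox a b) (\<lambda>x. (f x)\<^sup>2) * integral (cbox a b) (\<lambda>x. (g x)\<^sup>2)"
proof -
  let ?F = "integral (cbox a b) (\<lambda>x. (f x)\<^sup>2)" and ?G = "integral (cbox a b) (\<lambda>x. (g x)\<^sup>2)"
    and ?H = "integral (cbox a b) (\<lambda>x. f x * g x)"
  have i: "(\<lambda>x. (f x)\<^sup>2) integrable_on cbox a b" "(\<lambda>x. (g x)\<^sup>2) integrable_on cbox a b"
    "(\<lambda>x. f x * g x) integrable_on cbox a b"
    by (intro integrable_continuous continuous_intros assms)+
  have q: "0 \<le> s\<^sup>2 * ?F + 2 * s * r * ?H + r\<^sup>2 * ?G" for s r
  proof -
    have "0 \<le> integral (cbox a b) (\<lambda>x. (s * f x + r * g x)\<^sup>2)"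
      by (intro integral_nonneg integrable_continuous continuous_intros assms) auto
    also have "(\<lambda>x. (s * f x + r * g x)\<^sup>2) = (\<lambda>x. s\<^sup>2 * (f x)\<^sup>2 + 2 * s * r * (f x * g x) + r\<^sup>2 * (g x)\<^sup>2)"
      by (auto simp: power2_eq_square algebra_simps)
    also have "integral (cbox a b) \<dots> = s\<^sup>2 * ?F + 2 * s * r * ?H + r\<^sup>2 * ?G"
      by (subst integral_add integral_mult_right integral_mult_right, (intro integrable_add integrable_on_mult_right i)+)+ simp
    finally show ?thesis .
  qed
  have F: "0 \<le> ?F" and G: "0 \<le> ?G"
    by (auto intro!: integral_nonneg i)
  show ?thesis
  proof (cases "?G = 0")
    case False
    have "0 \<le> ?G\<^sup>2 * ?F + 2 * ?G * (-?H) * ?H + (-?H)\<^sup>2 * ?G" using q .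
    also have "\<dots> = ?G * (?F * ?G - ?H\<^sup>2)" by (simp add: power2_eq_square algebra_simps)
    finally show ?thesis using False G by (simp add: zero_le_mult_iff)
  next
    case True
    have "?H = 0"
    proof (rule ccontr)
      assume "?H \<noteq> 0"
      \<comment> \<open>For \<open>?G = 0\<close> the form is affine in \<open>r\<close>; this
        \<open>r\<close> gives it the value \<open>?F - (?F + 1) = -1\<close>.\<close>
      then show False
        using q[of 1 "- (?F + 1) / (2 * ?H)"] True F by (simp add: field_simps)
    qed
    then show ?thesis using F G by simp
  qed
qed

lemma integral_FTC_real:
  fixes f :: "real \<Rightarrow> real"
  assumes "a \<le> b" "\<And>x. x \<in> {a..b} \<Longrightarrow> (f has_real_derivative f' x) (at x within {a..b})"
  shows "integral {a..b} f' = f b - f a"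
  using fundamental_theorem_of_calculus[of a b f f'] assms
  by (auto simp: has_real_derivative_iff_has_vector_derivative intro!: integral_unique)

text \<open>With \<open>\<phi> = k tan (k (x - (a + b) / 2))\<close>, which is smooth on \<open>[a, b]\<close> for \<open>k < \<pi> / (b - a)\<close>, one has \<open>\<phi>' = k\<^sup>2 + \<phi>\<^sup>2\<close>, so
  \<open>(f' + \<phi> f)\<^sup>2 = f'\<^sup>2 - k\<^sup>2 f\<^sup>2 + (\<phi> f\<^sup>2)'\<close>.\<close>

lemma wirtinger_dirichlet:
  fixes f f' :: "real \<Rightarrow> real"
  assumes "a < b" and d: "\<And>x. x \<in> {a..b} \<Longrightarrow> (f has_real_derivative f' x) (at x within {a..b})"
    and c: "continuous_on {a..b} f'" and "f a = 0" "f b = 0"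
  shows "(pi / (b - a))\<^sup>2 * integral {a..b} (\<lambda>x. (f x)\<^sup>2) \<le> integral {a..b} (\<lambda>x. (f' x)\<^sup>2)"
proof -
  define L where "L = b - a"
  have L: "0 < L" using assms(1) by (simp add: L_def)
  have cf: "continuous_on {a..b} f"
    by (rule DERIV_continuous_on) (rule d)
  have i: "(\<lambda>x. (f x)\<^sup>2) integrable_on {a..b}" "(\<lambda>x. (f' x)\<^sup>2) integrable_on {a..b}"
    by (intro integrable_continuous_real continuous_intros cf c)+
  have k: "k\<^sup>2 * integral {a..b} (\<lambda>x. (f x)\<^sup>2) \<le> integral {a..b} (\<lambda>x. (f' x)\<^sup>2)"
    if k: "0 < k" "k < pi / L" for k
  proof -
    define ph where "ph = (\<lambda>x. k * tan (k * (x - (a + b) / 2)))"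
    have co: "cos (k * (x - (a + b) / 2)) \<noteq> 0" if "x \<in> {a..b}" for x
    proof -
      have x: "\<bar>x - (a + b) / 2\<bar> \<le> L / 2" using that by (auto simp: L_def abs_le_iff field_simps)
      have "\<bar>k * (x - (a + b) / 2)\<bar> \<le> k * (L / 2)"
        unfolding abs_mult using k x by (simp add: mult_left_mono)
      also have "\<dots> < pi / 2" using k L by (simp add: field_simps)
      finally have "cos (k * (x - (a + b) / 2)) > 0"
        by (intro cos_gt_zero_pi) auto
      then show ?thesis by simp
    qed
    have ph': "(ph has_real_derivative k\<^sup>2 + (ph x)\<^sup>2) (at x within {a..b})" if "x \<in> {a..b}" for x
    proof -
      have "(ph has_real_derivative k * (inverse ((cos (k * (x - (a + b) / 2)))\<^sup>2) * k)) (at x within {a..b})"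
        unfolding ph_def using co[OF that]
        by (auto intro!: derivative_eq_intros)
      moreover have "inverse ((cos (k * (x - (a + b) / 2)))\<^sup>2) = 1 + (tan (k * (x - (a + b) / 2)))\<^sup>2"
        using tan_sec[OF co[OF that]] by (simp add: power_inverse)
      ultimately show ?thesis
        unfolding ph_def by (simp add: power2_eq_square algebra_simps)
    qed
    have cph: "continuous_on {a..b} ph"
      by (rule DERIV_continuous_on) (rule ph')
    let ?g' = "\<lambda>x. (k\<^sup>2 + (ph x)\<^sup>2) * (f x)\<^sup>2 + 2 * ph x * f x * f' x"
    have g: "integral {a..b} ?g' = ph b * (f b)\<^sup>2 - ph a * (f a)\<^sup>2"
      by (rule integral_FTC_real)
         (use assms(1) in \<open>auto intro!: derivative_eq_intros d ph' simp: power2_eq_square algebra_simps\<close>)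
    have ig: "?g' integrable_on {a..b}"
      by (intro integrable_continuous_real continuous_intros cf c cph)
    have "0 \<le> integral {a..b} (\<lambda>x. (f' x + ph x * f x)\<^sup>2)"
      by (intro integral_nonneg integrable_continuous_real continuous_intros cf c cph) auto
    also have "(\<lambda>x. (f' x + ph x * f x)\<^sup>2) = (\<lambda>x. ((f' x)\<^sup>2 - k\<^sup>2 * (f x)\<^sup>2) + ?g' x)"
      by (auto simp: power2_eq_square algebra_simps)
    also have "integral {a..b} \<dots> = integral {a..b} (\<lambda>x. (f' x)\<^sup>2 - k\<^sup>2 * (f x)\<^sup>2) + integral {a..b} ?g'"
      using i ig by (intro integral_add integrable_diff integrable_on_mult_right)
    also have "integral {a..b} (\<lambda>x. (f' x)\<^sup>2 - k\<^sup>2 * (f x)\<^sup>2)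
        = integral {a..b} (\<lambda>x. (f' x)\<^sup>2) - k\<^sup>2 * integral {a..b} (\<lambda>x. (f x)\<^sup>2)"
      using i by (subst integral_diff) (auto intro!: integrable_on_mult_right)
    finally show ?thesis using g assms by simp
  qed
  \<comment> \<open>At \<open>k = pi / L\<close> itself the tangent blows up at both endpoints, so
    the sharp constant is reached only as a limit from the left.\<close>
  have "((\<lambda>k. k\<^sup>2 * integral {a..b} (\<lambda>x. (f x)\<^sup>2)) \<longlongrightarrow> (pi / L)\<^sup>2 * integral {a..b} (\<lambda>x. (f x)\<^sup>2)) (at_left (pi / L))"
    by (intro tendsto_intros)
  moreover have "eventually (\<lambda>k. k\<^sup>2 * integral {a..b} (\<lambda>x. (f x)\<^sup>2) \<le> integral {a..b} (\<lambda>x. (f' x)\<^sup>2)) (at_left (pi / L))"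
    unfolding eventually_at_left[OF divide_pos_pos[OF pi_gt_zero L]]
    by (rule exI[of _ 0]) (use k L in auto)
  ultimately show ?thesis
    unfolding L_def by (rule tendsto_upperbound) simp
qed

lemma periodic_integral_shift:
  fixes f :: "real \<Rightarrow> real"
  assumes "0 < L" "continuous_on UNIV f" "\<And>x. f (x + L) = f x" "0 \<le> c" "c \<le> L"
  shows "integral {c..c + L} f = integral {0..L} f"
proof -
  have i: "f integrable_on {a..b}" for a b
    by (rule integrable_continuous_real) (rule continuous_on_subset[OF assms(2)], simp)
  have "integral {c..c + L} f = integral {c..L} f + integral {L..c + L} f"
    using Henstock_Kurzweil_Integration.integral_combine[of c L "c + L" f] i assms by simp
  also have "integral {L..c + L} f = integral {0..c} f"
    using integral_shift_real_ivl[of L L "c + L" f] assms(3) by simp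
  also have "integral {c..L} f + integral {0..c} f = integral {0..L} f"
    using Henstock_Kurzweil_Integration.integral_combine[of 0 c L f] i assms by simp
  finally show ?thesis .
qed

text \<open>Pick \<open>c\<close> with \<open>f c = f (c + L/2)\<close>; then \<open>f - f c\<close> vanishes at \<open>c\<close>, \<open>c + L/2\<close> and
  \<open>c + L\<close>, so the Dirichlet inequality applies on both halves of a period.\<close>

lemma wirtinger_periodic:
  fixes f f' :: "real \<Rightarrow> real"
  assumes L: "0 < L" and d: "\<And>x. (f has_real_derivative f' x) (at x)"
    and c': "continuous_on UNIV f'" and per: "\<And>x. f (x + L) = f x"
  shows "integral {0..L} (\<lambda>x. (f x)\<^sup>2)
    \<le> (L / (2 * pi))\<^sup>2 * integral {0..L} (\<lambda>x. (f' x)\<^sup>2) + (integral {0..L} f)\<^sup>2 / L"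
proof -
  have cf: "continuous_on UNIV f" by (rule DERIV_continuous_on) (rule d)
  have per': "f' (x + L) = f' x" for x
  proof -
    have "((\<lambda>x. f (x + L)) has_real_derivative f' (x + L)) (at x)"
      using d[of "x + L"] by (simp add: DERIV_shift)
    then show ?thesis using d[of x] DERIV_unique by (simp add: per)
  qed
  have cont: "continuous_on A f" "continuous_on A f'" for A
    using cf c' by (auto intro: continuous_on_subset)
  obtain c where c: "0 \<le> c" "c \<le> L/2" and fc: "f c = f (c + L/2)"
  proof -
    let ?h = "\<lambda>x. f x - f (x + L/2)"
    have ch: "continuous_on {0..L/2} ?h"
      by (intro continuous_intros continuous_on_compose2[OF cf] cont) auto
    \<comment> \<open>By periodicity the shifted difference takes opposite values at
      \<open>0\<close> and \<open>L/2\<close>, hence has a zero in between.\<close>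
    have e: "?h (L/2) = - ?h 0" using per[of 0] by simp
    have "\<exists>x. 0 \<le> x \<and> x \<le> L/2 \<and> ?h x = 0"
    proof (cases "?h 0 \<le> 0")
      case True then show ?thesis using IVT'[of ?h 0 0 "L/2"] e ch L by auto
    next
      case False then show ?thesis using IVT2'[of ?h "L/2" 0 0] e ch L by auto
    qed
    then show ?thesis using that by auto
  qed
  define g where "g = (\<lambda>x. f x - f c)"
  have gd: "(g has_real_derivative f' x) (at x within A)" for x A
    unfolding g_def using d[of x] has_field_derivative_at_within[of f "f' x" x A] by (auto intro!: derivative_eq_intros)
  have cg: "continuous_on A g" for A unfolding g_def by (intro continuous_intros cont)
  have i: "(\<lambda>x. (g x)\<^sup>2) integrable_on {a..b}" "(\<lambda>x. (f' x)\<^sup>2) integrable_on {a..b}"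
     "(\<lambda>x. (f x)\<^sup>2) integrable_on {a..b}" "f integrable_on {a..b}" for a b
    by (intro integrable_continuous_real continuous_intros cont cg)+
  have "(2 * pi / L)\<^sup>2 * integral {c..c + L/2} (\<lambda>x. (g x)\<^sup>2) \<le> integral {c..c + L/2} (\<lambda>x. (f' x)\<^sup>2)"
    using wirtinger_dirichlet[of c "c + L/2" g f'] gd cont L fc by (simp add: g_def mult.commute)
  moreover have "(2 * pi / L)\<^sup>2 * integral {c + L/2..c + L} (\<lambda>x. (g x)\<^sup>2) \<le> integral {c + L/2..c + L} (\<lambda>x. (f' x)\<^sup>2)"
    using wirtinger_dirichlet[of "c + L/2" "c + L" g f'] gd cont L fc per[of c] by (simp add: g_def mult.commute)
  moreover have "integral {c..c + L} (\<lambda>x. (g x)\<^sup>2) = integral {c..c + L/2} (\<lambda>x. (g x)\<^sup>2) + integral {c + L/2..c + L} (\<lambda>x. (g x)\<^sup>2)"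
    "integral {c..c + L} (\<lambda>x. (f' x)\<^sup>2) = integral {c..c + L/2} (\<lambda>x. (f' x)\<^sup>2) + integral {c + L/2..c + L} (\<lambda>x. (f' x)\<^sup>2)"
    using L by (intro Henstock_Kurzweil_Integration.integral_combine[symmetric] i; simp)+
  ultimately have "(2 * pi / L)\<^sup>2 * integral {c..c + L} (\<lambda>x. (g x)\<^sup>2) \<le> integral {c..c + L} (\<lambda>x. (f' x)\<^sup>2)"
    by (simp add: distrib_left)
  then have 1: "(2 * pi / L)\<^sup>2 * integral {0..L} (\<lambda>x. (g x)\<^sup>2) \<le> integral {0..L} (\<lambda>x. (f' x)\<^sup>2)"
    using periodic_integral_shift[OF L, of "\<lambda>x. (g x)\<^sup>2" c] periodic_integral_shift[OF L, of "\<lambda>x. (f' x)\<^sup>2" c] c L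
    by (auto simp: per per' g_def continuous_on_power cont cg continuous_on_diff)
  have "integral {0..L} (\<lambda>x. (g x)\<^sup>2) = integral {0..L} (\<lambda>x. (f x)\<^sup>2 - 2 * f c * f x + (f c)\<^sup>2)"
    by (rule integral_cong) (auto simp: g_def power2_eq_square algebra_simps)
  also have "\<dots> = integral {0..L} (\<lambda>x. (f x)\<^sup>2) - 2 * f c * integral {0..L} f + L * (f c)\<^sup>2"
    using i L by (subst integral_add integral_diff integral_mult_right, (intro integrable_on_mult_right integrable_diff i integrable_const_ivl)+)+ simp
  finally have 2: "integral {0..L} (\<lambda>x. (g x)\<^sup>2) = \<dots>" .
  \<comment> \<open>Among all constants the mean minimises the squared distance to \<open>f\<close>;
    so subtracting \<open>f c\<close> leaves at least the integral of the square minus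
    \<open>(integral f)^2 / L\<close>.\<close>
  have "0 \<le> (L * f c - integral {0..L} f)\<^sup>2 / L" using L by simp
  also have "\<dots> = L * (f c)\<^sup>2 - 2 * f c * integral {0..L} f + (integral {0..L} f)\<^sup>2 / L"
    using L by (simp add: power2_eq_square field_simps)
  finally have "integral {0..L} (\<lambda>x. (f x)\<^sup>2) \<le> integral {0..L} (\<lambda>x. (g x)\<^sup>2) + (integral {0..L} f)\<^sup>2 / L"
    using 2 by linarith
  moreover have "integral {0..L} (\<lambda>x. (g x)\<^sup>2) \<le> (L / (2 * pi))\<^sup>2 * integral {0..L} (\<lambda>x. (f' x)\<^sup>2)"
  proof -
    have "integral {0..L} (\<lambda>x. (g x)\<^sup>2) = (L / (2 * pi))\<^sup>2 * ((2 * pi / L)\<^sup>2 * integral {0..L} (\<lambda>x. (g x)\<^sup>2))"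
      using L by (simp add: power2_eq_square field_simps)
    also have "\<dots> \<le> (L / (2 * pi))\<^sup>2 * integral {0..L} (\<lambda>x. (f' x)\<^sup>2)"
      by (rule mult_left_mono[OF 1]) simp
    finally show ?thesis .
  qed
  ultimately show ?thesis by linarith
qed

text \<open>Cauchy--Schwarz against the constant 1 on \<open>{0..z}\<close>. The factor
  \<open>z\<close> is kept because its integral over the unit interval is the 1/2 in
  \<open>vint_vp_le\<close>.\<close>

lemma square_le_integral_deriv:
  fixes f f' :: "real \<Rightarrow> real"
  assumes d: "\<And>x. x \<in> {0..1} \<Longrightarrow> (f has_real_derivative f' x) (at x within {0..1})"
    and c: "continuous_on {0..1} f'" and "f 0 = 0" and z: "z \<in> {0..1}"
  shows "(f z)\<^sup>2 \<le> z * integral {0..1} (\<lambda>x. (f' x)\<^sup>2)"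
proof -
  have c': "continuous_on {0..z} f'" by (rule continuous_on_subset[OF c]) (use z in auto)
  have "f z = integral {0..z} (\<lambda>x. f' x * 1)"
    using integral_FTC_real[of 0 z f f'] DERIV_subset[OF d] z assms(3) by force
  then have "(f z)\<^sup>2 \<le> integral {0..z} (\<lambda>x. (f' x)\<^sup>2) * integral {0..z} (\<lambda>x. 1\<^sup>2)"
    using integral_square_mult_le[of 0 z f' "\<lambda>_. 1"] c' by simp
  also have "\<dots> = z * integral {0..z} (\<lambda>x. (f' x)\<^sup>2)" using z by simp
  also have "\<dots> \<le> z * integral {0..1} (\<lambda>x. (f' x)\<^sup>2)"
    by (intro mult_left_mono integral_subset_le integrable_continuous_real continuous_intros c c') (use z in auto)
  finally show ?thesis .
qed

section \<open>Iterated integrals over a box\<close>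

text \<open>A linear change of variables between different representations of the same Euclidean
  space: the bijection maps boxes to boxes and preserves their content. It links
  \<open>real^3\<close> and \<open>real^2\<close> with nested pairs, where Fubini's theorem is
  available.\<close>

lemma integral_reindex:
  fixes f :: "'a::euclidean_space \<Rightarrow> real" and g :: "'b::euclidean_space \<Rightarrow> 'a"
  assumes hg: "\<And>p. h (g p) = p" and gh: "\<And>x. g (h x) = x" and g: "continuous_on UNIV g"
    and mem: "\<And>x u v. h x \<in> cbox (h u) (h v) \<longleftrightarrow> x \<in> cbox u v"
    and cont: "\<And>u v. cbox u v \<noteq> {} \<Longrightarrow> cbox (g u) (g v) \<noteq> {} \<Longrightarrow>
      measure lborel (cbox (g u) (g v)) = measure lborel (cbox u v)"
    and f: "continuous_on (cbox l r) f"
  shows "integral (cbox l r) f = integral (cbox (h l) (h r)) (\<lambda>p. f (g p))"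
proof -
  have mem': "x \<in> cbox (g u) (g v) \<longleftrightarrow> h x \<in> cbox u v" for x u v
    using mem[of x "g u" "g v"] by (simp add: hg)
  have img: "g ` cbox u v = cbox (g u) (g v)" for u v
    using hg gh mem' by (auto simp: image_iff) metis
  have imh: "h ` cbox u v = cbox (h u) (h v)" for u v
  proof (intro set_eqI iffI)
    fix p assume "p \<in> cbox (h u) (h v)"
    then have "g p \<in> cbox u v" using mem[of "g p" u v] by (simp add: hg)
    then show "p \<in> h ` cbox u v" using hg by (metis imageI)
  qed (use mem in auto)
  have fi: "(f has_integral integral (cbox l r) f) (cbox l r)"
    using f integrable_continuous integrable_integral by blast
  have "((\<lambda>p. f (g p)) has_integral (1/1) *\<^sub>R integral (cbox l r) f) (h ` cbox l r)"
  proof (rule has_integral_twiddle[OF zero_less_one hg gh _ _ _ _ fi])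
    show "continuous (at x) g" for x
      using g unfolding continuous_on_eq_continuous_at[OF open_UNIV] by blast
    show "\<exists>w z. g ` cbox u v = cbox w z" for u v using img by blast
    show "\<exists>w z. h ` cbox u v = cbox w z" for u v using imh by blast
    show "measure lborel (g ` cbox u v) = 1 * measure lborel (cbox u v)" for u v
      using cont[of u v] by (cases "cbox u v = {}") (auto simp flip: img)
  qed
  then show ?thesis unfolding imh by (simp add: integral_unique)
qed

text \<open>The remaining index stays implicit: it receives \<open>c\<close>. With \<open>i\<close>,
  \<open>j\<close> fixed, varying \<open>c\<close> runs along a line in the third direction, so one
  Fubini statement serves all three directions.\<close>

definition coord3 :: "3 \<Rightarrow> 3 \<Rightarrow> real \<Rightarrow> real \<Rightarrow> real \<Rightarrow> real^3" where
  "coord3 i j a b c = (\<chi> m. if m = i then a else if m = j then b else c)"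

lemma continuous_on_coord3 [continuous_intros]:
  assumes "continuous_on S f" "continuous_on S g" "continuous_on S h"
  shows "continuous_on S (\<lambda>x. coord3 i j (f x) (g x) (h x))"
proof -
  have "continuous_on S (\<lambda>x. if m = i then f x else if m = j then g x else h x)" for m
    using assms by (cases "m = i"; cases "m = j") simp_all
  then show ?thesis unfolding coord3_def by (intro continuous_on_vec_lambda)
qed

context
  fixes i j k :: 3 and l r :: "real^3"
  assumes ijk: "distinct [i, j, k]"
begin

lemma univ_ijk: "UNIV = {i, j, k}"
proof -
  have "card {i, j, k} = CARD(3)" using ijk by simp
  then show ?thesis using card_subset_eq[of UNIV "{i, j, k}"] by simp
qed

lemma all_ijk: "(\<forall>m. P m) \<longleftrightarrow> P i \<and> P j \<and> P k"
  using univ_ijk by (metis UNIV_I empty_iff insert_iff)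

lemma coord3_in_cbox:
  "coord3 i j a b c \<in> cbox l r \<longleftrightarrow> a \<in> {l$i..r$i} \<and> b \<in> {l$j..r$j} \<and> c \<in> {l$k..r$k}"
  using ijk by (auto simp: mem_box_cart all_ijk coord3_def)

lemma coord3_components: "coord3 i j (x$i) (x$j) (x$k) = x"
  using ijk by (simp add: vec_eq_iff all_ijk coord3_def)

lemma continuous_on_coord3_box:
  assumes f: "continuous_on (cbox l r) f"
  shows "continuous_on (cbox (l$i, (l$j, l$k)) (r$i, (r$j, r$k))) (\<lambda>p. f (coord3 i j (fst p) (fst (snd p)) (snd (snd p))))"
  by (rule continuous_on_compose2[OF f])
     (auto intro!: continuous_intros simp: coord3_in_cbox cbox_Pair_eq)

lemma integral_coord3:
  fixes f :: "real^3 \<Rightarrow> real"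
  assumes f: "continuous_on (cbox l r) f"
  shows "integral (cbox l r) f = integral (cbox (l$i, (l$j, l$k)) (r$i, (r$j, r$k)))
    (\<lambda>p. f (coord3 i j (fst p) (fst (snd p)) (snd (snd p))))"
  (is "_ = integral _ (\<lambda>p. f (?g p))")
proof (rule integral_reindex[where h = "\<lambda>x. (x$i, (x$j, x$k))", OF _ _ _ _ _ f])
  show "(?g p $ i, ?g p $ j, ?g p $ k) = p" for p using ijk by (cases p) (auto simp: coord3_def)
  show "?g (x $ i, x $ j, x $ k) = x" for x by (simp add: coord3_components)
  show "continuous_on UNIV ?g" by (intro continuous_intros)
  show "(x $ i, x $ j, x $ k) \<in> cbox (u $ i, u $ j, u $ k) (v $ i, v $ j, v $ k) \<longleftrightarrow> x \<in> cbox u v" for x u v :: "real^3"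
    by (auto simp: cbox_Pair_eq mem_box_cart all_ijk)
next
  fix u v :: "real \<times> real \<times> real"
  assume ne: "cbox u v \<noteq> {}" "cbox (?g u) (?g v) \<noteq> {}"
  obtain u1 u2 u3 v1 v2 v3 where uv: "u = (u1, u2, u3)" "v = (v1, v2, v3)" by (metis prod.exhaust)
  have "measure lborel (cbox (?g u) (?g v)) = (\<Prod>m\<in>{i,j,k}. ?g v $ m - ?g u $ m)"
    by (subst content_cbox_cart[OF ne(2)]) (simp only: univ_ijk)
  also have "\<dots> = (v1 - u1) * ((v2 - u2) * (v3 - u3))"
    using ijk by (auto simp: coord3_def uv)
  also have "\<dots> = measure lborel (cbox u v)"
  proof -
    have "u1 \<le> v1" "u2 \<le> v2" "u3 \<le> v3" using ne(1) by (auto simp: uv cbox_Pair_eq)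
    then show ?thesis by (simp add: uv content_Pair)
  qed
  finally show "measure lborel (cbox (?g u) (?g v)) = measure lborel (cbox u v)" .
qed

lemma continuous_on_slice:
  assumes f: "continuous_on (cbox l r) f" and "a \<in> {l$i..r$i}" "b \<in> {l$j..r$j}"
  shows "continuous_on {l$k..r$k} (\<lambda>c. f (coord3 i j a b c))"
  by (rule continuous_on_compose2[OF f]) (use assms in \<open>auto intro!: continuous_intros simp: coord3_in_cbox\<close>)

lemma continuous_on_slice_integral:
  fixes f :: "real^3 \<Rightarrow> real"
  assumes f: "continuous_on (cbox l r) f"
  shows "continuous_on (cbox (l$i, l$j) (r$i, r$j)) (\<lambda>p. integral {l$k..r$k} (\<lambda>c. f (coord3 i j (fst p) (snd p) c)))"
  unfolding cbox_interval[symmetric]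
  by (rule integral_continuous_on_param, unfold split_beta, rule continuous_on_compose2[OF f])
     (auto intro!: continuous_intros simp: coord3_in_cbox cbox_Pair_eq)

lemma continuous_on_slice_integral2:
  fixes f :: "real^3 \<Rightarrow> real"
  assumes f: "continuous_on (cbox l r) f"
  shows "continuous_on {l$i..r$i} (\<lambda>a. integral {l$j..r$j} (\<lambda>b. integral {l$k..r$k} (\<lambda>c. f (coord3 i j a b c))))"
  unfolding cbox_interval[symmetric]
  by (rule integral_continuous_on_param, unfold split_beta,
     rule continuous_on_compose2[OF continuous_on_slice_integral[OF f, folded cbox_interval]])
     (auto intro!: continuous_intros)

lemma integral_box_pair:
  fixes f :: "real^3 \<Rightarrow> real"
  assumes f: "continuous_on (cbox l r) f"
  shows "integral (cbox l r) f
    = integral (cbox (l$i, l$j) (r$i, r$j)) (\<lambda>p. integral {l$k..r$k} (\<lambda>c. f (coord3 i j (fst p) (snd p) c)))"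
    (is "_ = ?R")
    and "integral (cbox l r) f
    = integral {l$i..r$i} (\<lambda>a. integral {l$j..r$j} (\<lambda>b. integral {l$k..r$k} (\<lambda>c. f (coord3 i j a b c))))"
    (is "_ = ?S")
proof -
  have "integral (cbox l r) f
    = integral {l$i..r$i} (\<lambda>a. integral (cbox (l$j,l$k) (r$j,r$k)) (\<lambda>p. f (coord3 i j a (fst p) (snd p))))"
    unfolding integral_coord3[OF f] cbox_interval[symmetric]
    by (subst integral_prod_continuous[OF continuous_on_coord3_box[OF f]]) simp
  also have "\<dots> = ?S"
  proof (rule integral_cong)
    fix a assume a: "a \<in> {l$i..r$i}"
    have "continuous_on (cbox (l$j,l$k) (r$j,r$k)) (\<lambda>p. f (coord3 i j a (fst p) (snd p)))"
      by (rule continuous_on_compose2[OF f]) (use a in \<open>auto intro!: continuous_intros simp: coord3_in_cbox cbox_Pair_eq\<close>)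
    from integral_prod_continuous[OF this]
    show "integral (cbox (l$j,l$k) (r$j,r$k)) (\<lambda>p. f (coord3 i j a (fst p) (snd p)))
      = integral {l$j..r$j} (\<lambda>b. integral {l$k..r$k} (\<lambda>c. f (coord3 i j a b c)))"
      by (simp add: cbox_interval)
  qed
  finally show S: "integral (cbox l r) f = ?S" .
  show "integral (cbox l r) f = ?R"
    unfolding S integral_prod_continuous[OF continuous_on_slice_integral[OF f]] by (simp add: cbox_interval)
qed

text \<open>The bridge from one-dimensional inequalities to \<open>V\<close>: only the line
  integrals are compared, the integrands themselves need not be ordered.\<close>

lemma integral_box_slice_mono:
  fixes f g :: "real^3 \<Rightarrow> real"
  assumes f: "continuous_on (cbox l r) f" and g: "continuous_on (cbox l r) g"
    and le: "\<And>a b. a \<in> {l$i..r$i} \<Longrightarrow> b \<in> {l$j..r$j} \<Longrightarrow>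
      integral {l$k..r$k} (\<lambda>c. f (coord3 i j a b c)) \<le> integral {l$k..r$k} (\<lambda>c. g (coord3 i j a b c))"
  shows "integral (cbox l r) f \<le> integral (cbox l r) g"
  unfolding integral_box_pair(1)[OF f] integral_box_pair(1)[OF g]
  by (rule integral_le; (intro integrable_continuous continuous_on_slice_integral f g)?) (auto simp: cbox_Pair_eq le)

end

section \<open>Partial derivatives on the slab\<close>

text \<open>A relation instead of the function \<open>pd\<close>, so that existence of the
  derivative is part of the statement and functions that are not smooth, such as vertical primitives
  or \<open>\<tau>\<close>, are covered. The derivative is one-sided at the walls for
  \<open>i = 3\<close>.\<close>

definition has_pd :: "3 \<Rightarrow> (real^3 \<Rightarrow> real) \<Rightarrow> (real^3 \<Rightarrow> real) \<Rightarrow> bool" where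
  "has_pd i f f' \<longleftrightarrow> (\<forall>x\<in>slab. ((\<lambda>s. f (x + s *\<^sub>R axis i 1)) has_real_derivative f' x)
     (at 0 within {s. x + s *\<^sub>R axis i 1 \<in> slab}))"

lemma has_pdD: "has_pd i f f' \<Longrightarrow> x \<in> slab \<Longrightarrow>
  ((\<lambda>s. f (x + s *\<^sub>R axis i 1)) has_real_derivative f' x) (at 0 within {s. x + s *\<^sub>R axis i 1 \<in> slab})"
  by (simp add: has_pd_def)

lemma has_pd_add: "has_pd i f f' \<Longrightarrow> has_pd i g g' \<Longrightarrow> has_pd i (\<lambda>x. f x + g x) (\<lambda>x. f' x + g' x)"
  unfolding has_pd_def by (auto intro!: derivative_eq_intros)

lemma has_pd_diff: "has_pd i f f' \<Longrightarrow> has_pd i g g' \<Longrightarrow> has_pd i (\<lambda>x. f x - g x) (\<lambda>x. f' x - g' x)"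
  unfolding has_pd_def by (auto intro!: derivative_eq_intros)

lemma has_pd_mult: "has_pd i f f' \<Longrightarrow> has_pd i g g' \<Longrightarrow> has_pd i (\<lambda>x. f x * g x) (\<lambda>x. f' x * g x + f x * g' x)"
  unfolding has_pd_def by (fastforce intro!: derivative_eq_intros)

lemma has_pd_power2: "has_pd i f f' \<Longrightarrow> has_pd i (\<lambda>x. (f x)\<^sup>2) (\<lambda>x. 2 * f x * f' x)"
  unfolding has_pd_def by (fastforce intro!: derivative_eq_intros)

text \<open>Uniqueness of one-sided derivatives rests on this. Below the upper wall there is room
  upwards, on the upper wall there is room downwards; for a horizontal direction either segment lies
  in the slab.\<close>

lemma slab_line_nontrivial:
  assumes "x \<in> slab" shows "at 0 within {s. x + s *\<^sub>R axis i 1 \<in> slab} \<noteq> bot"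
proof -
  have "(0::real) islimpt {s. x + s *\<^sub>R axis i 1 \<in> slab}"
  proof (cases "x $ 3 < 1")
    case True
    have "(0::real) islimpt {0..1 - x$3}" by (rule islimpt_Icc[THEN iffD2]) (use True in auto)
    then show ?thesis by (rule islimpt_subset) (use assms in \<open>auto simp: slab_def axis_def\<close>)
  next
    case False
    have "(0::real) islimpt {-1..0}" by (rule islimpt_Icc[THEN iffD2]) auto
    then show ?thesis by (rule islimpt_subset) (use assms False in \<open>auto simp: slab_def axis_def\<close>)
  qed
  then show ?thesis by (simp add: trivial_limit_within)
qed

lemma has_pd_pd:
  assumes "has_pd i f f'" "x \<in> slab" shows "pd i f x = f' x"
  using has_pdD[OF assms] slab_line_nontrivial[OF assms(2)]
  unfolding pd_def partial_def has_real_derivative_iff_has_vector_derivative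
  by (simp add: vector_derivative_within)

lemma has_pd_line:
  assumes "has_pd i f f'" "x + c *\<^sub>R axis i 1 \<in> slab"
  shows "((\<lambda>s. f (x + s *\<^sub>R axis i 1)) has_real_derivative f' (x + c *\<^sub>R axis i 1)) (at c within {s. x + s *\<^sub>R axis i 1 \<in> slab})"
proof -
  have "((\<lambda>s. f (x + (c + s) *\<^sub>R axis i 1)) has_real_derivative f' (x + c *\<^sub>R axis i 1)) (at 0 within {s. x + (c + s) *\<^sub>R axis i 1 \<in> slab})"
    using has_pdD[OF assms] by (simp add: algebra_simps)
  moreover have "(+) c ` {s. x + (c + s) *\<^sub>R axis i 1 \<in> slab} = {s. x + s *\<^sub>R axis i 1 \<in> slab}"
    by (auto simp: image_iff intro!: exI[of _ "_ - c"])
  ultimately show ?thesis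
    using DERIV_at_within_shift[of "\<lambda>s. f (x + s *\<^sub>R axis i 1)" _ c 0 "{s. x + (c + s) *\<^sub>R axis i 1 \<in> slab}"] by simp
qed

lemma scaleR_axis_one: "s *\<^sub>R axis k 1 = axis k (s::real)"
  by (auto simp: axis_def vec_eq_iff)

lemma coord3_shift: "distinct [i, j, k] \<Longrightarrow> coord3 i j a b c + s *\<^sub>R axis k 1 = coord3 i j a b (c + s)"
  by (auto simp: vec_eq_iff coord3_def axis_def all_ijk[of i j k])

lemma has_pd_coord3:
  assumes "has_pd k f f'" "distinct [i, j, k]" "coord3 i j a b c \<in> slab" "\<And>s. s \<in> S \<Longrightarrow> coord3 i j a b s \<in> slab"
  shows "((\<lambda>s. f (coord3 i j a b s)) has_real_derivative f' (coord3 i j a b c)) (at c within S)"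
proof -
  have e: "coord3 i j a b 0 + s *\<^sub>R axis k 1 = coord3 i j a b s" for s
    using coord3_shift[OF assms(2), of a b 0 s] by simp
  show ?thesis
    using has_pd_line[OF assms(1), of "coord3 i j a b 0" c, unfolded e, OF assms(3)] assms(4)
    by (auto intro: DERIV_subset)
qed

lemma distinct_complement: "\<exists>i j. distinct [i, j, k :: 3]"
proof -
  have "distinct [2, 3, 1::3]" "distinct [1, 3, 2::3]" "distinct [1, 2, 3::3]" by auto
  then show ?thesis using exhaust_3[of k] by metis
qed

section \<open>Periodic fields on the cell and integration by parts\<close>

locale cell =
  fixes Lx Ly :: real
  assumes Lx: "0 < Lx" and Ly: "0 < Ly"
begin

abbreviation per :: "real^3" where "per \<equiv> vector [Lx, Ly, 1]"

lemma per_pos: "0 < per $ i"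
  using Lx Ly exhaust_3[of i] by auto

text \<open>Continuity up to the walls gives integrability over \<open>V\<close>, and periodicity
  cancels the lateral boundary terms. Asking for no derivatives keeps the class closed under
  absolute values, square roots and vertical primitives.\<close>

definition fld :: "(real^3 \<Rightarrow> real) \<Rightarrow> bool" where
  "fld f \<longleftrightarrow> continuous_on slab f \<and> periodic_xy Lx Ly f"

text \<open>The gauge integral, for which the fundamental theorem and Fubini are at hand;
  \<open>vint_lebesgue\<close> identifies it with the Lebesgue integral of the norms and
  energies.\<close>

definition vint :: "(real^3 \<Rightarrow> real) \<Rightarrow> real" where
  "vint f = integral (box_V Lx Ly) f"

lemma box_V_slab: "box_V Lx Ly \<subseteq> slab"
proof
  fix x assume "x \<in> box_V Lx Ly"
  then have "(0::real^3) $ 3 \<le> x $ 3 \<and> x $ 3 \<le> per $ 3" unfolding box_V_def mem_box_cart by blast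
  then show "x \<in> slab" by (simp add: slab_def)
qed

lemma fld_box: "fld f \<Longrightarrow> continuous_on (cbox 0 per) f"
  using box_V_slab continuous_on_subset unfolding fld_def box_V_def by blast

lemma fld_const: "fld (\<lambda>x. c)" by (auto simp: fld_def periodic_xy_def)
lemma fld_add: "fld f \<Longrightarrow> fld g \<Longrightarrow> fld (\<lambda>x. f x + g x)"
  by (auto simp: fld_def periodic_xy_def intro!: continuous_intros)
lemma fld_diff: "fld f \<Longrightarrow> fld g \<Longrightarrow> fld (\<lambda>x. f x - g x)"
  by (auto simp: fld_def periodic_xy_def intro!: continuous_intros)
lemma fld_minus: "fld f \<Longrightarrow> fld (\<lambda>x. - f x)"
  by (auto simp: fld_def periodic_xy_def intro!: continuous_intros)
lemma fld_mult: "fld f \<Longrightarrow> fld g \<Longrightarrow> fld (\<lambda>x. f x * g x)"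
  by (auto simp: fld_def periodic_xy_def intro!: continuous_intros)
lemma fld_abs: "fld f \<Longrightarrow> fld (\<lambda>x. \<bar>f x\<bar>)"
  by (auto simp: fld_def periodic_xy_def intro!: continuous_intros)
lemma fld_sqrt: "fld f \<Longrightarrow> fld (\<lambda>x. sqrt (f x))"
  by (auto simp: fld_def periodic_xy_def intro!: continuous_intros)
lemma fld_power: "fld f \<Longrightarrow> fld (\<lambda>x. f x ^ n)"
  by (auto simp: fld_def periodic_xy_def intro!: continuous_intros)
lemma fld_sum: "(\<And>i. i \<in> A \<Longrightarrow> fld (f i)) \<Longrightarrow> fld (\<lambda>x. \<Sum>i\<in>A. f i x)"
  by (auto simp: fld_def periodic_xy_def intro!: continuous_intros sum.cong)
lemma fld_z:
  assumes "continuous_on {0..1} h"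
  shows "fld (\<lambda>x. h (x $ 3))"
proof -
  have "continuous_on slab (\<lambda>x. h (x $ 3))"
    by (rule continuous_on_compose2[OF assms]) (auto intro!: continuous_intros simp: slab_def)
  then show ?thesis by (simp add: fld_def periodic_xy_def axis_def)
qed

lemmas fld_intros = fld_const fld_add fld_diff fld_minus fld_mult fld_abs fld_sqrt fld_power fld_sum

lemma fld_integrable: "fld f \<Longrightarrow> f integrable_on cbox 0 per"
  by (intro integrable_continuous fld_box)

lemma vint_add: "fld f \<Longrightarrow> fld g \<Longrightarrow> vint (\<lambda>x. f x + g x) = vint f + vint g"
  unfolding vint_def box_V_def by (intro integral_add fld_integrable)
lemma vint_diff: "fld f \<Longrightarrow> fld g \<Longrightarrow> vint (\<lambda>x. f x - g x) = vint f - vint g"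
  unfolding vint_def box_V_def by (intro integral_diff fld_integrable)
lemma vint_minus: "vint (\<lambda>x. - f x) = - vint f"
  unfolding vint_def box_V_def by simp
lemma vint_cmult: "vint (\<lambda>x. c * f x) = c * vint f"
  unfolding vint_def box_V_def by simp
lemma vint_sum: "finite A \<Longrightarrow> (\<And>i. i \<in> A \<Longrightarrow> fld (f i)) \<Longrightarrow> vint (\<lambda>x. \<Sum>i\<in>A. f i x) = (\<Sum>i\<in>A. vint (f i))"
  unfolding vint_def box_V_def by (intro integral_sum fld_integrable) auto
lemma vint_mono: "fld f \<Longrightarrow> fld g \<Longrightarrow> (\<And>x. x \<in> slab \<Longrightarrow> f x \<le> g x) \<Longrightarrow> vint f \<le> vint g"
  unfolding vint_def box_V_def by (intro integral_le fld_integrable) (use box_V_slab[unfolded box_V_def] in auto)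
lemma vint_cong: "(\<And>x. x \<in> slab \<Longrightarrow> f x = g x) \<Longrightarrow> vint f = vint g"
  unfolding vint_def by (rule integral_cong) (use box_V_slab in auto)
lemma vint_nonneg: "fld f \<Longrightarrow> (\<And>x. x \<in> slab \<Longrightarrow> 0 \<le> f x) \<Longrightarrow> 0 \<le> vint f"
  unfolding vint_def box_V_def by (intro integral_nonneg fld_integrable) (use box_V_slab[unfolded box_V_def] in auto)

lemma vint_square_mult_le: "fld f \<Longrightarrow> fld g \<Longrightarrow> (vint (\<lambda>x. f x * g x))\<^sup>2 \<le> vint (\<lambda>x. (f x)\<^sup>2) * vint (\<lambda>x. (g x)\<^sup>2)"
  unfolding vint_def box_V_def by (intro integral_square_mult_le fld_box)

lemma vint_abs_mult_le: "fld f \<Longrightarrow> fld g \<Longrightarrow> \<bar>vint (\<lambda>x. f x * g x)\<bar> \<le> sqrt (vint (\<lambda>x. (f x)\<^sup>2)) * sqrt (vint (\<lambda>x. (g x)\<^sup>2))"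
  using real_le_rsqrt[OF power2_abs[THEN ord_eq_le_trans, OF vint_square_mult_le]]
  by (simp add: real_sqrt_mult)

lemma vint_eq_0D:
  assumes f: "fld f" and nn: "\<And>x. x \<in> slab \<Longrightarrow> 0 \<le> f x" and z: "vint f = 0" and x: "x \<in> box_V Lx Ly"
  shows "f x = 0"
proof -
  have "f integrable_on cbox 0 per" using f by (rule fld_integrable)
  then have hi: "(f has_integral 0) (cbox 0 per)" using z unfolding vint_def box_V_def by (metis integrable_integral)
  have ne: "box 0 per \<noteq> {}" using per_pos by (simp add: interval_ne_empty_cart)
  have sub: "y \<in> slab" if "y \<in> cbox 0 per" for y using that box_V_slab by (auto simp: box_V_def)
  show ?thesis
  proof (rule has_integral_0_cbox_imp_0[OF fld_box[OF f] _ hi ne])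
    show "0 \<le> f y" if "y \<in> box 0 per" for y using that sub nn box_subset_cbox by blast
  qed (use x in \<open>simp add: box_V_def\<close>)
qed

lemma vint_slice_mono:
  assumes "fld f" "fld g" "distinct [i, j, k]"
    and "\<And>a b. a \<in> {0..per$i} \<Longrightarrow> b \<in> {0..per$j} \<Longrightarrow>
      integral {0..per$k} (\<lambda>c. f (coord3 i j a b c)) \<le> integral {0..per$k} (\<lambda>c. g (coord3 i j a b c))"
  shows "vint f \<le> vint g"
  unfolding vint_def box_V_def
  using integral_box_slice_mono[OF assms(3) fld_box[OF assms(1)] fld_box[OF assms(2)]] assms(4) by simp

lemma coord3_slab:
  assumes "distinct [i, j, k]" "a \<in> {0..per$i}" "b \<in> {0..per$j}" "c \<in> {0..per$k}"
  shows "coord3 i j a b c \<in> slab"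
  using coord3_in_cbox[OF assms(1), of a b c 0 per] assms box_V_slab by (auto simp: box_V_def)

text \<open>One direction of the divergence theorem: on each line in direction \<open>k\<close> the
  fundamental theorem leaves two end values, which agree by periodicity for horizontal
  \<open>k\<close> and vanish by assumption for \<open>k = 3\<close>.\<close>

lemma vint_partial:
  assumes h: "has_pd k f f'" and f: "fld f" "fld f'"
    and w: "k = 3 \<Longrightarrow> \<forall>x\<in>S_minus \<union> S_plus. f x = 0"
  shows "vint f' = 0"
proof -
  obtain i j where d: "distinct [i, j, k]" using distinct_complement by blast
  have "integral {0..per$k} (\<lambda>c. f' (coord3 i j a b c)) = 0" if ab: "a \<in> {0..per$i}" "b \<in> {0..per$j}" for a b
  proof -
    have "integral {0..per$k} (\<lambda>c. f' (coord3 i j a b c)) = f (coord3 i j a b (per$k)) - f (coord3 i j a b 0)"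
      by (rule integral_FTC_real) (use per_pos[of k] in \<open>auto intro!: has_pd_coord3[OF h d] coord3_slab[OF d ab]\<close>)
    also have "\<dots> = 0"
    proof (cases "k = 3")
      case True
      have "coord3 i j a b 0 \<in> S_minus" "coord3 i j a b (per$k) \<in> S_plus"
        using d True by (auto simp: S_minus_def S_plus_def coord3_def)
      then show ?thesis using w[OF True] by simp
    next
      case False
      then have "k = 1 \<or> k = 2" using exhaust_3[of k] by auto
      moreover have "coord3 i j a b (per$k) = coord3 i j a b 0 + axis k (per$k)"
        using coord3_shift[OF d, of a b 0 "per$k"] scaleR_axis_one[of "per$k" k] by simp
      moreover have "coord3 i j a b 0 \<in> slab" using coord3_slab[OF d ab] per_pos[of k] by simp
      ultimately show ?thesis using f(1) unfolding fld_def periodic_xy_def by auto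
    qed
    finally show ?thesis .
  qed
  \<comment> \<open>Equality of all line integrals is fed to the slice comparison in both
    directions.\<close>
  then have "vint f' \<le> vint (\<lambda>x. 0)" "vint (\<lambda>x. 0) \<le> vint f'"
    by (auto intro!: vint_slice_mono[OF _ _ d] f fld_const)
  then show ?thesis by (simp add: vint_def)
qed

lemma vint_by_parts:
  assumes "has_pd k f f'" "has_pd k g g'" "fld f" "fld f'" "fld g" "fld g'"
    and "k = 3 \<Longrightarrow> \<forall>x\<in>S_minus \<union> S_plus. f x * g x = 0"
  shows "vint (\<lambda>x. f' x * g x) = - vint (\<lambda>x. f x * g' x)"
proof -
  have "vint (\<lambda>x. f' x * g x + f x * g' x) = 0"
    by (rule vint_partial[OF has_pd_mult[OF assms(1,2)]]) (use assms in \<open>auto intro!: fld_intros\<close>)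
  then show ?thesis using assms by (simp add: vint_add fld_mult)
qed

end

section \<open>Vertical primitives\<close>

text \<open>Moves the variable upper limit into the integrand. A vertical primitive thus becomes a
  parameter integral over a fixed interval, whose continuity up to the walls is standard.\<close>

lemma integral_rescale_unit:
  fixes g :: "real \<Rightarrow> real"
  assumes z: "0 \<le> z" and c: "continuous_on {0..z} g"
  shows "integral {0..z} g = z * integral {0..1} (\<lambda>s. g (z * s))"
proof -
  let ?G = "\<lambda>y. integral {0..y} g"
  have "integral {0..1} (\<lambda>s. g (z * s) * z) = ?G (z * 1) - ?G (z * 0)"
  proof (rule integral_FTC_real)
    fix s :: real assume s: "s \<in> {0..1}"
    have zs: "z * s \<in> {0..z}" using s z by (auto intro: mult_left_le)
    have im: "(*) z ` {0..1} \<subseteq> {0..z}" using z by (auto intro: mult_left_le)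
    have "(?G has_real_derivative g (z * s)) (at (z * s) within (*) z ` {0..1})"
      by (rule DERIV_subset[OF integral_has_real_derivative[OF c zs] im])
    moreover have "((*) z has_real_derivative z) (at s within {0..1})"
      by (auto intro!: derivative_eq_intros)
    ultimately show "((\<lambda>s. ?G (z * s)) has_real_derivative g (z * s) * z) (at s within {0..1})"
      using DERIV_image_chain[of ?G "g (z * s)" "(*) z" s "{0..1}" z] by (simp add: o_def)
  qed simp
  then show ?thesis by (simp add: mult.commute)
qed

definition vp :: "(real^3 \<Rightarrow> real) \<Rightarrow> real^3 \<Rightarrow> real" where
  "vp f x = integral {0..x $ 3} (\<lambda>s. f (coord3 1 2 (x $ 1) (x $ 2) s))"

lemma vector_coord3: "vector [a, b, c] = coord3 1 2 a b c"
  by (simp add: vec_eq_iff coord3_def forall_3)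

lemma vertical_primitive_eq_vp: "vertical_primitive = vp"
  by (intro ext) (simp add: vertical_primitive_def vp_def vector_coord3)

lemma coord3_12_slab [simp]: "coord3 1 2 a b c \<in> slab \<longleftrightarrow> c \<in> {0..1}"
  by (auto simp: slab_def coord3_def)

lemma coord3_nth_12 [simp]: "coord3 1 2 a b c $ 1 = a" "coord3 1 2 a b c $ 2 = b" "coord3 1 2 a b c $ 3 = c"
  by (simp_all add: coord3_def)

lemma coord3_12_self [simp]: "coord3 1 2 (x $ 1) (x $ 2) (x $ 3) = x"
  by (simp add: coord3_def vec_eq_iff forall_3)

lemma has_pd_vp_z:
  assumes f: "continuous_on slab f"
  shows "has_pd 3 (vp f) f"
  unfolding has_pd_def
proof
  fix x :: "real^3" assume x: "x \<in> slab"
  let ?g = "\<lambda>s. f (coord3 1 2 (x $ 1) (x $ 2) s)"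
  have x3: "x $ 3 \<in> {0..1}" using x by (simp add: slab_def)
  have c: "continuous_on {0..1} ?g"
    by (rule continuous_on_compose2[OF f]) (auto intro!: continuous_intros)
  have S: "{s. x + s *\<^sub>R axis 3 1 \<in> slab} = {s. x $ 3 + s \<in> {0..1}}"
    by (auto simp: slab_def axis_def)
  have im: "(+) (x $ 3) ` {s. x $ 3 + s \<in> {0..1}} = {0..1}"
    by (force simp: image_iff intro!: exI[of _ "_ - x $ 3"])
  have "((\<lambda>z. integral {0..z} ?g) has_real_derivative f x) (at (x $ 3 + 0) within (+) (x $ 3) ` {s. x $ 3 + s \<in> {0..1}})"
    unfolding im using integral_has_real_derivative[OF c x3] by simp
  then have "((\<lambda>s. integral {0..x $ 3 + s} ?g) has_real_derivative f x) (at 0 within {s. x + s *\<^sub>R axis 3 1 \<in> slab})"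
    unfolding DERIV_at_within_shift S .
  then show "((\<lambda>s. vp f (x + s *\<^sub>R axis 3 1)) has_real_derivative f x) (at 0 within {s. x + s *\<^sub>R axis 3 1 \<in> slab})"
    by (simp add: vp_def axis_def)
qed

lemma coord3_12_shift:
  "i \<noteq> 3 \<Longrightarrow> coord3 1 2 ((x + s *\<^sub>R axis i 1) $ 1) ((x + s *\<^sub>R axis i 1) $ 2) c = coord3 1 2 (x $ 1) (x $ 2) c + s *\<^sub>R axis i 1"
  using exhaust_3[of i] by (auto simp: vec_eq_iff coord3_def axis_def forall_3)

lemma slab_line_UNIV: "i \<noteq> 3 \<Longrightarrow> x \<in> slab \<Longrightarrow> x + s *\<^sub>R axis i 1 \<in> slab"
  using exhaust_3[of i] by (auto simp: slab_def axis_def)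

lemma has_pd_vp_xy:
  assumes h: "has_pd i f f'" and f: "continuous_on slab f" "continuous_on slab f'" and i: "i \<noteq> 3"
  shows "has_pd i (vp f) (vp f')"
  unfolding has_pd_def
proof
  fix x :: "real^3" assume x: "x \<in> slab"
  have x3: "x $ 3 \<in> {0..1}" using x by (simp add: slab_def)
  have sl: "coord3 1 2 (x $ 1) (x $ 2) c + s *\<^sub>R axis i 1 \<in> slab" if "c \<in> {0..x $ 3}" for c s
    by (rule slab_line_UNIV[OF i]) (use that x3 in auto)
  have "((\<lambda>s. integral (cbox 0 (x $ 3)) (\<lambda>c. f (coord3 1 2 (x $ 1) (x $ 2) c + s *\<^sub>R axis i 1)))
     has_vector_derivative integral (cbox 0 (x $ 3)) (\<lambda>c. f' (coord3 1 2 (x $ 1) (x $ 2) c + 0 *\<^sub>R axis i 1)))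
     (at 0 within UNIV)"
  proof (rule leibniz_rule_vector_derivative)
    show "((\<lambda>s. f (coord3 1 2 (x $ 1) (x $ 2) c + s *\<^sub>R axis i 1)) has_vector_derivative
         f' (coord3 1 2 (x $ 1) (x $ 2) c + s *\<^sub>R axis i 1)) (at s within UNIV)" if "c \<in> cbox 0 (x $ 3)" for s c
      using has_pd_line[OF h sl[of c s]] that sl[of c]
      by (simp add: has_real_derivative_iff_has_vector_derivative)
    show "(\<lambda>c. f (coord3 1 2 (x $ 1) (x $ 2) c + s *\<^sub>R axis i 1)) integrable_on cbox 0 (x $ 3)" for s
      by (intro integrable_continuous continuous_on_compose2[OF f(1)] continuous_intros) (use sl in auto)
    show "continuous_on (UNIV \<times> cbox 0 (x $ 3)) (\<lambda>(s, c). f' (coord3 1 2 (x $ 1) (x $ 2) c + s *\<^sub>R axis i 1))"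
      unfolding split_beta
      by (rule continuous_on_compose2[OF f(2)]) (use sl in \<open>auto intro!: continuous_intros\<close>)
  qed auto
  moreover have "vp f (x + s *\<^sub>R axis i 1) = integral (cbox 0 (x $ 3)) (\<lambda>c. f (coord3 1 2 (x $ 1) (x $ 2) c + s *\<^sub>R axis i 1))" for s
    unfolding vp_def coord3_12_shift[OF i] using i by (simp add: axis_def)
  moreover have "{s. x + s *\<^sub>R axis i 1 \<in> slab} = UNIV" using slab_line_UNIV[OF i x] by auto
  ultimately show "((\<lambda>s. vp f (x + s *\<^sub>R axis i 1)) has_real_derivative vp f' x) (at 0 within {s. x + s *\<^sub>R axis i 1 \<in> slab})"
    by (simp add: has_real_derivative_iff_has_vector_derivative vp_def)
qed

context cell
begin

lemma fld_divide: "fld f \<Longrightarrow> fld (\<lambda>x. f x / c)"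
  using fld_mult[OF _ fld_const, of f "1 / c"] by simp

lemma fld_vp: assumes f: "fld f" shows "fld (vp f)"
proof -
  have cf: "continuous_on slab f" using f by (simp add: fld_def)
  have sc: "coord3 1 2 (x $ 1) (x $ 2) (x $ 3 * s) \<in> slab" if "x \<in> slab" "s \<in> {0..1}" for x s
    using that by (auto simp: slab_def mult_le_one)
  have e: "vp f x = x $ 3 * integral {0..1} (\<lambda>s. f (coord3 1 2 (x $ 1) (x $ 2) (x $ 3 * s)))" if x: "x \<in> slab" for x
    unfolding vp_def
    by (rule integral_rescale_unit) (use x in \<open>auto intro!: continuous_on_compose2[OF cf] continuous_intros simp: slab_def\<close>)
  have "continuous_on slab (\<lambda>x. integral (cbox 0 1) (\<lambda>s::real. f (coord3 1 2 (x $ 1) (x $ 2) (x $ 3 * s))))"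
    by (rule integral_continuous_on_param, unfold split_beta, rule continuous_on_compose2[OF cf])
       (use sc in \<open>auto intro!: continuous_intros\<close>)
  then have "continuous_on slab (\<lambda>x. x $ 3 * integral {0..1} (\<lambda>s. f (coord3 1 2 (x $ 1) (x $ 2) (x $ 3 * s))))"
    by (intro continuous_intros) simp
  then have "continuous_on slab (vp f)"
    using e by (simp cong: continuous_on_cong)
  moreover have "periodic_xy Lx Ly (vp f)"
    unfolding periodic_xy_def
  proof (intro ballI conjI)
    fix x :: "real^3" assume x: "x \<in> slab"
    have p: "f (coord3 1 2 (x $ 1) (x $ 2) s + axis 1 Lx) = f (coord3 1 2 (x $ 1) (x $ 2) s)"
      "f (coord3 1 2 (x $ 1) (x $ 2) s + axis 2 Ly) = f (coord3 1 2 (x $ 1) (x $ 2) s)" if "s \<in> {0..x $ 3}" for s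
      using f x that unfolding fld_def periodic_xy_def slab_def by simp_all
    show "vp f (x + axis 1 Lx) = vp f x"
      using coord3_12_shift[of 1 x Lx] p(1) unfolding vp_def scaleR_axis_one
      by (auto simp: axis_def intro!: integral_cong)
    show "vp f (x + axis 2 Ly) = vp f x"
      using coord3_12_shift[of 2 x Ly] p(2) unfolding vp_def scaleR_axis_one
      by (auto simp: axis_def intro!: integral_cong)
  qed
  ultimately show ?thesis by (simp add: fld_def)
qed

section \<open>Inequalities on vertical lines\<close>

lemma d123: "distinct [1, 2, 3 :: 3]" "distinct [3, 2, 1 :: 3]" "distinct [3, 1, 2 :: 3]" by auto

lemma fld_slice:
  assumes "fld f" "distinct [i, j, k]" "a \<in> {0..per$i}" "b \<in> {0..per$j}"
  shows "continuous_on {0..per$k} (\<lambda>c. f (coord3 i j a b c))"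
  using continuous_on_slice[OF assms(2) fld_box[OF assms(1)]] assms(3,4) by simp

lemma has_pd_z_line:
  assumes "has_pd 3 f f'" "z \<in> {0..1}"
  shows "((\<lambda>z. f (coord3 1 2 a b z)) has_real_derivative f' (coord3 1 2 a b z)) (at z within {0..1})"
  by (rule has_pd_coord3[OF assms(1) d123(1)]) (use assms(2) in auto)

lemma vint_dirichlet:
  assumes h: "has_pd 3 f f'" and f: "fld f" "fld f'" and w: "\<forall>x\<in>S_minus \<union> S_plus. f x = 0"
  shows "pi\<^sup>2 * vint (\<lambda>x. (f x)\<^sup>2) \<le> vint (\<lambda>x. (f' x)\<^sup>2)"
proof -
  have "vint (\<lambda>x. pi\<^sup>2 * (f x)\<^sup>2) \<le> vint (\<lambda>x. (f' x)\<^sup>2)"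
  proof (rule vint_slice_mono[OF _ _ d123(1)])
    fix a b assume ab: "a \<in> {0..per$1}" "b \<in> {0..per$2}"
    have "coord3 1 2 a b 0 \<in> S_minus" "coord3 1 2 a b 1 \<in> S_plus" by (auto simp: S_minus_def S_plus_def)
    then have "(pi / (1 - 0))\<^sup>2 * integral {0..1} (\<lambda>c. (f (coord3 1 2 a b c))\<^sup>2) \<le> integral {0..1} (\<lambda>c. (f' (coord3 1 2 a b c))\<^sup>2)"
      by (intro wirtinger_dirichlet has_pd_z_line h) (use fld_slice[OF f(2) d123(1) ab] w in auto)
    then show "integral {0..per$3} (\<lambda>c. pi\<^sup>2 * (f (coord3 1 2 a b c))\<^sup>2) \<le> integral {0..per$3} (\<lambda>c. (f' (coord3 1 2 a b c))\<^sup>2)"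
      by simp
  qed (auto intro!: fld_intros f)
  then show ?thesis by (simp add: vint_cmult)
qed

text \<open>On each vertical line the square of the primitive at height z is at most z times the
  integral of the squared integrand; integrating z over the unit interval gives 1/2.\<close>

lemma vint_vp_le:
  assumes f: "fld f"
  shows "vint (\<lambda>x. (vp f x)\<^sup>2) \<le> 1/2 * vint (\<lambda>x. (f x)\<^sup>2)"
proof -
  have h: "has_pd 3 (vp f) f" using has_pd_vp_z f by (simp add: fld_def)
  have "vint (\<lambda>x. (vp f x)\<^sup>2) \<le> vint (\<lambda>x. 1/2 * (f x)\<^sup>2)"
  proof (rule vint_slice_mono[OF _ _ d123(1)])
    fix a b assume ab: "a \<in> {0..per$1}" "b \<in> {0..per$2}"
    let ?A = "integral {0..1} (\<lambda>c. (f (coord3 1 2 a b c))\<^sup>2)"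
    have c: "continuous_on {0..1} (\<lambda>c. f (coord3 1 2 a b c))" "continuous_on {0..1} (\<lambda>c. vp f (coord3 1 2 a b c))"
      using fld_slice[OF f d123(1) ab] fld_slice[OF fld_vp[OF f] d123(1) ab] by simp_all
    have "(vp f (coord3 1 2 a b z))\<^sup>2 \<le> z * ?A" if "z \<in> {0..1}" for z
      by (rule square_le_integral_deriv[OF has_pd_z_line[OF h]]) (use that c in \<open>auto simp: vp_def\<close>)
    then have "integral {0..1} (\<lambda>c. (vp f (coord3 1 2 a b c))\<^sup>2) \<le> integral {0..1} (\<lambda>z. z * ?A)"
      by (intro integral_le integrable_continuous_real continuous_intros c)
    also have "\<dots> = 1/2 * ?A" by (simp add: ident_has_integral[THEN integral_unique])
    finally show "integral {0..per$3} (\<lambda>c. (vp f (coord3 1 2 a b c))\<^sup>2) \<le> integral {0..per$3} (\<lambda>c. 1/2 * (f (coord3 1 2 a b c))\<^sup>2)"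
      by simp
  qed (auto intro!: fld_intros fld_divide f fld_vp)
  then show ?thesis by (simp only: vint_cmult)
qed

text \<open>Since \<open>v\<close> vanishes at the bottom, its supremum on a vertical line is
  controlled by \<open>v'\<close> in the mean square sense. Hence \<open>g\<close> enters only
  through its one-dimensional L2 norm; with \<open>g\<close> the slope of \<open>\<tau>\<close> this
  is the origin of the norm of \<open>\<tau>'\<close> in the theorem.\<close>

lemma vint_mult_z_le:
  assumes h: "has_pd 3 v v'" and v: "fld v" "fld v'" and w: "\<forall>x\<in>S_minus. v x = 0"
    and g: "continuous_on {0..1} g"
  shows "vint (\<lambda>x. (v x * g (x $ 3))\<^sup>2) \<le> integral {0..1} (\<lambda>z. (g z)\<^sup>2) * vint (\<lambda>x. (v' x)\<^sup>2)"
proof -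
  let ?G = "integral {0..1} (\<lambda>z. (g z)\<^sup>2)"
  have "vint (\<lambda>x. (v x * g (x $ 3))\<^sup>2) \<le> vint (\<lambda>x. ?G * (v' x)\<^sup>2)"
  proof (rule vint_slice_mono[OF _ _ d123(1)])
    fix a b assume ab: "a \<in> {0..per$1}" "b \<in> {0..per$2}"
    let ?A = "integral {0..1} (\<lambda>c. (v' (coord3 1 2 a b c))\<^sup>2)"
    have c: "continuous_on {0..1} (\<lambda>c. v (coord3 1 2 a b c))" "continuous_on {0..1} (\<lambda>c. v' (coord3 1 2 a b c))"
      using fld_slice[OF v(1) d123(1) ab] fld_slice[OF v(2) d123(1) ab] by simp_all
    have A: "0 \<le> ?A" by (intro integral_nonneg integrable_continuous_real continuous_intros c) auto
    have "(v (coord3 1 2 a b z))\<^sup>2 \<le> ?A" if z: "z \<in> {0..1}" for z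
    proof -
      have "(v (coord3 1 2 a b z))\<^sup>2 \<le> z * ?A"
        by (rule square_le_integral_deriv[OF has_pd_z_line[OF h]]) (use z c w in \<open>auto simp: S_minus_def\<close>)
      also have "\<dots> \<le> ?A" using z A by (simp add: mult_left_le_one_le)
      finally show ?thesis .
    qed
    then have "integral {0..1} (\<lambda>c. (v (coord3 1 2 a b c) * g c)\<^sup>2) \<le> integral {0..1} (\<lambda>z. ?A * (g z)\<^sup>2)"
      by (intro integral_le integrable_continuous_real continuous_intros c g) (auto simp: power_mult_distrib mult_right_mono)
    then show "integral {0..per$3} (\<lambda>c. (v (coord3 1 2 a b c) * g (coord3 1 2 a b c $ 3))\<^sup>2) \<le> integral {0..per$3} (\<lambda>c. ?G * (v' (coord3 1 2 a b c))\<^sup>2)"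
      by (simp add: mult.commute)
  qed (auto intro!: fld_intros v fld_z g)
  then show ?thesis by (simp only: vint_cmult)
qed

end

section \<open>Horizontal means and the Poincare inequality\<close>

context cell
begin

text \<open>Not divided by the area of the cell, so that integrating over \<open>z\<close> yields
  \<open>vint\<close> directly.\<close>

definition hmean :: "(real^3 \<Rightarrow> real) \<Rightarrow> real \<Rightarrow> real" where
  "hmean f z = integral (cbox (0, 0) (Lx, Ly)) (\<lambda>p. f (coord3 1 2 (fst p) (snd p) z))"

lemma continuous_on_horizontal:
  assumes f: "fld f" and z: "z \<in> {0..1}"
  shows "continuous_on S (\<lambda>p. f (coord3 1 2 (fst p) (snd p) z))"
  by (rule continuous_on_compose2[of slab f]) (use f z in \<open>auto intro!: continuous_intros simp: fld_def\<close>)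

lemma fld_line_UNIV:
  assumes f: "fld f" and z: "z \<in> {0..1}"
  shows "continuous_on S (\<lambda>x. f (coord3 1 2 x y z))" "continuous_on S (\<lambda>y. f (coord3 1 2 x y z))"
  by (rule continuous_on_compose2[of slab f]; use f z in \<open>auto intro!: continuous_intros simp: fld_def\<close>)+

lemma hmean_iterated:
  assumes f: "fld f" and z: "z \<in> {0..1}"
  shows "hmean f z = integral {0..Lx} (\<lambda>x. integral {0..Ly} (\<lambda>y. f (coord3 1 2 x y z)))"
    and "hmean f z = integral {0..Ly} (\<lambda>y. integral {0..Lx} (\<lambda>x. f (coord3 1 2 x y z)))"
proof -
  have c: "continuous_on (cbox (0, 0) (Lx, Ly)) (\<lambda>(x, y). f (coord3 1 2 x y z))"
    using continuous_on_horizontal[OF f z] by (simp add: case_prod_unfold)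
  show 1: "hmean f z = integral {0..Lx} (\<lambda>x. integral {0..Ly} (\<lambda>y. f (coord3 1 2 x y z)))"
    unfolding hmean_def using integral_prod_continuous[OF c] by (simp add: case_prod_unfold)
  show "hmean f z = integral {0..Ly} (\<lambda>y. integral {0..Lx} (\<lambda>x. f (coord3 1 2 x y z)))"
    unfolding 1 using integral_swap_continuous[OF c] by simp
qed

lemma fld_periodic:
  assumes "fld f" "z \<in> {0..1}"
  shows "f (coord3 1 2 (x + Lx) y z) = f (coord3 1 2 x y z)" "f (coord3 1 2 x (y + Ly) z) = f (coord3 1 2 x y z)"
proof -
  have "coord3 1 2 (x + Lx) y z = coord3 1 2 x y z + axis 1 Lx" "coord3 1 2 x (y + Ly) z = coord3 1 2 x y z + axis 2 Ly"
    by (auto simp: vec_eq_iff coord3_def axis_def)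
  then show "f (coord3 1 2 (x + Lx) y z) = f (coord3 1 2 x y z)" "f (coord3 1 2 x (y + Ly) z) = f (coord3 1 2 x y z)"
    using assms by (auto simp: fld_def periodic_xy_def)
qed

lemma coord3_perm: "coord3 3 2 z y x = coord3 1 2 x y z" "coord3 3 1 z x y = coord3 1 2 x y z"
  "coord3 2 3 y z x = coord3 1 2 x y z" "coord3 1 3 x z y = coord3 1 2 x y z"
  by (auto simp: vec_eq_iff coord3_def forall_3)

lemma has_pd_x_line:
  assumes "has_pd 1 f f'" "z \<in> {0..1}"
  shows "((\<lambda>x. f (coord3 1 2 x y z)) has_real_derivative f' (coord3 1 2 x y z)) (at x within S)"
  using has_pd_coord3[OF assms(1) d123(2), of z y x S] assms(2) by (simp add: coord3_perm)

lemma has_pd_y_line: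
  assumes "has_pd 2 f f'" "z \<in> {0..1}"
  shows "((\<lambda>y. f (coord3 1 2 x y z)) has_real_derivative f' (coord3 1 2 x y z)) (at y within S)"
  using has_pd_coord3[OF assms(1) d123(3), of z x y S] assms(2) by (simp add: coord3_perm)

lemma hmean_partial:
  assumes h: "has_pd k f f'" and k: "k \<noteq> 3" and f: "fld f" "fld f'" and z: "z \<in> {0..1}"
  shows "hmean f' z = 0"
proof -
  consider "k = 1" | "k = 2" using k exhaust_3[of k] by auto
  then show ?thesis
  proof cases
    case 1
    have "integral {0..Lx} (\<lambda>x. f' (coord3 1 2 x y z)) = 0" for y
      using integral_FTC_real[of 0 Lx "\<lambda>x. f (coord3 1 2 x y z)"] has_pd_x_line[OF h[unfolded 1] z] Lx
        fld_periodic(1)[OF f(1) z, of 0 y] by simp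
    then show ?thesis by (simp add: hmean_iterated(2)[OF f(2) z])
  next
    case 2
    have "integral {0..Ly} (\<lambda>y. f' (coord3 1 2 x y z)) = 0" for x
      using integral_FTC_real[of 0 Ly "\<lambda>y. f (coord3 1 2 x y z)"] has_pd_y_line[OF h[unfolded 2] z] Ly
        fld_periodic(2)[OF f(1) z, of x 0] by simp
    then show ?thesis by (simp add: hmean_iterated(1)[OF f(2) z])
  qed
qed

lemma hmean_deriv:
  assumes h: "has_pd 3 f f'" and f: "fld f" "fld f'" and z: "z \<in> {0..1}"
  shows "(hmean f has_real_derivative hmean f' z) (at z within {0..1})"
  unfolding hmean_def[abs_def] has_real_derivative_iff_has_vector_derivative
proof (rule leibniz_rule_vector_derivative)
  show "((\<lambda>z. f (coord3 1 2 (fst p) (snd p) z)) has_vector_derivative f' (coord3 1 2 (fst p) (snd p) z)) (at z within {0..1})"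
    if "z \<in> {0..1}" for p z
    using has_pd_z_line[OF h that] by (simp add: has_real_derivative_iff_has_vector_derivative)
  show "(\<lambda>p. f (coord3 1 2 (fst p) (snd p) z)) integrable_on cbox (0, 0) (Lx, Ly)" if "z \<in> {0..1}" for z
    by (intro integrable_continuous continuous_on_horizontal f that)
  show "continuous_on ({0..1} \<times> cbox (0, 0) (Lx, Ly)) (\<lambda>(z, p). f' (coord3 1 2 (fst p) (snd p) z))"
    unfolding split_beta
    by (rule continuous_on_compose2[of slab f']) (use f in \<open>auto intro!: continuous_intros simp: fld_def\<close>)
qed (use z in auto)

text \<open>Integrating the divergence over a horizontal cross-section kills the two tangential
  terms by periodicity. The flux of \<open>f3\<close> through the section is therefore independent
  of height, and it vanishes at the bottom.\<close>

lemma hmean_eq_0: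
  assumes h: "has_pd 1 f1 g1" "has_pd 2 f2 g2" "has_pd 3 f3 g3"
    and f: "fld f1" "fld g1" "fld f2" "fld g2" "fld f3" "fld g3"
    and div0: "\<And>x. x \<in> slab \<Longrightarrow> g1 x + g2 x + g3 x = 0"
    and flux: "hmean f3 0 = 0" and z: "z \<in> {0..1}"
  shows "hmean f3 z = 0"
proof -
  have g3: "hmean g3 s = 0" if s: "s \<in> {0..1}" for s
  proof -
    have "hmean g3 s = integral (cbox (0, 0) (Lx, Ly)) (\<lambda>p. - (g1 (coord3 1 2 (fst p) (snd p) s) + g2 (coord3 1 2 (fst p) (snd p) s)))"
      unfolding hmean_def
    proof (rule integral_cong)
      fix p :: "real \<times> real"
      have "coord3 1 2 (fst p) (snd p) s \<in> slab" using s by simp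
      from div0[OF this] show "g3 (coord3 1 2 (fst p) (snd p) s) = - (g1 (coord3 1 2 (fst p) (snd p) s) + g2 (coord3 1 2 (fst p) (snd p) s))"
        by linarith
    qed
    also have "\<dots> = - (hmean g1 s + hmean g2 s)"
      unfolding hmean_def by (subst integral_neg, subst integral_add)
        (auto intro!: integrable_continuous continuous_on_horizontal f s simp del: atLeastAtMost_iff)
    also have "\<dots> = 0" using hmean_partial[OF h(1)] hmean_partial[OF h(2)] f s by simp
    finally show ?thesis .
  qed
  have "(hmean f3 has_real_derivative 0) (at s within {0..1})" if "s \<in> {0..1}" for s
    using hmean_deriv[OF h(3) f(5,6) that] g3[OF that] by simp
  then have "(hmean f3 has_real_derivative 0) (at s within {0..z})" if "s \<in> {0..z}" for s
    by (rule DERIV_subset) (use z that in auto)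
  then have "integral {0..z} (\<lambda>s. 0) = hmean f3 z - hmean f3 0"
    using z by (intro integral_FTC_real) auto
  then show ?thesis using flux by simp
qed

text \<open>Wirtinger in \<open>x\<close>, then in \<open>y\<close> for the \<open>x\<close>-means.\<close>

lemma horizontal_poincare:
  assumes h: "has_pd 1 f f1" "has_pd 2 f f2" and f: "fld f" "fld f1" "fld f2"
    and mean: "\<And>z. z \<in> {0..1} \<Longrightarrow> hmean f z = 0"
  shows "vint (\<lambda>x. (f x)\<^sup>2) \<le> (Lx / (2 * pi))\<^sup>2 * vint (\<lambda>x. (f1 x)\<^sup>2) + (Ly / (2 * pi))\<^sup>2 * vint (\<lambda>x. (f2 x)\<^sup>2)"
proof -
  define G where "G x = (Lx / (2 * pi))\<^sup>2 * (f1 x)\<^sup>2 + (Ly / (2 * pi))\<^sup>2 * (f2 x)\<^sup>2" for x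
  have fG: "fld G" unfolding G_def[abs_def] by (intro fld_intros f)
  have f2': "fld (\<lambda>x. (f x)\<^sup>2)" "fld (\<lambda>x. (f1 x)\<^sup>2)" "fld (\<lambda>x. (f2 x)\<^sup>2)" by (intro fld_intros f)+
  have main: "integral {0..Ly} (\<lambda>y. integral {0..Lx} (\<lambda>x. (f (coord3 1 2 x y z))\<^sup>2))
    \<le> integral {0..Ly} (\<lambda>y. integral {0..Lx} (\<lambda>x. G (coord3 1 2 x y z)))" if z: "z \<in> {0..1}" for z
  proof -
    let ?M = "\<lambda>y. integral {0..Lx} (\<lambda>x. f (coord3 1 2 x y z))"
    let ?M2 = "\<lambda>y. integral {0..Lx} (\<lambda>x. f2 (coord3 1 2 x y z))"
    have cI: "continuous_on S (\<lambda>y. integral {0..Lx} (\<lambda>x. g (coord3 1 2 x y z)))" if "fld g" for g S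
      unfolding cbox_interval[symmetric]
      by (rule integral_continuous_on_param, unfold split_beta, rule continuous_on_compose2[of slab g])
         (use that z in \<open>auto intro!: continuous_intros simp: fld_def\<close>)
    note cs = fld_line_UNIV[OF _ z]
    have Md: "(?M has_real_derivative ?M2 y) (at y)" for y
      unfolding has_real_derivative_iff_has_vector_derivative cbox_interval[symmetric]
    proof (rule leibniz_rule_vector_derivative[where U = UNIV])
      show "((\<lambda>y. f (coord3 1 2 x y z)) has_vector_derivative f2 (coord3 1 2 x y z)) (at y)" for x y
        using has_pd_y_line[OF h(2) z] by (simp add: has_real_derivative_iff_has_vector_derivative)
      show "(\<lambda>x. f (coord3 1 2 x y z)) integrable_on cbox 0 Lx" for y
        by (intro integrable_continuous cs f)
      show "continuous_on (UNIV \<times> cbox 0 Lx) (\<lambda>(y, x). f2 (coord3 1 2 x y z))"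
        unfolding split_beta
        by (rule continuous_on_compose2[of slab f2]) (use f z in \<open>auto intro!: continuous_intros simp: fld_def\<close>)
    qed auto
    have x: "integral {0..Lx} (\<lambda>x. (f (coord3 1 2 x y z))\<^sup>2)
       \<le> (Lx / (2 * pi))\<^sup>2 * integral {0..Lx} (\<lambda>x. (f1 (coord3 1 2 x y z))\<^sup>2) + (?M y)\<^sup>2 / Lx" for y
      by (rule wirtinger_periodic[OF Lx]) (use has_pd_x_line[OF h(1) z] cs f fld_periodic[OF f(1) z] in auto)
    have "integral {0..Ly} (\<lambda>y. (?M y)\<^sup>2) \<le> (Ly / (2 * pi))\<^sup>2 * integral {0..Ly} (\<lambda>y. (?M2 y)\<^sup>2) + (integral {0..Ly} ?M)\<^sup>2 / Ly"
      by (rule wirtinger_periodic[OF Ly]) (use Md cI f fld_periodic[OF f(1) z] in auto)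
    also have "integral {0..Ly} ?M = 0" using mean[OF z] hmean_iterated(2)[OF f(1) z] by simp
    finally have y: "integral {0..Ly} (\<lambda>y. (?M y)\<^sup>2) \<le> (Ly / (2 * pi))\<^sup>2 * integral {0..Ly} (\<lambda>y. (?M2 y)\<^sup>2)" by simp
    \<comment> \<open>The factor \<open>Lx\<close> from Cauchy--Schwarz cancels the
      \<open>1 / Lx\<close> in front of the squared mean in \<open>wirtinger_periodic\<close>, so
      the constant in \<open>y\<close> stays sharp.\<close>
    have "(?M2 y)\<^sup>2 \<le> Lx * integral {0..Lx} (\<lambda>x. (f2 (coord3 1 2 x y z))\<^sup>2)" for y
      using integral_square_mult_le[of 0 Lx "\<lambda>x. f2 (coord3 1 2 x y z)" "\<lambda>x. 1"] cs f Lx by (simp add: mult.commute)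
    then have y2: "integral {0..Ly} (\<lambda>y. (?M2 y)\<^sup>2) \<le> integral {0..Ly} (\<lambda>y. Lx * integral {0..Lx} (\<lambda>x. (f2 (coord3 1 2 x y z))\<^sup>2))"
      by (intro integral_le integrable_continuous_real continuous_intros cI f f2')
    have "integral {0..Ly} (\<lambda>y. integral {0..Lx} (\<lambda>x. (f (coord3 1 2 x y z))\<^sup>2))
      \<le> integral {0..Ly} (\<lambda>y. (Lx / (2 * pi))\<^sup>2 * integral {0..Lx} (\<lambda>x. (f1 (coord3 1 2 x y z))\<^sup>2) + (?M y)\<^sup>2 * (1 / Lx))"
      using x Lx by (intro integral_le integrable_continuous_real continuous_intros cI f f2') simp_all
    also have "\<dots> = (Lx / (2 * pi))\<^sup>2 * integral {0..Ly} (\<lambda>y. integral {0..Lx} (\<lambda>x. (f1 (coord3 1 2 x y z))\<^sup>2)) + integral {0..Ly} (\<lambda>y. (?M y)\<^sup>2) * (1 / Lx)"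
      by (subst integral_add) (use Lx in \<open>auto intro!: integrable_continuous_real continuous_intros cI f f2'\<close>)
    also have "integral {0..Ly} (\<lambda>y. (?M y)\<^sup>2) * (1 / Lx) \<le> (Ly / (2 * pi))\<^sup>2 * integral {0..Ly} (\<lambda>y. integral {0..Lx} (\<lambda>x. (f2 (coord3 1 2 x y z))\<^sup>2))"
    proof -
      have "integral {0..Ly} (\<lambda>y. (?M y)\<^sup>2) \<le> (Ly / (2 * pi))\<^sup>2 * (Lx * integral {0..Ly} (\<lambda>y. integral {0..Lx} (\<lambda>x. (f2 (coord3 1 2 x y z))\<^sup>2)))"
        using order_trans[OF y mult_left_mono[OF y2]] by simp
      then show ?thesis using Lx by (simp add: field_simps)
    qed
    also have "(Lx / (2 * pi))\<^sup>2 * integral {0..Ly} (\<lambda>y. integral {0..Lx} (\<lambda>x. (f1 (coord3 1 2 x y z))\<^sup>2)) + \<dots>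
      = integral {0..Ly} (\<lambda>y. integral {0..Lx} (\<lambda>x. G (coord3 1 2 x y z)))"
    proof -
      have "integral {0..Lx} (\<lambda>x. G (coord3 1 2 x y z)) = (Lx / (2 * pi))\<^sup>2 * integral {0..Lx} (\<lambda>x. (f1 (coord3 1 2 x y z))\<^sup>2)
         + (Ly / (2 * pi))\<^sup>2 * integral {0..Lx} (\<lambda>x. (f2 (coord3 1 2 x y z))\<^sup>2)" for y
        unfolding G_def by (subst integral_add) (auto intro!: integrable_continuous_real cs fld_intros f)
      then show ?thesis
        by simp (subst integral_add, auto intro!: integrable_continuous_real continuous_intros cI f2')
    qed
    finally show ?thesis by simp
  qed
  have it: "vint g = integral {0..1} (\<lambda>z. integral {0..Ly} (\<lambda>y. integral {0..Lx} (\<lambda>x. g (coord3 1 2 x y z))))"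
    and cit: "continuous_on {0..1} (\<lambda>z. integral {0..Ly} (\<lambda>y. integral {0..Lx} (\<lambda>x. g (coord3 1 2 x y z))))"
    if "fld g" for g
    using integral_box_pair(2)[OF d123(2) fld_box[OF that]] continuous_on_slice_integral2[OF d123(2) fld_box[OF that]]
    by (simp_all add: vint_def box_V_def coord3_perm)
  have "vint (\<lambda>x. (f x)\<^sup>2) \<le> vint G"
    unfolding it[OF fG] it[OF f2'(1)]
    by (intro integral_le integrable_continuous_real cit fG f2' main)
  also have "vint G = (Lx / (2 * pi))\<^sup>2 * vint (\<lambda>x. (f1 x)\<^sup>2) + (Ly / (2 * pi))\<^sup>2 * vint (\<lambda>x. (f2 x)\<^sup>2)"
    unfolding G_def[abs_def] by (subst vint_add) (auto intro!: fld_intros f simp: vint_cmult)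
  finally show ?thesis .
qed

end

section \<open>The Sobolev inequality\<close>

text \<open>The difference of the two sides is a combination of squares with nonnegative
  coefficients, displayed in the proof.\<close>

lemma amgm3:
  fixes x y z :: real
  assumes "0 \<le> x" "0 \<le> y" "0 \<le> z"
  shows "27 * (x * y * z) \<le> (x + y + z) ^ 3"
proof -
  have "(x + y + z) ^ 3 - 27 * (x * y * z) = 3 * (x * (y - z)\<^sup>2 + y * (z - x)\<^sup>2 + z * (x - y)\<^sup>2)
     + (x + y + z) * ((x - y)\<^sup>2 + (y - z)\<^sup>2 + (z - x)\<^sup>2) / 2"
    by (simp add: power2_eq_square power3_eq_cube field_simps)
  moreover have "0 \<le> \<dots>" using assms by (intro add_nonneg_nonneg mult_nonneg_nonneg divide_nonneg_nonneg) auto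
  ultimately show ?thesis by simp
qed

text \<open>The sixth power clears all roots: it equals 8192 / (27 pi^4), and
  \<open>pi <= 22/7\<close> makes the comparison rational.\<close>

lemma C_3_lower: "6 / 5 \<le> 2 * sqrt 2 * C_3"
proof -
  have C: "0 \<le> C_3" by (simp add: C_3_def)
  have p: "pi ^ 4 \<le> (22 / 7) ^ 4" using pi_approx by (intro power_mono) auto
  have s2: "sqrt 2 ^ 6 = (8::real)" "sqrt 3 ^ 6 = (27::real)"
    using power_mult[of "sqrt 2" 2 3] power_mult[of "sqrt 3" 2 3] by simp_all
  have pw: "(x powr (2/3)) ^ 6 = x ^ 4" if "0 < x" for x :: real
  proof -
    have "(x powr (2/3)) ^ 6 = (x powr (2/3)) powr 6" using that by (simp flip: powr_numeral)
    also have "\<dots> = x powr 4" by (simp add: powr_powr)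
    finally show ?thesis using that by simp
  qed
  have "(2 * sqrt 2 * C_3) ^ 6 = 64 * 8 * 16 / (pi ^ 4 * 27)"
    unfolding C_3_def power_mult_distrib power_divide s2 pw[OF pi_gt_zero] pw[of 2, simplified] by simp
  moreover have "(6 / 5) ^ 6 \<le> 64 * 8 * 16 / (pi ^ 4 * 27)"
  proof -
    have "(6 / 5) ^ 6 * (pi ^ 4 * 27) \<le> (6 / 5) ^ 6 * ((22 / 7) ^ 4 * 27)"
      using p by (intro mult_left_mono mult_right_mono) auto
    also have "\<dots> \<le> (64 * 8 * 16 :: real)" by (simp add: power_divide)
    finally show ?thesis by (simp add: pos_le_divide_eq)
  qed
  ultimately have le: "(6 / 5) ^ 6 \<le> (2 * sqrt 2 * C_3) ^ 6" by simp
  show ?thesis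
  proof (rule ccontr)
    assume "\<not> ?thesis"
    then have "(2 * sqrt 2 * C_3) ^ 6 < (6 / 5) ^ 6" using C by (intro power_strict_mono) auto
    then show False using le by simp
  qed
qed

context cell
begin

lemma lambda1_pos: "0 < lambda1 Lx Ly"
  using Lx Ly by (simp add: lambda1_def)

lemma lambda1_le: "lambda1 Lx Ly \<le> pi" "lambda1 Lx Ly \<le> 2 * pi / Lx" "lambda1 Lx Ly \<le> 2 * pi / Ly"
  by (simp_all add: lambda1_def)

text \<open>The Gagliardo--Nirenberg argument below loses a factor \<open>2\<close> in \<open>z\<close>, where there is no
  periodicity; the slack between \<open>C_S\<close> and Talenti's constant \<open>C_3\<close> absorbs it.\<close>

lemma C_S_lower:
  fixes s' :: real
  defines "s' \<equiv> sqrt (1/4 + 1 / Lx\<^sup>2 + 1 / Ly\<^sup>2) / lambda1 Lx Ly"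
  shows "728/1000 * (2 + s') \<le> C_S Lx Ly"
proof -
  let ?l = "lambda1 Lx Ly"
  define s where "s = sqrt (1 + 1 / Lx\<^sup>2 + 1 / Ly\<^sup>2) / ?l"
  have l: "0 < ?l" by (rule lambda1_pos)
  have R: "0 \<le> 1 / Lx\<^sup>2 + 1 / Ly\<^sup>2" by simp
  have s2: "s\<^sup>2 = (1 + 1 / Lx\<^sup>2 + 1 / Ly\<^sup>2) / ?l\<^sup>2" unfolding s_def using R by (simp add: power_divide)
  \<comment> \<open>\<open>s'\<close> has 1/4 where the definition of \<open>C_S\<close> has 1. The
    1/4 is the square of the coefficient in \<open>F / 2\<close> once the vertical factor
    \<open>4 * d3 + F\<close> is written as \<open>2 * (2 * d3 + F / 2)\<close>.\<close>
  have s'2: "s'\<^sup>2 = s\<^sup>2 - 3/4 / ?l\<^sup>2"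
  proof -
    have "s'\<^sup>2 = (1/4 + 1 / Lx\<^sup>2 + 1 / Ly\<^sup>2) / ?l\<^sup>2" unfolding s'_def using R by (simp add: power_divide)
    also have "\<dots> = ((1 + 1 / Lx\<^sup>2 + 1 / Ly\<^sup>2) - 3/4) / ?l\<^sup>2" by simp
    finally show ?thesis unfolding s2 diff_divide_distrib .
  qed
  have "?l \<le> 22/7" using lambda1_le(1) pi_approx by simp
  then have "?l\<^sup>2 \<le> (22/7)\<^sup>2" using l by (intro power_mono) auto
  then have q: "(7/22)\<^sup>2 \<le> 1 / ?l\<^sup>2" using l by (simp add: field_simps)
  have s_pos: "7/22 \<le> s"
  proof (rule power2_le_imp_le)
    have "1 / ?l\<^sup>2 \<le> s\<^sup>2" unfolding s2 using R by (intro divide_right_mono) auto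
    then show "(7/22)\<^sup>2 \<le> s\<^sup>2" using q by linarith
  qed (auto simp: s_def l less_imp_le)
  \<comment> \<open>Here 256/1000 is \<open>2 * 728/1000 - 6/5\<close>, so the bound rearranges to
    \<open>728/1000 * (2 + s') <= 6/5 * (1 + s)\<close>. The number 728/1000 is a rational upper
    bound for the sixth root of 4/27.\<close>
  have "(728/1000 * s')\<^sup>2 \<le> (6/5 * s - 256/1000)\<^sup>2"
  proof -
    have "(728/1000 * s')\<^sup>2 \<le> 529984/1000000 * (s\<^sup>2 - 3/4 * (7/22)\<^sup>2)"
      unfolding power_mult_distrib s'2 using q by (simp add: power2_eq_square)
    \<comment> \<open>4800/14219 is the vertex of the quadratic polynomial in \<open>s\<close> that
      has to be nonnegative; its minimum value is still positive.\<close>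
    moreover have "0 \<le> (s - 4800/14219)\<^sup>2" by simp
    ultimately show ?thesis
      by (simp add: power2_eq_square algebra_simps)
  qed
  then have "728/1000 * s' \<le> 6/5 * s - 256/1000"
    by (rule power2_le_imp_le) (use s_pos in simp)
  then have "728/1000 * (2 + s') \<le> 6/5 * (1 + s)" by simp
  also have "\<dots> \<le> C_S Lx Ly"
    unfolding C_S_def s_def[symmetric] using C_3_lower s_pos by (intro mult_right_mono) auto
  finally show ?thesis .
qed

text \<open>The three factors are those that Loomis--Whitney leaves in \<open>sobolev\<close>. The
  arithmetic-geometric mean inequality applied to their squares, after the vertical factor has been
  halved, costs \<open>4/27\<close>; the sum of squares is bounded by Cauchy--Schwarz and by the
  Poincare inequality \<open>F <= D / lambda1\<close>.\<close>

lemma sobolev_product_le: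
  assumes d: "0 \<le> d1" "0 \<le> d2" "0 \<le> d3" and D: "0 \<le> D" "D\<^sup>2 = d1\<^sup>2 + d2\<^sup>2 + d3\<^sup>2"
    and F: "0 \<le> F" "lambda1 Lx Ly * F \<le> D"
  shows "(2 * d1 + F / Lx) * (2 * d2 + F / Ly) * (4 * d3 + F) \<le> (C_S Lx Ly * D) ^ 3"
proof -
  define A1 A2 A3 where A: "A1 = 2 * d1 + F / Lx" "A2 = 2 * d2 + F / Ly" "A3 = 2 * d3 + F / 2"
  define S where "S = sqrt (1/4 + 1 / Lx\<^sup>2 + 1 / Ly\<^sup>2)"
  have S2: "S\<^sup>2 = 1/4 + 1 / Lx\<^sup>2 + 1 / Ly\<^sup>2" and S0: "0 \<le> S" unfolding S_def by simp_all
  \<comment> \<open>Cauchy--Schwarz in three dimensions, with the defect given by Lagrange's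
    identity.\<close>
  have cs: "d1 / Lx + d2 / Ly + d3 / 2 \<le> D * S"
  proof (rule power2_le_imp_le)
    have "(D * S)\<^sup>2 - (d1 / Lx + d2 / Ly + d3 / 2)\<^sup>2 = (d1 / Ly - d2 / Lx)\<^sup>2 + (d1 / 2 - d3 / Lx)\<^sup>2 + (d2 / 2 - d3 / Ly)\<^sup>2"
      unfolding power_mult_distrib D(2) S2 by (simp add: power2_eq_square algebra_simps)
    then show "(d1 / Lx + d2 / Ly + d3 / 2)\<^sup>2 \<le> (D * S)\<^sup>2"
      by (smt (verit) zero_le_power2)
  qed (use D S0 in simp)
  have "A1\<^sup>2 + A2\<^sup>2 + A3\<^sup>2 = 4 * D\<^sup>2 + 4 * F * (d1 / Lx + d2 / Ly + d3 / 2) + F\<^sup>2 * S\<^sup>2"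
    unfolding A D(2) S2 by (simp add: power2_eq_square algebra_simps)
  also have "\<dots> \<le> 4 * D\<^sup>2 + 4 * F * (D * S) + F\<^sup>2 * S\<^sup>2"
    using cs F by (intro add_mono mult_left_mono) auto
  also have "\<dots> = (2 * D + F * S)\<^sup>2" by (simp add: power2_eq_square algebra_simps)
  also have "\<dots> \<le> (D * (2 + S / lambda1 Lx Ly))\<^sup>2"
  proof (rule power_mono)
    have "F \<le> D / lambda1 Lx Ly" using F lambda1_pos by (simp add: pos_le_divide_eq mult.commute)
    then have "F * S \<le> D / lambda1 Lx Ly * S" using S0 by (rule mult_right_mono)
    then show "2 * D + F * S \<le> D * (2 + S / lambda1 Lx Ly)" by (simp add: algebra_simps)
  qed (use D F S0 in auto)
  finally have sq: "A1\<^sup>2 + A2\<^sup>2 + A3\<^sup>2 \<le> (D * (2 + S / lambda1 Lx Ly))\<^sup>2" .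
  have C: "728/1000 * (2 + S / lambda1 Lx Ly) \<le> C_S Lx Ly" using C_S_lower unfolding S_def .
  have nn: "0 \<le> D * (2 + S / lambda1 Lx Ly)" using D S0 lambda1_pos by simp
  have "(A1 * A2 * (2 * A3))\<^sup>2 = 4 / 27 * (27 * (A1\<^sup>2 * A2\<^sup>2 * A3\<^sup>2))" by (simp add: power_mult_distrib)
  also have "\<dots> \<le> 4 / 27 * (A1\<^sup>2 + A2\<^sup>2 + A3\<^sup>2) ^ 3"
    by (intro mult_left_mono amgm3) auto
  also have "\<dots> \<le> 4 / 27 * ((D * (2 + S / lambda1 Lx Ly))\<^sup>2) ^ 3"
    using sq by (intro mult_left_mono power_mono) auto
  also have "\<dots> = 4 / 27 * (D * (2 + S / lambda1 Lx Ly)) ^ 6" by (simp flip: power_mult)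
  \<comment> \<open>728/1000 has been chosen so that its sixth power just exceeds 4/27.\<close>
  also have "\<dots> \<le> (728/1000) ^ 6 * (D * (2 + S / lambda1 Lx Ly)) ^ 6"
    using nn by (intro mult_right_mono) (auto simp: power_divide)
  also have "\<dots> = (728/1000 * (D * (2 + S / lambda1 Lx Ly))) ^ 6" by (rule power_mult_distrib[symmetric])
  also have "\<dots> = (D * (728/1000 * (2 + S / lambda1 Lx Ly))) ^ 6" by (subst mult.left_commute) (rule refl)
  also have "\<dots> \<le> (D * C_S Lx Ly) ^ 6"
    using C D S0 lambda1_pos by (intro power_mono mult_left_mono) (auto intro!: mult_nonneg_nonneg)
  also have "\<dots> = ((C_S Lx Ly * D) ^ 3)\<^sup>2" by (simp flip: power_mult add: mult.commute)
  finally have le: "(A1 * A2 * (2 * A3))\<^sup>2 \<le> ((C_S Lx Ly * D) ^ 3)\<^sup>2" .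
  have "0 \<le> C_S Lx Ly"
    by (rule order_trans[OF _ C]) (use S0 lambda1_pos in simp)
  then have "0 \<le> (C_S Lx Ly * D) ^ 3" using D(1) by simp
  with le have "A1 * A2 * (2 * A3) \<le> (C_S Lx Ly * D) ^ 3" by (rule power2_le_imp_le)
  moreover have "2 * A3 = 4 * d3 + F" unfolding A by simp
  ultimately show ?thesis unfolding A(1,2) by metis
qed

end

text \<open>On a closed loop two arcs join \<open>s\<close> and \<open>t\<close>, and the change
  along either bounds the difference, so half the total variation suffices. Without periodicity the
  whole variation is needed, which is the factor 2 lost in the vertical direction.\<close>

lemma integral_abs_diff_le:
  fixes g g' :: "real \<Rightarrow> real"
  assumes d: "\<And>x. x \<in> {0..L} \<Longrightarrow> (g has_real_derivative g' x) (at x within {0..L})"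
    and c: "continuous_on {0..L} g'" and st: "s \<in> {0..L}" "t \<in> {0..L}"
  shows "g t - g s \<le> integral {0..L} (\<lambda>x. \<bar>g' x\<bar>)"
    and "g 0 = g L \<Longrightarrow> g t - g s \<le> 1/2 * integral {0..L} (\<lambda>x. \<bar>g' x\<bar>)"
proof -
  let ?V = "\<lambda>a b. integral {a..b} (\<lambda>x. \<bar>g' x\<bar>)"
  have c': "continuous_on {a..b} g'" if "0 \<le> a" "b \<le> L" for a b
    by (rule continuous_on_subset[OF c]) (use that in auto)
  have D: "\<bar>g b - g a\<bar> \<le> ?V a b" if ab: "0 \<le> a" "a \<le> b" "b \<le> L" for a b
  proof -
    have "g b - g a = integral {a..b} g'"
      by (rule integral_FTC_real[symmetric]) (use ab in \<open>auto intro!: DERIV_subset[OF d]\<close>)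
    then show ?thesis
      using integral_norm_bound_integral[of g' "{a..b}" "\<lambda>x. \<bar>g' x\<bar>"] c'[OF ab(1,3)]
      by (auto intro!: integrable_continuous_real continuous_intros)
  qed
  have i: "(\<lambda>x. \<bar>g' x\<bar>) integrable_on {a..b}" if "0 \<le> a" "b \<le> L" for a b
    by (intro integrable_continuous_real continuous_intros c' that)
  have ord: "\<bar>g v - g u\<bar> \<le> ?V 0 L \<and> (g 0 = g L \<longrightarrow> \<bar>g v - g u\<bar> \<le> 1/2 * ?V 0 L)"
    if uv: "0 \<le> u" "u \<le> v" "v \<le> L" for u v
  proof -
    have "?V 0 L = ?V 0 u + ?V u v + ?V v L"
      using Henstock_Kurzweil_Integration.integral_combine[of 0 u L "\<lambda>x. \<bar>g' x\<bar>"]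
        Henstock_Kurzweil_Integration.integral_combine[of u v L "\<lambda>x. \<bar>g' x\<bar>"] i uv by simp
    moreover have "\<bar>g u - g 0\<bar> \<le> ?V 0 u" "\<bar>g v - g u\<bar> \<le> ?V u v" "\<bar>g L - g v\<bar> \<le> ?V v L"
      using uv by (auto intro!: D)
    ultimately show ?thesis by linarith
  qed
  have "\<bar>g t - g s\<bar> \<le> ?V 0 L \<and> (g 0 = g L \<longrightarrow> \<bar>g t - g s\<bar> \<le> 1/2 * ?V 0 L)"
  proof (cases "s \<le> t")
    case True then show ?thesis using ord[of s t] st by simp
  next
    case False then show ?thesis using ord[of t s] st by (simp add: abs_minus_commute)
  qed
  then show "g t - g s \<le> ?V 0 L" "g 0 = g L \<Longrightarrow> g t - g s \<le> 1/2 * ?V 0 L" by linarith+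
qed

lemma le_mean_add:
  fixes g :: "real \<Rightarrow> real"
  assumes L: "0 < L" and c: "continuous_on {0..L} g" and K: "\<And>s. s \<in> {0..L} \<Longrightarrow> g t - g s \<le> K"
  shows "g t \<le> integral {0..L} g / L + K"
proof -
  have "integral {0..L} (\<lambda>s. g t - K) \<le> integral {0..L} g"
    by (intro integral_le integrable_continuous_real continuous_intros c) (use K in \<open>auto simp: algebra_simps\<close>)
  then show ?thesis using L by (simp add: field_simps)
qed

lemma integral_mult_le_sqrt:
  fixes f g :: "'a::euclidean_space \<Rightarrow> real"
  assumes "continuous_on (cbox a b) f" "continuous_on (cbox a b) g"
  shows "integral (cbox a b) (\<lambda>x. f x * g x)
    \<le> sqrt (integral (cbox a b) (\<lambda>x. (f x)\<^sup>2)) * sqrt (integral (cbox a b) (\<lambda>x. (g x)\<^sup>2))"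
  using real_le_rsqrt[OF integral_square_mult_le[OF assms]] by (simp add: real_sqrt_mult)

context cell
begin

lemma vint_hmean:
  assumes "fld f"
  shows "vint f = integral {0..1} (hmean f)" and "continuous_on {0..1} (hmean f)"
proof -
  have e: "integral {0..Lx} (\<lambda>x. integral {0..Ly} (\<lambda>y. f (coord3 1 2 x y z))) = hmean f z" if "z \<in> {0..1}" for z
    using hmean_iterated(1)[OF assms that] ..
  have "vint f = integral {0..1} (\<lambda>z. integral {0..Lx} (\<lambda>x. integral {0..Ly} (\<lambda>y. f (coord3 1 2 x y z))))"
    using integral_box_pair(2)[OF d123(3) fld_box[OF assms]] by (simp add: vint_def box_V_def coord3_perm)
  also have "\<dots> = integral {0..1} (hmean f)" by (rule integral_cong) (rule e)
  finally show "vint f = integral {0..1} (hmean f)" .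
  have "continuous_on {0..1} (\<lambda>z. integral {0..Lx} (\<lambda>x. integral {0..Ly} (\<lambda>y. f (coord3 1 2 x y z))))"
    using continuous_on_slice_integral2[OF d123(3) fld_box[OF assms]] by (simp add: coord3_perm)
  then show "continuous_on {0..1} (hmean f)" by (rule continuous_on_eq) (rule e)
qed

text \<open>By the three hypotheses \<open>n^3\<close> is at most the root of a product of three
  functions, each independent of one coordinate. Cauchy--Schwarz over the horizontal section at
  fixed \<open>z\<close> separates \<open>q3\<close>; a second one in \<open>z\<close> separates
  \<open>q1\<close> from \<open>q2\<close>.\<close>

lemma loomis_whitney:
  assumes n: "fld n" "\<And>x. x \<in> slab \<Longrightarrow> 0 \<le> n x"
    and q: "fld q1" "fld q2" "fld q3"
    and q0: "\<And>x. x \<in> slab \<Longrightarrow> 0 \<le> q1 x" "\<And>x. x \<in> slab \<Longrightarrow> 0 \<le> q2 x" "\<And>x. x \<in> slab \<Longrightarrow> 0 \<le> q3 x"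
    and le1: "\<And>x y z. x \<in> {0..Lx} \<Longrightarrow> y \<in> {0..Ly} \<Longrightarrow> z \<in> {0..1} \<Longrightarrow> (n (coord3 1 2 x y z))\<^sup>2 \<le> integral {0..Lx} (\<lambda>x. q1 (coord3 1 2 x y z))"
    and le2: "\<And>x y z. x \<in> {0..Lx} \<Longrightarrow> y \<in> {0..Ly} \<Longrightarrow> z \<in> {0..1} \<Longrightarrow> (n (coord3 1 2 x y z))\<^sup>2 \<le> integral {0..Ly} (\<lambda>y. q2 (coord3 1 2 x y z))"
    and le3: "\<And>x y z. x \<in> {0..Lx} \<Longrightarrow> y \<in> {0..Ly} \<Longrightarrow> z \<in> {0..1} \<Longrightarrow> (n (coord3 1 2 x y z))\<^sup>2 \<le> integral {0..1} (\<lambda>z. q3 (coord3 1 2 x y z))"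
  shows "(vint (\<lambda>x. n x ^ 3))\<^sup>2 \<le> vint q1 * vint q2 * vint q3"
proof -
  let ?A = "\<lambda>y z. integral {0..Lx} (\<lambda>x. q1 (coord3 1 2 x y z))"
  let ?B = "\<lambda>x z. integral {0..Ly} (\<lambda>y. q2 (coord3 1 2 x y z))"
  let ?C = "\<lambda>x y. integral {0..1} (\<lambda>z. q3 (coord3 1 2 x y z))"
  have A0: "0 \<le> ?A y z" and B0: "0 \<le> ?B x z" if "z \<in> {0..1}" for x y z
    by (intro integral_nonneg integrable_continuous_real fld_line_UNIV q that; use q0 that in simp)+
  have C0: "0 \<le> ?C x y" if "x \<in> {0..Lx}" "y \<in> {0..Ly}" for x y
    using fld_slice[OF q(3) d123(1), of x y] that by (intro integral_nonneg integrable_continuous_real) (use q0 in auto)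
  have cA: "continuous_on S (\<lambda>y. ?A y z)" if z: "z \<in> {0..1}" for z S
    unfolding cbox_interval[symmetric]
    by (rule integral_continuous_on_param, unfold split_beta, rule continuous_on_compose2[of slab q1])
       (use q z in \<open>auto intro!: continuous_intros simp: fld_def\<close>)
  have cB: "continuous_on S (\<lambda>x. ?B x z)" if z: "z \<in> {0..1}" for z S
    unfolding cbox_interval[symmetric]
    by (rule integral_continuous_on_param, unfold split_beta, rule continuous_on_compose2[of slab q2])
       (use q z in \<open>auto intro!: continuous_intros simp: fld_def\<close>)
  have cC: "continuous_on (cbox (0, 0) (Lx, Ly)) (\<lambda>p. ?C (fst p) (snd p))"
    using continuous_on_slice_integral[OF d123(1) fld_box[OF q(3)]] by simp
  have vC: "integral (cbox (0, 0) (Lx, Ly)) (\<lambda>p. ?C (fst p) (snd p)) = vint q3"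
    using integral_box_pair(1)[OF d123(1) fld_box[OF q(3)]] by (simp add: vint_def box_V_def)
  have q3': "0 \<le> vint q3" by (rule vint_nonneg[OF q(3) q0(3)])
  have h: "hmean (\<lambda>x. n x ^ 3) z \<le> sqrt (vint q3) * (sqrt (hmean q1 z) * sqrt (hmean q2 z))" if z: "z \<in> {0..1}" for z
  proof -
    let ?AB = "\<lambda>p::real\<times>real. sqrt (?A (snd p) z) * sqrt (?B (fst p) z)"
    have cAB: "continuous_on (cbox (0, 0) (Lx, Ly)) ?AB"
      by (intro continuous_intros continuous_on_compose2[OF cA[OF z, of UNIV]] continuous_on_compose2[OF cB[OF z, of UNIV]]) auto
    have cCs: "continuous_on (cbox (0, 0) (Lx, Ly)) (\<lambda>p. sqrt (?C (fst p) (snd p)))"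
      by (intro continuous_intros cC)
    have "hmean (\<lambda>x. n x ^ 3) z \<le> integral (cbox (0, 0) (Lx, Ly)) (\<lambda>p. sqrt (?C (fst p) (snd p)) * ?AB p)"
      unfolding hmean_def
    proof (rule integral_le)
      show "(\<lambda>p. n (coord3 1 2 (fst p) (snd p) z) ^ 3) integrable_on cbox (0, 0) (Lx, Ly)"
        by (intro integrable_continuous continuous_on_horizontal[OF _ z] fld_intros n)
      show "(\<lambda>p. sqrt (?C (fst p) (snd p)) * ?AB p) integrable_on cbox (0, 0) (Lx, Ly)"
        by (intro integrable_continuous continuous_on_mult cCs cAB)
      fix p :: "real \<times> real" assume p: "p \<in> cbox (0, 0) (Lx, Ly)"
      obtain x y where xy: "p = (x, y)" "x \<in> {0..Lx}" "y \<in> {0..Ly}" using p by (cases p) (auto simp: cbox_Pair_eq)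
      let ?n = "n (coord3 1 2 x y z)"
      have n0: "0 \<le> ?n" using n(2) z by simp
      have "(?n ^ 3)\<^sup>2 = ?n\<^sup>2 * (?n\<^sup>2 * ?n\<^sup>2)" by (simp flip: power_mult power_add)
      also have "\<dots> \<le> ?C x y * (?A y z * ?B x z)"
        using le1[OF xy(2,3) z] le2[OF xy(2,3) z] le3[OF xy(2,3) z] A0[OF z] B0[OF z] C0[OF xy(2,3)]
        by (intro mult_mono) auto
      finally have "?n ^ 3 \<le> sqrt (?C x y * (?A y z * ?B x z))" by (rule real_le_rsqrt)
      then show "n (coord3 1 2 (fst p) (snd p) z) ^ 3 \<le> sqrt (?C (fst p) (snd p)) * ?AB p"
        by (simp add: xy real_sqrt_mult)
    qed
    also have "\<dots> \<le> sqrt (integral (cbox (0, 0) (Lx, Ly)) (\<lambda>p. (sqrt (?C (fst p) (snd p)))\<^sup>2)) * sqrt (integral (cbox (0, 0) (Lx, Ly)) (\<lambda>p. (?AB p)\<^sup>2))"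
      by (rule integral_mult_le_sqrt[OF cCs cAB])
    also have "integral (cbox (0, 0) (Lx, Ly)) (\<lambda>p. (sqrt (?C (fst p) (snd p)))\<^sup>2) = vint q3"
      unfolding vC[symmetric] by (rule integral_cong) (use C0 in \<open>auto simp: cbox_Pair_eq\<close>)
    \<comment> \<open>At fixed \<open>z\<close> one factor depends on \<open>y\<close> only and the
      other on \<open>x\<close> only, so the double integral is a product.\<close>
    also have "integral (cbox (0, 0) (Lx, Ly)) (\<lambda>p. (?AB p)\<^sup>2) = hmean q1 z * hmean q2 z"
    proof -
      have "integral (cbox (0, 0) (Lx, Ly)) (\<lambda>p. (?AB p)\<^sup>2) = integral {0..Lx} (\<lambda>x. integral {0..Ly} (\<lambda>y. ?A y z * ?B x z))"
        using integral_prod_continuous[OF continuous_on_power[OF cAB, of 2]] A0[OF z] B0[OF z]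
        by (simp add: power_mult_distrib)
      also have "\<dots> = integral {0..Ly} (\<lambda>y. ?A y z) * integral {0..Lx} (\<lambda>x. ?B x z)" by simp
      finally show ?thesis using hmean_iterated(2)[OF q(1) z] hmean_iterated(1)[OF q(2) z] by simp
    qed
    finally show ?thesis by (simp add: real_sqrt_mult)
  qed
  have hq0: "0 \<le> hmean q1 z" "0 \<le> hmean q2 z" if "z \<in> {0..1}" for z
    unfolding hmean_def by (intro integral_nonneg integrable_continuous continuous_on_horizontal[OF _ that] q; use q0 that in simp)+
  note ch = vint_hmean(2)[OF q(1)] vint_hmean(2)[OF q(2)]
  have fn: "fld (\<lambda>x. n x ^ 3)" by (intro fld_intros n)
  have "vint (\<lambda>x. n x ^ 3) \<le> integral {0..1} (\<lambda>z. sqrt (vint q3) * (sqrt (hmean q1 z) * sqrt (hmean q2 z)))"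
    unfolding vint_hmean(1)[OF fn]
    by (intro integral_le integrable_continuous_real continuous_intros ch vint_hmean(2) fn h)
  also have "\<dots> = sqrt (vint q3) * integral {0..1} (\<lambda>z. sqrt (hmean q1 z) * sqrt (hmean q2 z))" by simp
  also have "\<dots> \<le> sqrt (vint q3) * (sqrt (integral {0..1} (\<lambda>z. (sqrt (hmean q1 z))\<^sup>2)) * sqrt (integral {0..1} (\<lambda>z. (sqrt (hmean q2 z))\<^sup>2)))"
    using integral_mult_le_sqrt[of 0 1 "\<lambda>z. sqrt (hmean q1 z)" "\<lambda>z. sqrt (hmean q2 z)"] ch q3'
    by (intro mult_left_mono) (auto intro!: continuous_intros)
  also have "integral {0..1} (\<lambda>z. (sqrt (hmean q1 z))\<^sup>2) = vint q1"
    unfolding vint_hmean(1)[OF q(1)] by (rule integral_cong) (use hq0 in auto)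
  also have "integral {0..1} (\<lambda>z. (sqrt (hmean q2 z))\<^sup>2) = vint q2"
    unfolding vint_hmean(1)[OF q(2)] by (rule integral_cong) (use hq0 in auto)
  finally have le: "vint (\<lambda>x. n x ^ 3) \<le> sqrt (vint q3) * (sqrt (vint q1) * sqrt (vint q2))" .
  have n0: "0 \<le> vint (\<lambda>x. n x ^ 3)" by (rule vint_nonneg[OF fn]) (use n in auto)
  have "(vint (\<lambda>x. n x ^ 3))\<^sup>2 \<le> (sqrt (vint q3) * (sqrt (vint q1) * sqrt (vint q2)))\<^sup>2"
    by (rule power_mono[OF le n0])
  also have "\<dots> = vint q1 * vint q2 * vint q3"
    using vint_nonneg[OF q(1) q0(1)] vint_nonneg[OF q(2) q0(2)] q3' by (simp add: power_mult_distrib)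
  finally show ?thesis .
qed

text \<open>Apply Loomis--Whitney to \<open>|B|\<^sup>4 = n\<^sup>2\<close>, bounding \<open>n\<^sup>2\<close> on each coordinate line by its mean plus
  its oscillation.\<close>

lemma sobolev:
  fixes n n1 n2 n3 m1 m2 m3 :: "real^3 \<Rightarrow> real"
  assumes h: "has_pd 1 n n1" "has_pd 2 n n2" "has_pd 3 n n3"
    and n: "fld n" "fld n1" "fld n2" "fld n3" and m: "fld m1" "fld m2" "fld m3"
    and n0: "\<And>x. x \<in> slab \<Longrightarrow> 0 \<le> n x"
    and le: "\<And>x. x \<in> slab \<Longrightarrow> \<bar>n1 x\<bar> \<le> 2 * sqrt (n x) * m1 x"
      "\<And>x. x \<in> slab \<Longrightarrow> \<bar>n2 x\<bar> \<le> 2 * sqrt (n x) * m2 x"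
      "\<And>x. x \<in> slab \<Longrightarrow> \<bar>n3 x\<bar> \<le> 2 * sqrt (n x) * m3 x"
    and poincare: "(lambda1 Lx Ly)\<^sup>2 * vint n \<le> D\<^sup>2" "0 \<le> D"
      "D\<^sup>2 = vint (\<lambda>x. (m1 x)\<^sup>2) + vint (\<lambda>x. (m2 x)\<^sup>2) + vint (\<lambda>x. (m3 x)\<^sup>2)"
  shows "sqrt (vint (\<lambda>x. n x ^ 3)) \<le> (C_S Lx Ly * D) ^ 3"
proof -
  define F where "F = sqrt (vint n)"
  define S where "S = sqrt (vint (\<lambda>x. n x ^ 3))"
  have v0: "0 \<le> vint n" "0 \<le> vint (\<lambda>x. n x ^ 3)" using n0 n by (auto intro!: vint_nonneg fld_intros)
  have F0: "0 \<le> F" and S0: "0 \<le> S" by (simp_all add: F_def S_def v0)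
  \<comment> \<open>Mean plus oscillation of \<open>n^2\<close>, whose derivative is
    \<open>2 * n * n1\<close>. Periodicity halves the oscillation in \<open>q1\<close> and
    \<open>q2\<close>; in \<open>q3\<close> the 2 remains.\<close>
  define q1 where "q1 x = (n x)\<^sup>2 / Lx + n x * \<bar>n1 x\<bar>" for x
  define q2 where "q2 x = (n x)\<^sup>2 / Ly + n x * \<bar>n2 x\<bar>" for x
  define q3 where "q3 x = (n x)\<^sup>2 / 1 + 2 * (n x * \<bar>n3 x\<bar>)" for x
  have fq: "fld q1" "fld q2" "fld q3"
    unfolding q1_def[abs_def] q2_def[abs_def] q3_def[abs_def] by (intro fld_intros fld_divide n)+
  have q0: "0 \<le> q1 x" "0 \<le> q2 x" "0 \<le> q3 x" if "x \<in> slab" for x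
    unfolding q1_def q2_def q3_def using n0[OF that] Lx Ly by auto
  have abs2: "\<bar>2 * n x * k\<bar> = 2 * (n x * \<bar>k\<bar>)" if "x \<in> slab" for x k using n0[OF that] by (simp add: abs_mult)
  have LW: "(vint (\<lambda>x. n x ^ 3))\<^sup>2 \<le> vint q1 * vint q2 * vint q3"
  proof (rule loomis_whitney[OF n(1) n0 fq q0])
    fix x y z assume xyz: "x \<in> {0..Lx}" "y \<in> {0..Ly}" "z \<in> {0..(1::real)}"
    note cl = fld_line_UNIV[OF _ xyz(3)]
    note cz = fld_slice[OF _ d123(1), of _ x y, simplified, OF _ xyz(1,2)[simplified]]
    let ?f = "\<lambda>x y z. (n (coord3 1 2 x y z))\<^sup>2"
    have "?f x y z \<le> integral {0..Lx} (\<lambda>x. ?f x y z) / Lx + 1/2 * integral {0..Lx} (\<lambda>x. \<bar>2 * n (coord3 1 2 x y z) * n1 (coord3 1 2 x y z)\<bar>)"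
    proof (rule le_mean_add[OF Lx])
      show "?f x y z - ?f s y z \<le> 1/2 * integral {0..Lx} (\<lambda>x. \<bar>2 * n (coord3 1 2 x y z) * n1 (coord3 1 2 x y z)\<bar>)" if "s \<in> {0..Lx}" for s
        by (rule integral_abs_diff_le(2)[OF has_pd_x_line[OF has_pd_power2[OF h(1)] xyz(3)]])
           (use xyz that fld_periodic(1)[OF n(1) xyz(3), of 0 y] in \<open>auto intro!: continuous_intros cl n fld_intros\<close>)
    qed (intro continuous_intros cl n)
    also have "\<dots> = integral {0..Lx} (\<lambda>x. ?f x y z / Lx + n (coord3 1 2 x y z) * \<bar>n1 (coord3 1 2 x y z)\<bar>)"
      using Lx xyz by (subst integral_add) (auto intro!: integrable_continuous_real continuous_intros cl n fld_intros simp: abs2)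
    finally show "?f x y z \<le> integral {0..Lx} (\<lambda>x. q1 (coord3 1 2 x y z))" unfolding q1_def .
    have "?f x y z \<le> integral {0..Ly} (\<lambda>y. ?f x y z) / Ly + 1/2 * integral {0..Ly} (\<lambda>y. \<bar>2 * n (coord3 1 2 x y z) * n2 (coord3 1 2 x y z)\<bar>)"
    proof (rule le_mean_add[OF Ly])
      show "?f x y z - ?f x s z \<le> 1/2 * integral {0..Ly} (\<lambda>y. \<bar>2 * n (coord3 1 2 x y z) * n2 (coord3 1 2 x y z)\<bar>)" if "s \<in> {0..Ly}" for s
        by (rule integral_abs_diff_le(2)[OF has_pd_y_line[OF has_pd_power2[OF h(2)] xyz(3)]])
           (use xyz that fld_periodic(2)[OF n(1) xyz(3), of x 0] in \<open>auto intro!: continuous_intros cl n fld_intros\<close>)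
    qed (intro continuous_intros cl n)
    also have "\<dots> = integral {0..Ly} (\<lambda>y. ?f x y z / Ly + n (coord3 1 2 x y z) * \<bar>n2 (coord3 1 2 x y z)\<bar>)"
      using Ly xyz by (subst integral_add) (auto intro!: integrable_continuous_real continuous_intros cl n fld_intros simp: abs2)
    finally show "?f x y z \<le> integral {0..Ly} (\<lambda>y. q2 (coord3 1 2 x y z))" unfolding q2_def .
    have "?f x y z \<le> integral {0..1} (\<lambda>z. ?f x y z) / 1 + integral {0..1} (\<lambda>z. \<bar>2 * n (coord3 1 2 x y z) * n3 (coord3 1 2 x y z)\<bar>)"
    proof (rule le_mean_add)
      show "?f x y z - ?f x y s \<le> integral {0..1} (\<lambda>z. \<bar>2 * n (coord3 1 2 x y z) * n3 (coord3 1 2 x y z)\<bar>)" if "s \<in> {0..1}" for s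
        by (rule integral_abs_diff_le(1)[OF has_pd_z_line[OF has_pd_power2[OF h(3)]]])
           (use xyz that in \<open>auto intro!: continuous_intros cz n fld_intros\<close>)
    qed (auto intro!: continuous_intros cz n fld_intros)
    also have "integral {0..1} (\<lambda>z. \<bar>2 * n (coord3 1 2 x y z) * n3 (coord3 1 2 x y z)\<bar>)
       = integral {0..1} (\<lambda>z. 2 * (n (coord3 1 2 x y z) * \<bar>n3 (coord3 1 2 x y z)\<bar>))"
      by (rule integral_cong) (use abs2 in auto)
    also have "integral {0..1} (\<lambda>z. ?f x y z) / 1 + \<dots> = integral {0..1} (\<lambda>z. ?f x y z / 1 + 2 * (n (coord3 1 2 x y z) * \<bar>n3 (coord3 1 2 x y z)\<bar>))"
      by (subst integral_add) (auto intro!: integrable_continuous_real continuous_intros cz n fld_intros)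
    finally show "?f x y z \<le> integral {0..1} (\<lambda>z. q3 (coord3 1 2 x y z))" unfolding q3_def .
  qed
  \<comment> \<open>Interpolation: \<open>n^2\<close> is the product of \<open>n^(3/2)\<close> and
    \<open>n^(1/2)\<close>, whose L2 norms are \<open>S\<close> and \<open>F\<close>.\<close>
  have nn: "vint (\<lambda>x. (n x)\<^sup>2) \<le> S * F"
  proof -
    have "vint (\<lambda>x. (n x)\<^sup>2) = vint (\<lambda>x. (n x * sqrt (n x)) * sqrt (n x))"
      by (rule vint_cong) (use n0 in \<open>auto simp: power2_eq_square\<close>)
    also have "\<dots> \<le> sqrt (vint (\<lambda>x. (n x * sqrt (n x))\<^sup>2)) * sqrt (vint (\<lambda>x. (sqrt (n x))\<^sup>2))"
      by (rule order_trans[OF abs_ge_self vint_abs_mult_le]) (intro fld_intros n)+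
    also have "vint (\<lambda>x. (n x * sqrt (n x))\<^sup>2) = vint (\<lambda>x. n x ^ 3)"
      by (rule vint_cong) (use n0 in \<open>auto simp: power_mult_distrib power3_eq_cube power2_eq_square\<close>)
    also have "vint (\<lambda>x. (sqrt (n x))\<^sup>2) = vint n"
      by (rule vint_cong) (use n0 in auto)
    finally show ?thesis unfolding S_def F_def .
  qed
  \<comment> \<open>The hypothesis \<open>|k| <= 2 sqrt n m\<close> again produces a factor
    \<open>n^(3/2)\<close> with L2 norm \<open>S\<close>. Thus each of the three integrals of
    \<open>q\<close> carries exactly one \<open>S\<close>.\<close>
  have nm: "vint (\<lambda>x. n x * \<bar>k x\<bar>) \<le> 2 * S * sqrt (vint (\<lambda>x. (m x)\<^sup>2))"
    if k: "fld k" "fld m" "\<And>x. x \<in> slab \<Longrightarrow> \<bar>k x\<bar> \<le> 2 * sqrt (n x) * m x" for k m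
  proof -
    have "vint (\<lambda>x. n x * \<bar>k x\<bar>) \<le> vint (\<lambda>x. 2 * ((n x * sqrt (n x)) * m x))"
    proof (rule vint_mono)
      fix x assume x: "x \<in> slab"
      show "n x * \<bar>k x\<bar> \<le> 2 * ((n x * sqrt (n x)) * m x)"
        using mult_left_mono[OF k(3)[OF x] n0[OF x]] by (simp add: mult_ac)
    qed (intro fld_intros n k)+
    also have "\<dots> = 2 * vint (\<lambda>x. (n x * sqrt (n x)) * m x)" by (rule vint_cmult)
    also have "vint (\<lambda>x. (n x * sqrt (n x)) * m x) \<le> sqrt (vint (\<lambda>x. (n x * sqrt (n x))\<^sup>2)) * sqrt (vint (\<lambda>x. (m x)\<^sup>2))"
      by (rule order_trans[OF abs_ge_self vint_abs_mult_le]) (intro fld_intros n k)+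
    also have "vint (\<lambda>x. (n x * sqrt (n x))\<^sup>2) = vint (\<lambda>x. n x ^ 3)"
      by (rule vint_cong) (use n0 in \<open>auto simp: power_mult_distrib power3_eq_cube power2_eq_square\<close>)
    finally show ?thesis unfolding S_def by simp
  qed
  define d1 where "d1 = sqrt (vint (\<lambda>x. (m1 x)\<^sup>2))"
  define d2 where "d2 = sqrt (vint (\<lambda>x. (m2 x)\<^sup>2))"
  define d3 where "d3 = sqrt (vint (\<lambda>x. (m3 x)\<^sup>2))"
  have m0: "0 \<le> vint (\<lambda>x. (m1 x)\<^sup>2)" "0 \<le> vint (\<lambda>x. (m2 x)\<^sup>2)" "0 \<le> vint (\<lambda>x. (m3 x)\<^sup>2)"
    by (intro vint_nonneg fld_intros m; simp)+
  have d0: "0 \<le> d1" "0 \<le> d2" "0 \<le> d3" and dD: "D\<^sup>2 = d1\<^sup>2 + d2\<^sup>2 + d3\<^sup>2"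
    unfolding d1_def d2_def d3_def poincare(3) using m0 by simp_all
  have Q1: "vint q1 \<le> S * (2 * d1 + F / Lx)"
  proof -
    have "vint q1 = vint (\<lambda>x. (n x)\<^sup>2) / Lx + vint (\<lambda>x. n x * \<bar>n1 x\<bar>)"
      unfolding q1_def[abs_def] using vint_cmult[of "1 / Lx" "\<lambda>x. (n x)\<^sup>2"]
      by (subst vint_add) (auto intro!: fld_intros fld_divide n)
    also have "\<dots> \<le> S * F / Lx + 2 * S * d1"
      unfolding d1_def using nn nm[OF n(2) m(1) le(1)] Lx by (intro add_mono divide_right_mono) auto
    finally show ?thesis by (simp add: algebra_simps)
  qed
  have Q2: "vint q2 \<le> S * (2 * d2 + F / Ly)"
  proof -
    have "vint q2 = vint (\<lambda>x. (n x)\<^sup>2) / Ly + vint (\<lambda>x. n x * \<bar>n2 x\<bar>)"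
      unfolding q2_def[abs_def] using vint_cmult[of "1 / Ly" "\<lambda>x. (n x)\<^sup>2"]
      by (subst vint_add) (auto intro!: fld_intros fld_divide n)
    also have "\<dots> \<le> S * F / Ly + 2 * S * d2"
      unfolding d2_def using nn nm[OF n(3) m(2) le(2)] Ly by (intro add_mono divide_right_mono) auto
    finally show ?thesis by (simp add: algebra_simps)
  qed
  have Q3: "vint q3 \<le> S * (4 * d3 + F)"
  proof -
    have "vint q3 = vint (\<lambda>x. (n x)\<^sup>2) + 2 * vint (\<lambda>x. n x * \<bar>n3 x\<bar>)"
      unfolding q3_def[abs_def] using vint_cmult[of 2 "\<lambda>x. n x * \<bar>n3 x\<bar>"]
      by (subst vint_add) (auto intro!: fld_intros fld_divide n)
    also have "\<dots> \<le> S * F + 2 * (2 * S * d3)"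
      unfolding d3_def using nn nm[OF n(4) m(3) le(3)] by (intro add_mono mult_left_mono) auto
    finally show ?thesis by (simp add: algebra_simps)
  qed
  have "S ^ 4 = (vint (\<lambda>x. n x ^ 3))\<^sup>2"
    unfolding S_def using v0 power_mult[of "sqrt (vint (\<lambda>x. n x ^ 3))" 2 2] by simp
  also have "\<dots> \<le> vint q1 * vint q2 * vint q3" by (rule LW)
  also have "\<dots> \<le> (S * (2 * d1 + F / Lx)) * (S * (2 * d2 + F / Ly)) * (S * (4 * d3 + F))"
    using S0 F0 d0 Lx Ly by (intro mult_mono Q1 Q2 Q3 vint_nonneg fq q0) (auto intro!: mult_nonneg_nonneg add_nonneg_nonneg vint_nonneg fq q0)
  also have "\<dots> = S ^ 3 * ((2 * d1 + F / Lx) * (2 * d2 + F / Ly) * (4 * d3 + F))"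
    by (simp add: power3_eq_cube)
  also have "\<dots> \<le> S ^ 3 * (C_S Lx Ly * D) ^ 3"
  proof (intro mult_left_mono sobolev_product_le d0 poincare dD F0)
    have "(lambda1 Lx Ly * F)\<^sup>2 \<le> D\<^sup>2" using poincare(1) v0 by (simp add: F_def power_mult_distrib)
    then show "lambda1 Lx Ly * F \<le> D" using poincare(2) by (rule power2_le_imp_le)
  qed (use S0 in simp)
  \<comment> \<open>Left is \<open>S^4\<close>, right is \<open>S^3\<close> times the constant:
    cancelling \<open>S^3\<close> closes the self-referential estimate, and \<open>S = 0\<close> is
    trivial.\<close>
  finally have "S ^ 3 * S \<le> S ^ 3 * (C_S Lx Ly * D) ^ 3" by (simp add: power_numeral_odd power_numeral_even mult_ac)
  then have "S \<le> (C_S Lx Ly * D) ^ 3 \<or> S = 0" using S0 by (cases "S = 0") auto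
  moreover have "0 \<le> (C_S Lx Ly * D) ^ 3"
  proof -
    have "0 \<le> C_S Lx Ly"
    proof (rule order_trans[OF _ C_S_lower])
      have "0 \<le> sqrt (1/4 + 1 / Lx\<^sup>2 + 1 / Ly\<^sup>2) / lambda1 Lx Ly"
        by (intro divide_nonneg_pos lambda1_pos real_sqrt_ge_zero) simp
      then show "0 \<le> 728/1000 * (2 + sqrt (1/4 + 1 / Lx\<^sup>2 + 1 / Ly\<^sup>2) / lambda1 Lx Ly)" by simp
    qed
    then show ?thesis using poincare(2) by simp
  qed
  ultimately show ?thesis unfolding S_def by auto
qed

end

section \<open>Smooth fields\<close>

lemma has_vector_derivative_within_cong:
  assumes "\<And>s. s \<in> S \<Longrightarrow> f s = g s" "x \<in> S"
  shows "(f has_vector_derivative d) (at x within S) \<longleftrightarrow> (g has_vector_derivative d) (at x within S)"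
  using has_vector_derivative_transform[of x S f g d] has_vector_derivative_transform[of x S g f d] assms by auto

lemma vector_derivative_within_cong:
  assumes "\<And>s. s \<in> S \<Longrightarrow> f s = g s" "x \<in> S"
  shows "vector_derivative f (at x within S) = vector_derivative g (at x within S)"
  unfolding vector_derivative_def using has_vector_derivative_within_cong[OF assms] by simp

lemma partial_cong:
  assumes "\<And>y. y \<in> D \<Longrightarrow> f y = g y" "x \<in> D"
  shows "partial D b f x = partial D b g x"
  unfolding partial_def by (rule vector_derivative_within_cong) (use assms in auto)

lemma iter_partial_cong:
  assumes "\<And>y. y \<in> D \<Longrightarrow> f y = g y" "x \<in> D"
  shows "iter_partial D bs f x = iter_partial D bs g x"
  using assms(2) by (induction bs arbitrary: x) (auto intro!: partial_cong assms(1))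

lemma differentiable_within_cong:
  fixes f g :: "real \<Rightarrow> 'b::real_normed_vector"
  assumes "\<And>s. s \<in> S \<Longrightarrow> f s = g s" "x \<in> S" "f differentiable (at x within S)"
  shows "g differentiable (at x within S)"
  using assms(3) has_derivative_transform[of x S g f] assms(1,2) unfolding differentiable_def by metis

lemma smooth_on_cong:
  assumes f: "smooth_on D f" and e: "\<And>y. y \<in> D \<Longrightarrow> g y = f y"
  shows "smooth_on D g"
  unfolding smooth_on_def
proof (intro ballI conjI)
  fix bs :: "'a list" assume bs: "bs \<in> lists Basis"
  have e': "iter_partial D bs f y = iter_partial D bs g y" if "y \<in> D" for y
    by (rule iter_partial_cong) (use e that in auto)
  show "continuous_on D (iter_partial D bs g)"
    using f bs unfolding smooth_on_def by (intro continuous_on_eq[OF _ e']) auto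
  fix b x :: 'a assume b: "b \<in> Basis" and x: "x \<in> D"
  show "(\<lambda>s. iter_partial D bs g (x + s *\<^sub>R b)) differentiable (at 0 within {s. x + s *\<^sub>R b \<in> D})"
    by (rule differentiable_within_cong[of _ "\<lambda>s. iter_partial D bs f (x + s *\<^sub>R b)"])
       (use f bs b x e' in \<open>auto simp: smooth_on_def\<close>)
qed

lemma iter_partial_append: "iter_partial D (bs @ cs) f = iter_partial D bs (iter_partial D cs f)"
  by (induction bs) auto

lemma smooth_on_partial:
  assumes "smooth_on D f" "b \<in> Basis"
  shows "smooth_on D (partial D b f)"
proof -
  have "iter_partial D (bs @ [b]) f = iter_partial D bs (partial D b f)" for bs
    by (simp add: iter_partial_append)
  moreover have "bs @ [b] \<in> lists Basis" if "bs \<in> lists Basis" for bs using that assms(2) by auto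
  ultimately show ?thesis using assms(1) unfolding smooth_on_def by metis
qed

lemma smooth_on_continuous: "smooth_on D f \<Longrightarrow> continuous_on D f"
  unfolding smooth_on_def by (drule bspec[of _ _ "[]"]) auto

lemma smooth_on_has_partial:
  assumes "smooth_on D f" "b \<in> Basis" "x \<in> D"
  shows "((\<lambda>s. f (x + s *\<^sub>R b)) has_vector_derivative partial D b f x) (at 0 within {s. x + s *\<^sub>R b \<in> D})"
proof -
  have "(\<lambda>s. iter_partial D [] f (x + s *\<^sub>R b)) differentiable (at 0 within {s. x + s *\<^sub>R b \<in> D})"
    using assms unfolding smooth_on_def by blast
  then show ?thesis unfolding partial_def by (simp add: vector_derivative_works)
qed

text \<open>Each point of \<open>D\<close> is an accumulation point of \<open>D\<close> along every
  coordinate line. This makes derivatives within \<open>D\<close> unique, so that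
  \<open>partial\<close> obeys the usual rules at boundary points too.\<close>

definition thick :: "'a::euclidean_space set \<Rightarrow> bool" where
  "thick D \<longleftrightarrow> (\<forall>x\<in>D. \<forall>b\<in>Basis. at (0::real) within {s. x + s *\<^sub>R b \<in> D} \<noteq> bot)"

text \<open>With \<open>h\<close> a coordinate projection this passes from vector fields to their
  scalar components; \<open>partial\<close> commutes with \<open>h\<close> because derivatives
  within a thick set are unique.\<close>

lemma smooth_on_linear_image:
  assumes D: "thick D" and h: "bounded_linear h" and f: "smooth_on D f"
  shows "smooth_on D (\<lambda>x. h (f x))"
    and "b \<in> Basis \<Longrightarrow> x \<in> D \<Longrightarrow> partial D b (\<lambda>x. h (f x)) x = h (partial D b f x)"
proof -
  have p: "partial D b (\<lambda>x. h (g x)) x = h (partial D b g x)"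
    if "smooth_on D g" "b \<in> Basis" "x \<in> D" for g b x
    unfolding partial_def[of D b "\<lambda>x. h (g x)"]
    by (rule vector_derivative_within[OF _ bounded_linear.has_vector_derivative[OF h smooth_on_has_partial[OF that]]])
       (use D that in \<open>auto simp: thick_def\<close>)
  then show "b \<in> Basis \<Longrightarrow> x \<in> D \<Longrightarrow> partial D b (\<lambda>x. h (f x)) x = h (partial D b f x)" using f by simp
  have sm: "smooth_on D (iter_partial D bs f)" if "bs \<in> lists Basis" for bs
    using that by (induction bs) (auto intro!: f smooth_on_partial)
  have it: "iter_partial D bs (\<lambda>x. h (f x)) x = h (iter_partial D bs f x)" if "bs \<in> lists Basis" "x \<in> D" for bs x
    using that
  proof (induction bs arbitrary: x)
    case (Cons b bs)
    have "partial D b (iter_partial D bs (\<lambda>x. h (f x))) x = partial D b (\<lambda>x. h (iter_partial D bs f x)) x"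
      by (rule partial_cong) (use Cons in auto)
    then show ?case using p[OF sm] Cons by auto
  qed simp
  show "smooth_on D (\<lambda>x. h (f x))"
    unfolding smooth_on_def
  proof (intro ballI conjI)
    fix bs :: "'a list" assume bs: "bs \<in> lists Basis"
    show "continuous_on D (iter_partial D bs (\<lambda>x. h (f x)))"
      by (rule continuous_on_eq[OF bounded_linear.continuous_on[OF h smooth_on_continuous[OF sm[OF bs]]]])
         (use it bs in auto)
    fix b x :: 'a assume b: "b \<in> Basis" and x: "x \<in> D"
    have "((\<lambda>s. h (iter_partial D bs f (x + s *\<^sub>R b))) has_vector_derivative h (partial D b (iter_partial D bs f) x))
      (at 0 within {s. x + s *\<^sub>R b \<in> D})"
      by (rule bounded_linear.has_vector_derivative[OF h smooth_on_has_partial[OF sm[OF bs] b x]])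
    then have "(\<lambda>s. h (iter_partial D bs f (x + s *\<^sub>R b))) differentiable (at 0 within {s. x + s *\<^sub>R b \<in> D})"
      by (rule differentiableI_vector)
    then show "(\<lambda>s. iter_partial D bs (\<lambda>x. h (f x)) (x + s *\<^sub>R b)) differentiable (at 0 within {s. x + s *\<^sub>R b \<in> D})"
      by (rule differentiable_within_cong[rotated 2]) (use it bs x in auto)
  qed
qed

lemma smooth_on_line:
  fixes f :: "'a::euclidean_space \<Rightarrow> real"
  assumes f: "smooth_on D f" and b: "b \<in> Basis" and c: "x + c *\<^sub>R b \<in> D"
  shows "((\<lambda>s. f (x + s *\<^sub>R b)) has_real_derivative partial D b f (x + c *\<^sub>R b)) (at c within {s. x + s *\<^sub>R b \<in> D})"
proof -
  have "((\<lambda>s. f (x + (c + s) *\<^sub>R b)) has_real_derivative partial D b f (x + c *\<^sub>R b)) (at 0 within {s. x + (c + s) *\<^sub>R b \<in> D})"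
    using smooth_on_has_partial[OF f b c] by (simp add: algebra_simps has_real_derivative_iff_has_vector_derivative)
  moreover have "(+) c ` {s. x + (c + s) *\<^sub>R b \<in> D} = {s. x + s *\<^sub>R b \<in> D}"
    by (auto simp: image_iff intro!: exI[of _ "_ - c"])
  ultimately show ?thesis
    using DERIV_at_within_shift[of "\<lambda>s. f (x + s *\<^sub>R b)" _ c 0 "{s. x + (c + s) *\<^sub>R b \<in> D}"] by simp
qed

text \<open>The increment may have either sign: at the upper wall only downward steps stay in the
  domain.\<close>

lemma mvt_closed_segment:
  fixes g g' :: "real \<Rightarrow> real"
  assumes d: "\<And>r. r \<in> closed_segment 0 s \<Longrightarrow> (g has_real_derivative g' r) (at r within closed_segment 0 s)"
  shows "\<exists>r\<in>closed_segment 0 s. g s - g 0 = s * g' r"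
proof -
  consider "s = 0" | "0 < s" | "s < 0" by linarith
  then show ?thesis
  proof cases
    case 2
    then show ?thesis
      using mvt_simple[of 0 s g "\<lambda>x. (*) (g' x)"] d
      by (auto simp: closed_segment_eq_real_ivl has_field_derivative_def mult.commute intro: less_imp_le)
  next
    case 3
    then obtain x where "x \<in> {s<..<0}" "g 0 - g s = g' x * (0 - s)"
      using mvt_simple[of s 0 g "\<lambda>x. (*) (g' x)"] d
      by (auto simp: closed_segment_eq_real_ivl has_field_derivative_def)
    then show ?thesis using 3 by (intro bexI[of _ x]) (auto simp: closed_segment_eq_real_ivl algebra_simps)
  qed auto
qed

text \<open>Each coordinate of a point of the rectangle spanned at \<open>x\<close> lies between the
  corresponding coordinates of the two given vertices, which are opposite ones; so no assumption on
  the fourth vertex is needed beyond interval shape.\<close>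

lemma is_interval_corner:
  assumes D: "is_interval D" and bc: "b \<in> Basis" "c \<in> Basis" "b \<noteq> c"
    and s: "x + s *\<^sub>R b \<in> D" and r: "x + r *\<^sub>R c \<in> D"
    and st: "\<sigma> \<in> closed_segment 0 s" "\<rho> \<in> closed_segment 0 (r::real)"
  shows "x + \<sigma> *\<^sub>R b + \<rho> *\<^sub>R c \<in> D"
proof (rule D[unfolded is_interval_def, rule_format, OF s r])
  fix i :: 'a assume i: "i \<in> Basis"
  show "(x + s *\<^sub>R b) \<bullet> i \<le> (x + \<sigma> *\<^sub>R b + \<rho> *\<^sub>R c) \<bullet> i \<and> (x + \<sigma> *\<^sub>R b + \<rho> *\<^sub>R c) \<bullet> i \<le> (x + r *\<^sub>R c) \<bullet> i
    \<or> (x + r *\<^sub>R c) \<bullet> i \<le> (x + \<sigma> *\<^sub>R b + \<rho> *\<^sub>R c) \<bullet> i \<and> (x + \<sigma> *\<^sub>R b + \<rho> *\<^sub>R c) \<bullet> i \<le> (x + s *\<^sub>R b) \<bullet> i"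
    using st bc i by (auto simp: inner_add_left inner_Basis closed_segment_eq_real_ivl split: if_splits)
qed

text \<open>The left-hand side is symmetric in \<open>(s, b)\<close> and \<open>(r, c)\<close>, so letting \<open>s, r\<close> tend to \<open>0\<close> yields
  Clairaut's theorem.\<close>

lemma mixed_difference:
  fixes f :: "'a::euclidean_space \<Rightarrow> real"
  assumes D: "is_interval D" and f: "smooth_on D f" and bc: "b \<in> Basis" "c \<in> Basis" "b \<noteq> c"
    and s: "x + s *\<^sub>R b \<in> D" and r: "x + r *\<^sub>R c \<in> D"
  shows "\<exists>y\<in>D. dist y x \<le> \<bar>s\<bar> + \<bar>r\<bar> \<and>
    f (x + s *\<^sub>R b + r *\<^sub>R c) - f (x + s *\<^sub>R b) - f (x + r *\<^sub>R c) + f x = s * r * partial D c (partial D b f) y"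
proof -
  note mem = is_interval_corner[OF D bc s r]
  have mem0: "x + \<sigma> *\<^sub>R b \<in> D" if "\<sigma> \<in> closed_segment 0 s" for \<sigma>
    using mem[OF that, of 0] by simp
  have l: "((\<lambda>\<sigma>. f (x + \<sigma> *\<^sub>R b + \<rho> *\<^sub>R c)) has_real_derivative partial D b f (x + \<sigma> *\<^sub>R b + \<rho> *\<^sub>R c)) (at \<sigma> within closed_segment 0 s)"
    if "\<sigma> \<in> closed_segment 0 s" "\<rho> \<in> closed_segment 0 r" for \<sigma> \<rho>
  proof -
    have e: "x + \<rho> *\<^sub>R c + t *\<^sub>R b = x + t *\<^sub>R b + \<rho> *\<^sub>R c" for t by simp
    show ?thesis
      by (rule DERIV_subset[OF smooth_on_line[OF f bc(1), of "x + \<rho> *\<^sub>R c" \<sigma>, unfolded e]]) (use mem that in auto)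
  qed
  have "\<exists>\<xi>\<in>closed_segment 0 s. (f (x + s *\<^sub>R b + r *\<^sub>R c) - f (x + s *\<^sub>R b)) - (f (x + 0 *\<^sub>R b + r *\<^sub>R c) - f (x + 0 *\<^sub>R b))
     = s * (partial D b f (x + \<xi> *\<^sub>R b + r *\<^sub>R c) - partial D b f (x + \<xi> *\<^sub>R b))"
  proof (rule mvt_closed_segment)
    fix \<sigma> assume "\<sigma> \<in> closed_segment 0 s"
    then show "((\<lambda>\<sigma>. f (x + \<sigma> *\<^sub>R b + r *\<^sub>R c) - f (x + \<sigma> *\<^sub>R b)) has_real_derivative
        partial D b f (x + \<sigma> *\<^sub>R b + r *\<^sub>R c) - partial D b f (x + \<sigma> *\<^sub>R b)) (at \<sigma> within closed_segment 0 s)"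
      using l[of \<sigma> r] l[of \<sigma> 0] by (auto intro!: derivative_eq_intros)
  qed
  then obtain \<xi> where \<xi>: "\<xi> \<in> closed_segment 0 s" and e1: "f (x + s *\<^sub>R b + r *\<^sub>R c) - f (x + s *\<^sub>R b) - f (x + r *\<^sub>R c) + f x
     = s * (partial D b f (x + \<xi> *\<^sub>R b + r *\<^sub>R c) - partial D b f (x + \<xi> *\<^sub>R b))" by (auto simp: algebra_simps)
  have "\<exists>\<eta>\<in>closed_segment 0 r. partial D b f (x + \<xi> *\<^sub>R b + r *\<^sub>R c) - partial D b f (x + \<xi> *\<^sub>R b + 0 *\<^sub>R c)
     = r * partial D c (partial D b f) (x + \<xi> *\<^sub>R b + \<eta> *\<^sub>R c)"
    by (rule mvt_closed_segment, rule DERIV_subset[OF smooth_on_line[OF smooth_on_partial[OF f bc(1)] bc(2)]])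
       (use mem \<xi> in auto)
  then obtain \<eta> where \<eta>: "\<eta> \<in> closed_segment 0 r" and e2: "partial D b f (x + \<xi> *\<^sub>R b + r *\<^sub>R c) - partial D b f (x + \<xi> *\<^sub>R b)
     = r * partial D c (partial D b f) (x + \<xi> *\<^sub>R b + \<eta> *\<^sub>R c)" by auto
  have "dist (x + \<xi> *\<^sub>R b + \<eta> *\<^sub>R c) x \<le> \<bar>s\<bar> + \<bar>r\<bar>"
  proof -
    have "dist (x + \<xi> *\<^sub>R b + \<eta> *\<^sub>R c) x = norm (\<xi> *\<^sub>R b + \<eta> *\<^sub>R c)" by (simp add: dist_norm)
    also have "\<dots> \<le> \<bar>\<xi>\<bar> + \<bar>\<eta>\<bar>" using norm_triangle_ineq[of "\<xi> *\<^sub>R b" "\<eta> *\<^sub>R c"] bc by simp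
    also have "\<dots> \<le> \<bar>s\<bar> + \<bar>r\<bar>" using \<xi> \<eta> by (auto simp: closed_segment_eq_real_ivl split: if_splits)
    finally show ?thesis .
  qed
  then show ?thesis using mem[OF \<xi> \<eta>] e1 e2 by auto
qed

lemma partial_commute:
  fixes f :: "'a::euclidean_space \<Rightarrow> real"
  assumes D: "is_interval D" "thick D" and f: "smooth_on D f" and bc: "b \<in> Basis" "c \<in> Basis" and x: "x \<in> D"
  shows "partial D b (partial D c f) x = partial D c (partial D b f) x"
proof (cases "b = c")
  case False
  let ?F = "partial D b (partial D c f)" and ?G = "partial D c (partial D b f)"
  have c: "continuous_on D ?F" "continuous_on D ?G"
    by (intro smooth_on_continuous smooth_on_partial f bc)+
  have small: "\<exists>s. x + s *\<^sub>R b \<in> D \<and> s \<noteq> 0 \<and> \<bar>s\<bar> < e" if "0 < e" "b \<in> Basis" for e b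
  proof -
    have "(0::real) islimpt {s. x + s *\<^sub>R b \<in> D}"
      using D(2) x that(2) unfolding thick_def trivial_limit_within by blast
    then show ?thesis using that(1) by (auto simp: islimpt_approachable)
  qed
  show ?thesis
  proof (rule ccontr)
    assume ne: "?F x \<noteq> ?G x"
    \<comment> \<open>Half of the supposed gap: the two mixed derivatives agree at nearby points
      \<open>y\<close> and \<open>z\<close>, yet each would be closer than \<open>e\<close> to a
      different limit.\<close>
    define e where "e = \<bar>?F x - ?G x\<bar> / 2"
    have e: "0 < e" using ne by (simp add: e_def)
    obtain d1 where d1: "0 < d1" "\<And>y. y \<in> D \<Longrightarrow> dist y x < d1 \<Longrightarrow> dist (?F y) (?F x) < e"
      using c(1) x e unfolding continuous_on_iff by metis
    obtain d2 where d2: "0 < d2" "\<And>y. y \<in> D \<Longrightarrow> dist y x < d2 \<Longrightarrow> dist (?G y) (?G x) < e"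
      using c(2) x e unfolding continuous_on_iff by metis
    define d where "d = min d1 d2 / 2"
    have d: "0 < d" using d1 d2 by (simp add: d_def)
    obtain s where s: "x + s *\<^sub>R b \<in> D" "s \<noteq> 0" "\<bar>s\<bar> < d" using small[OF d bc(1)] by blast
    obtain r where r: "x + r *\<^sub>R c \<in> D" "r \<noteq> 0" "\<bar>r\<bar> < d" using small[OF d bc(2)] by blast
    obtain y where y: "y \<in> D" "dist y x \<le> \<bar>s\<bar> + \<bar>r\<bar>"
      "f (x + s *\<^sub>R b + r *\<^sub>R c) - f (x + s *\<^sub>R b) - f (x + r *\<^sub>R c) + f x = s * r * ?G y"
      using mixed_difference[OF D(1) f bc False s(1) r(1)] by blast
    obtain z where z: "z \<in> D" "dist z x \<le> \<bar>r\<bar> + \<bar>s\<bar>"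
      "f (x + r *\<^sub>R c + s *\<^sub>R b) - f (x + r *\<^sub>R c) - f (x + s *\<^sub>R b) + f x = r * s * ?F z"
      using mixed_difference[OF D(1) f bc(2,1) not_sym[OF False] r(1) s(1)] by blast
    have "s * r * ?G y = s * r * ?F z" using y(3) z(3) by (simp add: algebra_simps)
    then have eq: "?G y = ?F z" using s(2) r(2) by simp
    have "dist (?F z) (?F x) < e" "dist (?G y) (?G x) < e"
      using y z s(3) r(3) by (auto intro!: d1 d2 simp: d_def)
    then have "\<bar>?F x - ?G x\<bar> < 2 * e" using eq by (simp add: dist_real_def)
    then show False by (simp add: e_def)
  qed
qed simp

lemma thick_slab: "thick slab"
  unfolding thick_def
proof (intro ballI)
  fix x b :: "real^3" assume x: "x \<in> slab" and "b \<in> Basis"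
  then obtain i where "b = axis i 1" by (auto simp: Basis_vec_def)
  then show "at (0::real) within {s. x + s *\<^sub>R b \<in> slab} \<noteq> bot" using slab_line_nontrivial[OF x] by simp
qed

lemma is_interval_slab: "is_interval slab"
  unfolding is_interval_cart slab_def by (auto dest!: spec[of _ 3])

lemma axis_Basis: "axis i (1::real) \<in> Basis"
  by (auto simp: Basis_vec_def)

lemma smooth_on_has_pd: "smooth_on slab f \<Longrightarrow> has_pd i f (pd i f)"
  unfolding has_pd_def pd_def using smooth_on_has_partial[OF _ axis_Basis]
  by (auto simp: has_real_derivative_iff_has_vector_derivative)

lemma smooth_on_pd: "smooth_on slab f \<Longrightarrow> smooth_on slab (pd i f)"
  unfolding pd_def by (rule smooth_on_partial[OF _ axis_Basis])

lemma pd_commute: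
  fixes f :: "real^3 \<Rightarrow> real"
  shows "smooth_on slab f \<Longrightarrow> x \<in> slab \<Longrightarrow> pd i (pd j f) x = pd j (pd i f) x"
  unfolding pd_def by (rule partial_commute[OF is_interval_slab thick_slab _ axis_Basis axis_Basis])

lemma pd_cong: "(\<And>x. x \<in> slab \<Longrightarrow> f x = g x) \<Longrightarrow> x \<in> slab \<Longrightarrow> pd i f x = pd i g x"
  unfolding pd_def by (rule partial_cong) auto

lemma pd_component:
  fixes f :: "real^3 \<Rightarrow> real^3"
  shows "smooth_on slab f \<Longrightarrow> x \<in> slab \<Longrightarrow> pd j f x $ i = pd j (\<lambda>x. f x $ i) x"
  unfolding pd_def using smooth_on_linear_image(2)[OF thick_slab bounded_linear_vec_nth _ axis_Basis] by metis

lemma smooth_on_component: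
  fixes f :: "'a::euclidean_space \<Rightarrow> real^3"
  shows "thick D \<Longrightarrow> smooth_on D f \<Longrightarrow> smooth_on D (\<lambda>x. f x $ i)"
  by (rule smooth_on_linear_image(1)[OF _ bounded_linear_vec_nth])

lemma periodic_partial:
  fixes f :: "real^3 \<Rightarrow> 'b::real_normed_vector"
  assumes "periodic_xy Lx Ly f"
  shows "periodic_xy Lx Ly (pd i f)"
  unfolding periodic_xy_def
proof (intro ballI)
  fix x :: "real^3" assume x: "x \<in> slab"
  have sh: "x + c + s *\<^sub>R axis i 1 \<in> slab \<longleftrightarrow> x + s *\<^sub>R axis i 1 \<in> slab" if "c = axis 1 Lx \<or> c = axis 2 Ly" for c s
    using that by (auto simp: slab_def axis_def)
  have "pd i f (x + c) = pd i f x" if c: "c = axis 1 Lx \<or> c = axis 2 Ly" for c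
  proof -
    have "f (x + c + s *\<^sub>R axis i 1) = f (x + s *\<^sub>R axis i 1)" if "x + s *\<^sub>R axis i 1 \<in> slab" for s
    proof -
      have "x + c + s *\<^sub>R axis i 1 = (x + s *\<^sub>R axis i 1) + c" by simp
      then show ?thesis using assms that c unfolding periodic_xy_def by metis
    qed
    then show ?thesis
      unfolding pd_def partial_def sh[OF c]
      by (intro vector_derivative_within_cong) (use x in auto)
  qed
  then show "pd i f (x + axis 1 Lx) = pd i f x \<and> pd i f (x + axis 2 Ly) = pd i f x" by blast
qed

section \<open>Space-time fields\<close>

locale spacetime =
  fixes Lx Ly :: real and I :: "real set"
  assumes I: "is_interval I" and I': "interior I \<noteq> {}"
begin

text \<open>The instant may be an endpoint of \<open>I\<close>. A nonempty interior excludes a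
  one-point interval, so one-sided time derivatives are unique.\<close>

lemma I_perfect: "t \<in> I \<Longrightarrow> at t within I \<noteq> bot"
proof -
  assume t: "t \<in> I"
  have "\<not> I \<subseteq> {t}"
  proof
    assume "I \<subseteq> {t}"
    then have "interior I \<subseteq> interior {t}" by (rule interior_mono)
    then show False using I' by simp
  qed
  then have "\<nexists>a. I = {a}" using t by auto
  then have "t islimpt I"
    using connected_imp_perfect[of I t] t I by (auto simp: is_interval_connected_1)
  then show ?thesis by (simp add: trivial_limit_within)
qed

lemma I_shift: "(+) t ` {s. t + s \<in> I} = I"
  by (auto simp: image_iff intro!: exI[of _ "_ - t"])

lemma at_shift_nontrivial: "t \<in> I \<Longrightarrow> at 0 within {s. t + s \<in> I} \<noteq> bot"
proof -
  assume t: "t \<in> I"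
  have "t islimpt I" using I_perfect[OF t] by (simp add: trivial_limit_within)
  then have "\<exists>y\<in>{s. t + s \<in> I}. y \<noteq> 0 \<and> dist y 0 < e" if "0 < e" for e
    using that unfolding islimpt_approachable
    by (metis (no_types, lifting) I_shift add.right_neutral dist_add_cancel imageE)
  then show ?thesis by (simp add: trivial_limit_within islimpt_approachable)
qed

abbreviation st :: "(real \<times> (real^3)) set" where "st \<equiv> I \<times> slab"

lemma st_Basis: "(1::real, 0::real^3) \<in> Basis" "(0::real, axis i (1::real)) \<in> Basis"
  using axis_Basis[of i] by (simp_all add: Basis_prod_def image_iff Basis_real_def)

lemma thick_st: "thick st"
  unfolding thick_def
proof (intro ballI)
  fix p b :: "real \<times> (real^3)" assume p: "p \<in> st" and b: "b \<in> Basis"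
  obtain t x where tx: "p = (t, x)" "t \<in> I" "x \<in> slab" using p by auto
  have "b = (1, 0) \<or> (\<exists>i. b = (0, axis i 1))" using b by (auto simp: Basis_prod_def Basis_vec_def)
  then show "at (0::real) within {s. p + s *\<^sub>R b \<in> st} \<noteq> bot"
  proof (elim disjE exE)
    assume "b = (1, 0)"
    then have "{s. p + s *\<^sub>R b \<in> st} = {s. t + s \<in> I}" using tx by auto
    then show ?thesis using at_shift_nontrivial[OF tx(2)] by simp
  next
    fix i assume "b = (0, axis i 1)"
    then have "{s. p + s *\<^sub>R b \<in> st} = {s. x + s *\<^sub>R axis i 1 \<in> slab}" using tx by auto
    then show ?thesis using slab_line_nontrivial[OF tx(3)] by simp
  qed
qed

lemma is_interval_st: "is_interval st"
  unfolding is_interval_def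
proof (intro ballI allI impI)
  fix p q r :: "real \<times> (real^3)"
  assume pq: "p \<in> st" "q \<in> st"
    and r: "\<forall>i\<in>Basis. p \<bullet> i \<le> r \<bullet> i \<and> r \<bullet> i \<le> q \<bullet> i \<or> q \<bullet> i \<le> r \<bullet> i \<and> r \<bullet> i \<le> p \<bullet> i"
  have "fst r \<in> I"
    using bspec[OF r st_Basis(1)] pq I unfolding is_interval_1 by (auto simp: inner_prod_def mem_Times_iff)
  moreover have "snd r \<in> slab"
    using bspec[OF r st_Basis(2)[of 3]] pq by (auto simp: inner_prod_def mem_Times_iff slab_def inner_axis)
  ultimately show "r \<in> st" by (simp add: mem_Times_iff)
qed

lemma partial_st_space:
  assumes "t \<in> I"
  shows "partial st (0, b) F (t, x) = partial slab b (\<lambda>x. F (t, x)) x"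
  using assms by (simp add: partial_def)

lemma iter_partial_st_space:
  assumes t: "t \<in> I" and x: "x \<in> slab"
  shows "iter_partial st (map (Pair 0) bs) F (t, x) = iter_partial slab bs (\<lambda>x. F (t, x)) x"
  using x
proof (induction bs arbitrary: x)
  case (Cons b bs)
  show ?case
    using Cons by (simp add: partial_st_space[OF t]) (rule partial_cong, auto)
qed simp

lemma smooth_on_time_slice:
  assumes F: "smooth_on st F" and t: "t \<in> I"
  shows "smooth_on slab (\<lambda>x. F (t, x))"
  unfolding smooth_on_def
proof (intro ballI conjI)
  fix bs :: "(real^3) list" assume "bs \<in> lists Basis"
  then have bs: "map (Pair 0) bs \<in> lists Basis" by (auto simp: Basis_prod_def lists_eq_set)
  note e = iter_partial_st_space[OF t]
  have c: "continuous_on st (iter_partial st (map (Pair 0) bs) F)"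
    using F bs unfolding smooth_on_def by blast
  have "continuous_on slab (\<lambda>x. iter_partial st (map (Pair 0) bs) F (t, x))"
    by (rule continuous_on_compose2[OF c]) (auto intro!: continuous_intros t)
  then show "continuous_on slab (iter_partial slab bs (\<lambda>x. F (t, x)))"
    by (rule continuous_on_eq) (rule e)
  fix b x :: "real^3" assume b: "b \<in> Basis" and x: "x \<in> slab"
  have b': "(0::real, b) \<in> Basis" using b by (auto simp: Basis_prod_def)
  have "(\<lambda>s. iter_partial st (map (Pair 0) bs) F ((t, x) + s *\<^sub>R (0, b))) differentiable (at 0 within {s. (t, x) + s *\<^sub>R (0, b) \<in> st})"
    using F bs b' x t unfolding smooth_on_def by blast
  then have "(\<lambda>s. iter_partial st (map (Pair 0) bs) F (t, x + s *\<^sub>R b)) differentiable (at 0 within {s. x + s *\<^sub>R b \<in> slab})"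
    using t by simp
  then show "(\<lambda>s. iter_partial slab bs (\<lambda>x. F (t, x)) (x + s *\<^sub>R b)) differentiable (at 0 within {s. x + s *\<^sub>R b \<in> slab})"
    by (rule differentiable_within_cong[rotated 2]) (use e x in auto)
qed

abbreviation sf :: "(real \<Rightarrow> real^3 \<Rightarrow> real) \<Rightarrow> bool" where
  "sf F \<equiv> smooth_field Lx Ly I F"

lemma sf_has_time_deriv:
  assumes F: "sf F" and t: "t \<in> I" and x: "x \<in> slab"
  shows "((\<lambda>s. F s x) has_real_derivative partial st (1, 0) (\<lambda>(t, x). F t x) (t, x)) (at t within I)"
    and "time_deriv I F t x = partial st (1, 0) (\<lambda>(t, x). F t x) (t, x)"
    and "((\<lambda>s. F s x) has_real_derivative time_deriv I F t x) (at t within I)"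
proof -
  have "((\<lambda>s. (\<lambda>(t, x). F t x) ((t, x) + s *\<^sub>R (1, 0))) has_vector_derivative partial st (1, 0) (\<lambda>(t, x). F t x) (t, x))
     (at 0 within {s. (t, x) + s *\<^sub>R (1, 0) \<in> st})"
    by (rule smooth_on_has_partial) (use F t x st_Basis in \<open>auto simp: smooth_field_def\<close>)
  then have "((\<lambda>s. F (t + s) x) has_real_derivative partial st (1, 0) (\<lambda>(t, x). F t x) (t, x)) (at 0 within {s. t + s \<in> I})"
    using x by (simp add: has_real_derivative_iff_has_vector_derivative)
  then have "((\<lambda>s. F s x) has_real_derivative partial st (1, 0) (\<lambda>(t, x). F t x) (t, x)) (at (t + 0) within (+) t ` {s. t + s \<in> I})"
    by (simp only: DERIV_at_within_shift)
  then show 1: "((\<lambda>s. F s x) has_real_derivative partial st (1, 0) (\<lambda>(t, x). F t x) (t, x)) (at t within I)"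
    unfolding I_shift by simp
  then show 2: "time_deriv I F t x = partial st (1, 0) (\<lambda>(t, x). F t x) (t, x)"
    unfolding time_deriv_def has_real_derivative_iff_has_vector_derivative
    by (rule vector_derivative_within[OF I_perfect[OF t]])
  show "((\<lambda>s. F s x) has_real_derivative time_deriv I F t x) (at t within I)" using 1 2 by simp
qed

lemma sf_pd: assumes "sf F" shows "sf (\<lambda>t. pd i (F t))"
proof -
  have "smooth_on st (partial st (0, axis i 1) (\<lambda>(t, x). F t x))"
    using assms st_Basis by (intro smooth_on_partial) (auto simp: smooth_field_def)
  then have "smooth_on st (\<lambda>(t, x). pd i (F t) x)"
    by (rule smooth_on_cong) (auto simp: partial_st_space pd_def)
  then show ?thesis using assms by (auto simp: smooth_field_def intro!: periodic_partial)
qed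

lemma sf_time_deriv: assumes "sf F" shows "sf (time_deriv I F)"
proof -
  have "smooth_on st (partial st (1, 0) (\<lambda>(t, x). F t x))"
    using assms st_Basis by (intro smooth_on_partial) (auto simp: smooth_field_def)
  then have "smooth_on st (\<lambda>(t, x). time_deriv I F t x)"
    by (rule smooth_on_cong) (auto simp: sf_has_time_deriv(2)[OF assms])
  moreover have "periodic_xy Lx Ly (time_deriv I F t)" if t: "t \<in> I" for t
    unfolding periodic_xy_def time_deriv_def
  proof (intro ballI conjI)
    fix x :: "real^3" assume x: "x \<in> slab"
    have p: "F s (x + axis 1 Lx) = F s x" "F s (x + axis 2 Ly) = F s x" if "s \<in> I" for s
      using assms that x by (auto simp: smooth_field_def periodic_xy_def)
    show "vector_derivative (\<lambda>s. F s (x + axis 1 Lx)) (at t within I) = vector_derivative (\<lambda>s. F s x) (at t within I)"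
      "vector_derivative (\<lambda>s. F s (x + axis 2 Ly)) (at t within I) = vector_derivative (\<lambda>s. F s x) (at t within I)"
      by (rule vector_derivative_within_cong; use p t in auto)+
  qed
  ultimately show ?thesis by (auto simp: smooth_field_def)
qed

lemma sf_slice: "sf F \<Longrightarrow> t \<in> I \<Longrightarrow> smooth_on slab (F t) \<and> periodic_xy Lx Ly (F t)"
  using smooth_on_time_slice[of "\<lambda>(t, x). F t x" t] by (auto simp: smooth_field_def)

text \<open>Clairaut's theorem on the space-time domain with one temporal direction. The energy
  contains the gradient of \<open>T\<close>, and its rate of change is wanted as the gradient of the
  time derivative, ready for integration by parts.\<close>

lemma sf_pd_time_deriv:
  assumes F: "sf F" and t: "t \<in> I" and x: "x \<in> slab"
  shows "time_deriv I (\<lambda>t. pd i (F t)) t x = pd i (time_deriv I F t) x"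
proof -
  let ?F = "\<lambda>(t, x). F t x"
  have "time_deriv I (\<lambda>t. pd i (F t)) t x = partial st (1, 0) (\<lambda>(t, x). pd i (F t) x) (t, x)"
    by (rule sf_has_time_deriv(2)[OF sf_pd[OF F] t x])
  also have "\<dots> = partial st (1, 0) (partial st (0, axis i 1) ?F) (t, x)"
    by (rule partial_cong) (use t x in \<open>auto simp: partial_st_space pd_def\<close>)
  also have "\<dots> = partial st (0, axis i 1) (partial st (1, 0) ?F) (t, x)"
    by (rule partial_commute[OF is_interval_st thick_st]) (use F t x st_Basis in \<open>auto simp: smooth_field_def\<close>)
  also have "\<dots> = partial slab (axis i 1) (\<lambda>x. partial st (1, 0) ?F (t, x)) x"
    by (rule partial_st_space[OF t])
  also have "\<dots> = pd i (time_deriv I F t) x"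
    unfolding pd_def by (rule partial_cong) (use t x sf_has_time_deriv(2)[OF F] in auto)
  finally show ?thesis .
qed

lemma smooth_field_component:
  fixes F :: "real \<Rightarrow> real^3 \<Rightarrow> real^3"
  assumes "smooth_field Lx Ly I F"
  shows "sf (\<lambda>t x. F t x $ i)"
proof -
  have "smooth_on st (\<lambda>p. (\<lambda>(t, x). F t x) p $ i)"
    by (rule smooth_on_component[OF thick_st]) (use assms in \<open>simp add: smooth_field_def\<close>)
  then have "smooth_on st (\<lambda>(t, x). F t x $ i)" by (simp add: case_prod_unfold)
  then show ?thesis using assms by (auto simp: smooth_field_def periodic_xy_def)
qed

lemma time_deriv_component:
  fixes F :: "real \<Rightarrow> real^3 \<Rightarrow> real^3"
  assumes F: "smooth_field Lx Ly I F" and t: "t \<in> I" and x: "x \<in> slab"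
  shows "time_deriv I F t x $ i = time_deriv I (\<lambda>t x. F t x $ i) t x"
proof -
  have "((\<lambda>s. (\<lambda>(t, x). F t x) ((t, x) + s *\<^sub>R (1, 0))) has_vector_derivative partial st (1, 0) (\<lambda>(t, x). F t x) (t, x))
     (at 0 within {s. (t, x) + s *\<^sub>R (1, 0) \<in> st})"
    by (rule smooth_on_has_partial) (use F t x st_Basis in \<open>auto simp: smooth_field_def\<close>)
  then have "((\<lambda>s. F s x) \<circ> (\<lambda>s. t + s) has_vector_derivative partial st (1, 0) (\<lambda>(t, x). F t x) (t, x)) (at 0 within {s. t + s \<in> I})"
    using x by (simp add: o_def)
  then have d: "((\<lambda>s. F s x) has_vector_derivative partial st (1, 0) (\<lambda>(t, x). F t x) (t, x)) (at t within I)"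
  proof -
    assume a: "((\<lambda>s. F s x) \<circ> (\<lambda>s. t + s) has_vector_derivative partial st (1, 0) (\<lambda>(t, x). F t x) (t, x)) (at 0 within {s. t + s \<in> I})"
    have "((\<lambda>s. s - t) has_vector_derivative 1) (at t within I)"
      by (auto intro!: derivative_eq_intros simp: has_vector_derivative_def)
    moreover have "(\<lambda>s. s - t) ` I = {s. t + s \<in> I}"
      by (auto simp: image_iff intro!: bexI[of _ "t + _"])
    ultimately have "(((\<lambda>s. F s x) \<circ> (\<lambda>s. t + s)) \<circ> (\<lambda>s. s - t) has_vector_derivative 1 *\<^sub>R partial st (1, 0) (\<lambda>(t, x). F t x) (t, x)) (at t within I)"
      using a by (intro vector_diff_chain_within) auto
    then show ?thesis by (simp add: o_def)
  qed
  have "time_deriv I F t x = partial st (1, 0) (\<lambda>(t, x). F t x) (t, x)"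
    unfolding time_deriv_def by (rule vector_derivative_within[OF I_perfect[OF t] d])
  moreover have "time_deriv I (\<lambda>t x. F t x $ i) t x = partial st (1, 0) (\<lambda>(t, x). F t x) (t, x) $ i"
    unfolding time_deriv_def
    by (rule vector_derivative_within[OF I_perfect[OF t] bounded_linear.has_vector_derivative[OF bounded_linear_vec_nth d]])
  ultimately show ?thesis by simp
qed

text \<open>The subtrahend \<open>h\<close> is independent of time and merely continuous; it will be
  the slope of \<open>\<tau>\<close> in the vertical part of the thermal energy and zero
  elsewhere.\<close>

lemma integral_square_time_deriv:
  assumes F: "sf F" and t: "t \<in> I" and ab: "cbox a b \<subseteq> slab"
    and c: "continuous_on (cbox a b) h"
  shows "((\<lambda>t. integral (cbox a b) (\<lambda>x. (F t x - h x)\<^sup>2)) has_real_derivative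
     integral (cbox a b) (\<lambda>x. 2 * (F t x - h x) * time_deriv I F t x)) (at t within I)"
  unfolding has_real_derivative_iff_has_vector_derivative
proof (rule leibniz_rule_vector_derivative)
  show "((\<lambda>t. (F t x - h x)\<^sup>2) has_vector_derivative 2 * (F t x - h x) * time_deriv I F t x) (at t within I)"
    if "t \<in> I" "x \<in> cbox a b" for t x
    unfolding has_real_derivative_iff_has_vector_derivative[symmetric]
    using sf_has_time_deriv(3)[OF F that(1), of x] that(2) ab by (auto intro!: derivative_eq_intros)
  have cF: "continuous_on (I \<times> cbox a b) (\<lambda>p. G (fst p) (snd p))" if "sf G" for G
  proof -
    have "continuous_on st (\<lambda>p. G (fst p) (snd p))"
      using smooth_on_continuous[of st "\<lambda>(t, x). G t x"] that by (simp add: smooth_field_def case_prod_unfold)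
    then show ?thesis by (rule continuous_on_subset) (use ab in auto)
  qed
  show "(\<lambda>x. (F t x - h x)\<^sup>2) integrable_on cbox a b" if "t \<in> I" for t
  proof -
    have "continuous_on (cbox a b) (F t)"
      using smooth_on_continuous sf_slice[OF F that] ab continuous_on_subset by blast
    then show ?thesis by (intro integrable_continuous continuous_intros c)
  qed
  show "continuous_on (I \<times> cbox a b) (\<lambda>(t, x). 2 * (F t x - h x) * time_deriv I F t x)"
    unfolding split_beta
    by (intro continuous_intros cF F sf_time_deriv continuous_on_compose2[OF c]) auto
qed (use t I in \<open>auto simp: is_interval_convex_1\<close>)

end

section \<open>Integral identities\<close>

context cell
begin

text \<open>Closed under \<open>pd\<close>, which \<open>fld\<close> is not; the perturbation need
  not belong to it, as \<open>\<tau>\<close> need not be smooth.\<close>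

definition sm :: "(real^3 \<Rightarrow> real) \<Rightarrow> bool" where
  "sm f \<longleftrightarrow> smooth_on slab f \<and> periodic_xy Lx Ly f"

lemma sm_fld: "sm f \<Longrightarrow> fld f"
  by (simp add: sm_def fld_def smooth_on_continuous)

lemma sm_pd: "sm f \<Longrightarrow> sm (pd i f)"
  by (simp add: sm_def smooth_on_pd periodic_partial)

lemma sm_has_pd: "sm f \<Longrightarrow> has_pd i f (pd i f)"
  by (simp add: sm_def smooth_on_has_pd)

lemma sm_commute: "sm f \<Longrightarrow> x \<in> slab \<Longrightarrow> pd i (pd j f) x = pd j (pd i f) x"
  by (simp add: sm_def pd_commute)

lemmas sm_intros = sm_fld sm_pd sm_has_pd

lemma walls_slab: "x \<in> S_minus \<union> S_plus \<Longrightarrow> x \<in> slab"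
  by (auto simp: S_minus_def S_plus_def slab_def)

text \<open>A horizontal line through a wall point stays on the wall, where the function is
  constantly zero.\<close>

lemma tangential_derivative_0:
  assumes h: "has_pd k f f'" and k: "k \<noteq> 3" and w: "\<forall>x\<in>S_minus \<union> S_plus. f x = 0" and x: "x \<in> S_minus \<union> S_plus"
  shows "f' x = 0"
proof -
  have "x + s *\<^sub>R axis k 1 \<in> S_minus \<union> S_plus" for s
    using x k exhaust_3[of k] by (auto simp: S_minus_def S_plus_def axis_def)
  then have "(\<lambda>s. f (x + s *\<^sub>R axis k 1)) = (\<lambda>s. 0)" using w by (intro ext) blast
  moreover have "{s. x + s *\<^sub>R axis k 1 \<in> slab} = UNIV" using slab_line_UNIV[OF k walls_slab[OF x]] by auto
  ultimately have "((\<lambda>s. 0) has_real_derivative f' x) (at 0)" using has_pdD[OF h walls_slab[OF x]] by simp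
  then show ?thesis using DERIV_unique DERIV_const by blast
qed

lemma vint_sum_mult_le:
  assumes "finite A" "\<And>a. a \<in> A \<Longrightarrow> fld (f a)" "\<And>a. a \<in> A \<Longrightarrow> fld (g a)"
  shows "\<bar>vint (\<lambda>x. \<Sum>a\<in>A. f a x * g a x)\<bar> \<le> sqrt (\<Sum>a\<in>A. vint (\<lambda>x. (f a x)\<^sup>2)) * sqrt (\<Sum>a\<in>A. vint (\<lambda>x. (g a x)\<^sup>2))"
proof -
  have nn: "0 \<le> vint (\<lambda>x. (f a x)\<^sup>2)" "0 \<le> vint (\<lambda>x. (g a x)\<^sup>2)" if "a \<in> A" for a
    using assms that by (auto intro!: vint_nonneg fld_intros)
  have "\<bar>vint (\<lambda>x. \<Sum>a\<in>A. f a x * g a x)\<bar> \<le> (\<Sum>a\<in>A. \<bar>vint (\<lambda>x. f a x * g a x)\<bar>)"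
    using assms by (subst vint_sum) (auto intro!: fld_intros)
  also have "\<dots> \<le> (\<Sum>a\<in>A. \<bar>sqrt (vint (\<lambda>x. (f a x)\<^sup>2))\<bar> * \<bar>sqrt (vint (\<lambda>x. (g a x)\<^sup>2))\<bar>)"
    using nn assms by (intro sum_mono) (auto intro: vint_abs_mult_le)
  also have "\<dots> \<le> L2_set (\<lambda>a. sqrt (vint (\<lambda>x. (f a x)\<^sup>2))) A * L2_set (\<lambda>a. sqrt (vint (\<lambda>x. (g a x)\<^sup>2))) A"
    by (rule L2_set_mult_ineq)
  also have "\<dots> = sqrt (\<Sum>a\<in>A. vint (\<lambda>x. (f a x)\<^sup>2)) * sqrt (\<Sum>a\<in>A. vint (\<lambda>x. (g a x)\<^sup>2))"
    unfolding L2_set_def using nn by simp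
  finally show ?thesis .
qed

text \<open>The families \<open>f1\<close> and \<open>f2\<close> hold a vector field and the
  diagonal of its Jacobian, given as functions and not through \<open>pd\<close>; so the lemma
  applies to gradients of functions that are not smooth. Only the normal component meets the
  wall.\<close>

lemma green:
  assumes f: "\<And>k. has_pd k (f1 k) (f2 k)" "\<And>k. fld (f1 k)" "\<And>k. fld (f2 k)"
    and g: "\<And>k. has_pd k g (g1 k)" "fld g" "\<And>k. fld (g1 k)"
    and w: "\<forall>x\<in>S_minus \<union> S_plus. f1 3 x * g x = 0"
  shows "vint (\<lambda>x. (\<Sum>k\<in>UNIV. f2 k x) * g x) = - (\<Sum>k\<in>UNIV. vint (\<lambda>x. f1 k x * g1 k x))"
proof -
  have "vint (\<lambda>x. (\<Sum>k\<in>UNIV. f2 k x) * g x) = (\<Sum>k\<in>UNIV. vint (\<lambda>x. f2 k x * g x))"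
    unfolding sum_distrib_right by (rule vint_sum) (auto intro!: fld_intros f g)
  also have "\<dots> = (\<Sum>k\<in>UNIV. - vint (\<lambda>x. f1 k x * g1 k x))"
  proof (rule sum.cong[OF refl])
    fix k show "vint (\<lambda>x. f2 k x * g x) = - vint (\<lambda>x. f1 k x * g1 k x)"
      by (rule vint_by_parts[OF f(1) g(1)]) (use w in \<open>auto intro: f g\<close>)
  qed
  finally show ?thesis by (simp add: sum_negf)
qed

lemma vint_divfree_grad:
  assumes v: "\<And>k. has_pd k (v k) (v1 k)" "\<And>k. fld (v k)" "\<And>k. fld (v1 k)"
    and div: "\<And>x. x \<in> slab \<Longrightarrow> (\<Sum>k\<in>UNIV. v1 k x) = 0"
    and f: "\<And>k. has_pd k f (f1 k)" "fld f" "\<And>k. fld (f1 k)"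
    and w: "\<forall>x\<in>S_minus \<union> S_plus. v 3 x = 0"
  shows "vint (\<lambda>x. \<Sum>k\<in>UNIV. v k x * f1 k x) = 0"
proof -
  have "vint (\<lambda>x. (\<Sum>k\<in>UNIV. v1 k x) * f x) = - (\<Sum>k\<in>UNIV. vint (\<lambda>x. v k x * f1 k x))"
    by (rule green) (use v f w in auto)
  moreover have "vint (\<lambda>x. (\<Sum>k\<in>UNIV. v1 k x) * f x) = vint (\<lambda>x. 0)"
    by (rule vint_cong) (simp add: div)
  moreover have "vint (\<lambda>x. 0) = 0" by (simp add: vint_def)
  moreover have "vint (\<lambda>x. \<Sum>k\<in>UNIV. v k x * f1 k x) = (\<Sum>k\<in>UNIV. vint (\<lambda>x. v k x * f1 k x))"
    by (rule vint_sum) (auto intro!: fld_intros v f)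
  ultimately show ?thesis by simp
qed

text \<open>The rotated horizontal gradient \<open>(f2, - f1, 0)\<close> is free of divergence. Only
  horizontal integrations by parts occur, so no wall condition enters; consequently the pressure
  does no work on the thermal wind.\<close>

lemma vint_jacobian:
  assumes P: "sm P" and f: "has_pd 1 f2 f21" "has_pd 2 f1 f12" "fld f1" "fld f2" "fld f12" "fld f21"
    and e: "\<And>x. x \<in> slab \<Longrightarrow> f12 x = f21 x"
  shows "vint (\<lambda>x. pd 1 P x * f2 x - pd 2 P x * f1 x) = 0"
proof -
  have "vint (\<lambda>x. pd 1 P x * f2 x) = - vint (\<lambda>x. P x * f21 x)"
    by (rule vint_by_parts) (auto intro!: f sm_intros P)
  moreover have "vint (\<lambda>x. pd 2 P x * f1 x) = - vint (\<lambda>x. P x * f12 x)"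
    by (rule vint_by_parts) (auto intro!: f sm_intros P)
  moreover have "vint (\<lambda>x. P x * f12 x) = vint (\<lambda>x. P x * f21 x)"
    by (rule vint_cong) (simp add: e)
  ultimately show ?thesis by (simp add: vint_diff fld_mult sm_intros P f)
qed

end

text \<open>The flow frozen at one instant, in scalar components. The stress-free condition has been
  combined with no penetration into Neumann conditions for the two horizontal velocities, and
  \<open>B_wall\<close> is the ferromagnetic condition. The flux is prescribed at the bottom only,
  since incompressibility propagates it.\<close>

locale fluid = cell +
  fixes u B :: "3 \<Rightarrow> real^3 \<Rightarrow> real" and P T :: "real^3 \<Rightarrow> real"
  assumes u: "\<And>i. sm (u i)" and B: "\<And>i. sm (B i)" and P: "sm P" and T: "sm T"
    and div_u: "\<And>x. x \<in> slab \<Longrightarrow> (\<Sum>k\<in>UNIV. pd k (u k) x) = 0"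
    and div_B: "\<And>x. x \<in> slab \<Longrightarrow> (\<Sum>k\<in>UNIV. pd k (B k) x) = 0"
    and u_wall: "\<And>x. x \<in> S_minus \<union> S_plus \<Longrightarrow> u 3 x = 0"
      "\<And>x. x \<in> S_minus \<union> S_plus \<Longrightarrow> pd 3 (u 1) x = 0" "\<And>x. x \<in> S_minus \<union> S_plus \<Longrightarrow> pd 3 (u 2) x = 0"
    and B_wall: "\<And>x. x \<in> S_minus \<union> S_plus \<Longrightarrow> B 1 x = 0" "\<And>x. x \<in> S_minus \<union> S_plus \<Longrightarrow> B 2 x = 0"
    and flux: "hmean (B 3) 0 = 0"
begin

definition Lap :: "(real^3 \<Rightarrow> real) \<Rightarrow> real^3 \<Rightarrow> real" where
  "Lap f x = (\<Sum>k\<in>UNIV. pd k (pd k f) x)"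

text \<open>The components of the current, \<open>J = curl B\<close>. Likewise \<open>JB\<close>
  below is the Lorentz force \<open>J x B\<close>, and \<open>F\<close> is \<open>u x B\<close>,
  whose curl drives the induction equation.\<close>

definition J :: "3 \<Rightarrow> real^3 \<Rightarrow> real" where
  "J i x = (if i = 1 then pd 2 (B 3) x - pd 3 (B 2) x
    else if i = 2 then pd 3 (B 1) x - pd 1 (B 3) x else pd 1 (B 2) x - pd 2 (B 1) x)"

definition JB :: "3 \<Rightarrow> real^3 \<Rightarrow> real" where
  "JB i x = (if i = 1 then J 2 x * B 3 x - J 3 x * B 2 x
    else if i = 2 then J 3 x * B 1 x - J 1 x * B 3 x else J 1 x * B 2 x - J 2 x * B 1 x)"

definition F :: "3 \<Rightarrow> real^3 \<Rightarrow> real" where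
  "F i x = (if i = 1 then u 2 x * B 3 x - u 3 x * B 2 x
    else if i = 2 then u 3 x * B 1 x - u 1 x * B 3 x else u 1 x * B 2 x - u 2 x * B 1 x)"

text \<open>The derivative of \<open>F i\<close> in direction \<open>k\<close>, written out by the
  product rule.\<close>

definition dF :: "3 \<Rightarrow> 3 \<Rightarrow> real^3 \<Rightarrow> real" where
  "dF k i x = (if i = 1 then (pd k (u 2) x * B 3 x + u 2 x * pd k (B 3) x) - (pd k (u 3) x * B 2 x + u 3 x * pd k (B 2) x)
    else if i = 2 then (pd k (u 3) x * B 1 x + u 3 x * pd k (B 1) x) - (pd k (u 1) x * B 3 x + u 1 x * pd k (B 3) x)
    else (pd k (u 1) x * B 2 x + u 1 x * pd k (B 2) x) - (pd k (u 2) x * B 1 x + u 2 x * pd k (B 1) x))"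

definition K2 :: real where "K2 = (\<Sum>i\<in>UNIV. \<Sum>k\<in>UNIV. vint (\<lambda>x. (pd k (B i) x)\<^sup>2))"
definition N2 :: real where "N2 = (\<Sum>i\<in>UNIV. \<Sum>k\<in>UNIV. vint (\<lambda>x. (pd k (u i) x)\<^sup>2))"

lemmas smf = u B P T sm_pd

lemmas flds = u[THEN sm_fld] B[THEN sm_fld] P[THEN sm_fld] T[THEN sm_fld]
  u[THEN sm_pd, THEN sm_fld] B[THEN sm_pd, THEN sm_fld] P[THEN sm_pd, THEN sm_fld] T[THEN sm_pd, THEN sm_fld]
  u[THEN sm_pd, THEN sm_pd, THEN sm_fld] B[THEN sm_pd, THEN sm_pd, THEN sm_fld]
  P[THEN sm_pd, THEN sm_pd, THEN sm_fld] T[THEN sm_pd, THEN sm_pd, THEN sm_fld]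

lemma fld_J: "fld (J i)"
  unfolding J_def[abs_def] by (cases "i = 1"; cases "i = 2") (auto intro!: fld_intros flds)

lemma fld_JB: "fld (JB i)"
  unfolding JB_def[abs_def] by (cases "i = 1"; cases "i = 2") (auto intro!: fld_intros flds fld_J)

lemma fld_F: "fld (F i)"
  unfolding F_def[abs_def] by (cases "i = 1"; cases "i = 2") (auto intro!: fld_intros flds)

lemma fld_dF: "fld (dF k i)"
  unfolding dF_def[abs_def] by (cases "i = 1"; cases "i = 2") (auto intro!: fld_intros flds)

lemma has_pd_F: "has_pd k (F i) (dF k i)"
  unfolding F_def[abs_def] dF_def[abs_def]
  by (cases "i = 1"; cases "i = 2") (auto intro!: has_pd_diff has_pd_mult sm_has_pd smf)

lemma fld_Lap: "sm f \<Longrightarrow> fld (Lap f)"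
  unfolding Lap_def[abs_def] by (intro fld_intros sm_fld sm_pd)

text \<open>The tangential components vanish along the wall, so their tangential derivatives do, and
  solenoidality leaves a Neumann condition for the normal component. It removes the wall term in
  \<open>vint_B_Lap\<close>.\<close>

lemma B33_wall: "x \<in> S_minus \<union> S_plus \<Longrightarrow> pd 3 (B 3) x = 0"
proof -
  assume x: "x \<in> S_minus \<union> S_plus"
  have "pd 1 (B 1) x = 0" "pd 2 (B 2) x = 0"
    using tangential_derivative_0[OF sm_has_pd[OF B], of 1 1] tangential_derivative_0[OF sm_has_pd[OF B], of 2 2] B_wall x by auto
  then show ?thesis using div_B[OF walls_slab[OF x]] by (simp add: sum_3)
qed

lemma vint_Lap:
  fixes f :: "3 \<Rightarrow> real^3 \<Rightarrow> real"
  assumes f: "\<And>i. sm (f i)" and w: "\<And>i x. x \<in> S_minus \<union> S_plus \<Longrightarrow> f i x = 0 \<or> pd 3 (f i) x = 0"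
  shows "vint (\<lambda>x. \<Sum>i\<in>UNIV. Lap (f i) x * f i x) = - (\<Sum>i\<in>UNIV. \<Sum>k\<in>UNIV. vint (\<lambda>x. (pd k (f i) x)\<^sup>2))"
proof -
  have "vint (\<lambda>x. Lap (f i) x * f i x) = - (\<Sum>k\<in>UNIV. vint (\<lambda>x. (pd k (f i) x)\<^sup>2))" for i
    unfolding Lap_def power2_eq_square
    by (rule green) (use w in \<open>auto intro!: sm_intros f\<close>)
  then show ?thesis
    using vint_sum[of UNIV "\<lambda>i x. Lap (f i) x * f i x"] fld_mult[OF fld_Lap[OF f] sm_fld[OF f]] by (simp add: sum_negf)
qed

lemma vint_u_Lap: "vint (\<lambda>x. \<Sum>i\<in>UNIV. Lap (u i) x * u i x) = - N2"
  unfolding N2_def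
proof (rule vint_Lap[OF u])
  show "u i x = 0 \<or> pd 3 (u i) x = 0" if "x \<in> S_minus \<union> S_plus" for i x
    using u_wall[OF that] exhaust_3[of i] by auto
qed

lemma vint_B_Lap: "vint (\<lambda>x. \<Sum>i\<in>UNIV. Lap (B i) x * B i x) = - K2"
  unfolding K2_def
proof (rule vint_Lap[OF B])
  show "B i x = 0 \<or> pd 3 (B i) x = 0" if "x \<in> S_minus \<union> S_plus" for i x
    using B_wall[OF that] B33_wall[OF that] exhaust_3[of i] by auto
qed

text \<open>The curl is moved from \<open>u x B\<close> onto \<open>B\<close>, and
  \<open>J . (u x B) = - u . (J x B)\<close>. The magnetic energy thus gains exactly what the
  Lorentz force takes from the flow.\<close>

lemma vint_B_curl_F:
  "vint (\<lambda>x. B 1 x * (dF 2 3 x - dF 3 2 x) + B 2 x * (dF 3 1 x - dF 1 3 x) + B 3 x * (dF 1 2 x - dF 2 1 x))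
    = - vint (\<lambda>x. \<Sum>i\<in>UNIV. u i x * JB i x)"
proof -
  \<comment> \<open>\<open>B 3\<close> does not vanish on the walls, but a curl never pairs the
    vertical derivative with the third component.\<close>
  have ibp: "vint (\<lambda>x. B i x * dF k j x) = - vint (\<lambda>x. pd k (B i) x * F j x)" if "k = 3 \<Longrightarrow> i \<noteq> 3" for i j k
  proof -
    have "vint (\<lambda>x. dF k j x * B i x) = - vint (\<lambda>x. F j x * pd k (B i) x)"
    proof (rule vint_by_parts[OF has_pd_F sm_has_pd[OF B] fld_F fld_dF])
      assume "k = 3"
      then show "\<forall>x\<in>S_minus \<union> S_plus. F j x * B i x = 0" using that B_wall exhaust_3[of i] by auto
    qed (auto intro!: sm_intros smf)
    then show ?thesis by (simp add: mult.commute)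
  qed
  have ibps: "vint (\<lambda>x. B 1 x * dF 2 3 x) = - vint (\<lambda>x. pd 2 (B 1) x * F 3 x)"
    "vint (\<lambda>x. B 1 x * dF 3 2 x) = - vint (\<lambda>x. pd 3 (B 1) x * F 2 x)"
    "vint (\<lambda>x. B 2 x * dF 3 1 x) = - vint (\<lambda>x. pd 3 (B 2) x * F 1 x)"
    "vint (\<lambda>x. B 2 x * dF 1 3 x) = - vint (\<lambda>x. pd 1 (B 2) x * F 3 x)"
    "vint (\<lambda>x. B 3 x * dF 1 2 x) = - vint (\<lambda>x. pd 1 (B 3) x * F 2 x)"
    "vint (\<lambda>x. B 3 x * dF 2 1 x) = - vint (\<lambda>x. pd 2 (B 3) x * F 1 x)"
    by (rule ibp; simp)+
  note fi = fld_intros fld_dF fld_F fld_J fld_JB flds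
  have "vint (\<lambda>x. B 1 x * (dF 2 3 x - dF 3 2 x) + B 2 x * (dF 3 1 x - dF 1 3 x) + B 3 x * (dF 1 2 x - dF 2 1 x))
    = vint (\<lambda>x. B 1 x * dF 2 3 x) - vint (\<lambda>x. B 1 x * dF 3 2 x) + (vint (\<lambda>x. B 2 x * dF 3 1 x) - vint (\<lambda>x. B 2 x * dF 1 3 x))
      + (vint (\<lambda>x. B 3 x * dF 1 2 x) - vint (\<lambda>x. B 3 x * dF 2 1 x))"
    unfolding right_diff_distrib by (simp add: vint_add vint_diff fi)
  also have "\<dots> = vint (\<lambda>x. \<Sum>i\<in>UNIV. J i x * F i x)"
    unfolding sum_3 J_def ibps by (simp add: left_diff_distrib vint_add vint_diff fi)
  also have "\<dots> = vint (\<lambda>x. - (\<Sum>i\<in>UNIV. u i x * JB i x))"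
    by (rule vint_cong) (simp add: sum_3 F_def JB_def algebra_simps)
  finally show ?thesis by (simp add: vint_minus)
qed

text \<open>Pointwise, the squared current is the squared gradient minus the squared divergence, up
  to 2x2 minors of the gradient; these are null Lagrangians and integrate to zero under the wall
  conditions.\<close>

lemma vint_J_square: "vint (\<lambda>x. \<Sum>i\<in>UNIV. (J i x)\<^sup>2) = K2"
proof -
  note fi = fld_intros flds
  \<comment> \<open>The first integration may be vertical, but then \<open>B i\<close> vanishes on
    the walls because \<open>i\<close> is horizontal; the second one is in direction
    \<open>i\<close>, hence horizontal.\<close>
  have cross: "vint (\<lambda>x. pd j (B i) x * pd i (B j) x) = vint (\<lambda>x. pd i (B i) x * pd j (B j) x)" if ij: "i \<noteq> 3" for i j
  proof -
    have "vint (\<lambda>x. pd j (B i) x * pd i (B j) x) = - vint (\<lambda>x. B i x * pd j (pd i (B j)) x)"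
      by (rule vint_by_parts) (use B_wall ij exhaust_3[of i] in \<open>auto intro!: sm_intros smf\<close>)
    also have "vint (\<lambda>x. B i x * pd j (pd i (B j)) x) = vint (\<lambda>x. B i x * pd i (pd j (B j)) x)"
      by (rule vint_cong) (use sm_commute[OF B] in auto)
    also have "- \<dots> = vint (\<lambda>x. pd i (B i) x * pd j (B j) x)"
      by (rule vint_by_parts[symmetric]) (use ij in \<open>auto intro!: sm_intros smf\<close>)
    finally show ?thesis .
  qed
  have div: "vint (\<lambda>x. (pd 1 (B 1) x + pd 2 (B 2) x + pd 3 (B 3) x)\<^sup>2) = 0"
  proof -
    have "vint (\<lambda>x. (pd 1 (B 1) x + pd 2 (B 2) x + pd 3 (B 3) x)\<^sup>2) = vint (\<lambda>x. 0)"
      by (rule vint_cong) (use div_B in \<open>simp add: sum_3\<close>)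
    then show ?thesis by (simp add: vint_def)
  qed
  have 1: "vint (\<lambda>x. \<Sum>i\<in>UNIV. (J i x)\<^sup>2)
    = vint (\<lambda>x. (\<Sum>i\<in>UNIV. \<Sum>k\<in>UNIV. (pd k (B i) x)\<^sup>2)
        - ((pd 1 (B 1) x + pd 2 (B 2) x + pd 3 (B 3) x)\<^sup>2
        + 2 * (pd 2 (B 1) x * pd 1 (B 2) x - pd 1 (B 1) x * pd 2 (B 2) x)
        + 2 * (pd 3 (B 1) x * pd 1 (B 3) x - pd 1 (B 1) x * pd 3 (B 3) x)
        + 2 * (pd 3 (B 2) x * pd 2 (B 3) x - pd 2 (B 2) x * pd 3 (B 3) x)))"
    by (rule vint_cong) (simp add: sum_3 J_def power2_eq_square algebra_simps)
  also have "\<dots> = vint (\<lambda>x. \<Sum>i\<in>UNIV. \<Sum>k\<in>UNIV. (pd k (B i) x)\<^sup>2)"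
    using div cross[of 1 2] cross[of 1 3] cross[of 2 3] by (simp add: vint_add vint_diff vint_cmult fi)
  also have "\<dots> = K2"
    unfolding K2_def by (simp add: vint_sum fi)
  finally show ?thesis .
qed

end

context fluid
begin

definition nB :: "real^3 \<Rightarrow> real" where "nB x = (\<Sum>i\<in>UNIV. (B i x)\<^sup>2)"

lemma fld_nB: "fld nB"
  unfolding nB_def[abs_def] by (intro fld_intros flds)

lemma vint_nB: "vint nB = (\<Sum>i\<in>UNIV. vint (\<lambda>x. (B i x)\<^sup>2))"
  unfolding nB_def[abs_def] by (rule vint_sum) (auto intro!: fld_intros flds)

lemma vint_pd_sq_nonneg: "0 \<le> vint (\<lambda>x. (pd k (B i) x)\<^sup>2)" "0 \<le> vint (\<lambda>x. (pd k (u i) x)\<^sup>2)"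
  by (auto intro!: vint_nonneg fld_intros flds)

lemma K2_nonneg: "0 \<le> K2" and N2_nonneg: "0 \<le> N2"
  unfolding K2_def N2_def by (intro sum_nonneg vint_pd_sq_nonneg)+

text \<open>The three entries of the minimum \<open>lambda1\<close> arise here: \<open>pi\<close>
  for the tangential components, from Dirichlet conditions in \<open>z\<close>; the two horizontal
  wave numbers for \<open>B 3\<close>, whose horizontal means vanish.\<close>

lemma poincare_B: "(lambda1 Lx Ly)\<^sup>2 * vint nB \<le> K2"
proof -
  let ?l = "lambda1 Lx Ly"
  have l2: "?l\<^sup>2 \<le> pi\<^sup>2" using lambda1_pos lambda1_le by (intro power_mono) auto
  have dir: "?l\<^sup>2 * vint (\<lambda>x. (B i x)\<^sup>2) \<le> (\<Sum>k\<in>UNIV. vint (\<lambda>x. (pd k (B i) x)\<^sup>2))" if "i \<noteq> 3" for i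
  proof -
    have "?l\<^sup>2 * vint (\<lambda>x. (B i x)\<^sup>2) \<le> pi\<^sup>2 * vint (\<lambda>x. (B i x)\<^sup>2)"
      by (rule mult_right_mono[OF l2]) (auto intro!: vint_nonneg fld_intros flds)
    also have "\<dots> \<le> vint (\<lambda>x. (pd 3 (B i) x)\<^sup>2)"
      by (rule vint_dirichlet) (use that B_wall exhaust_3[of i] in \<open>auto intro!: flds sm_has_pd[OF B]\<close>)
    also have "\<dots> \<le> (\<Sum>k\<in>UNIV. vint (\<lambda>x. (pd k (B i) x)\<^sup>2))"
      by (rule member_le_sum) (auto simp: vint_pd_sq_nonneg)
    finally show ?thesis .
  qed
  have B3: "?l\<^sup>2 * vint (\<lambda>x. (B 3 x)\<^sup>2) \<le> (\<Sum>k\<in>UNIV. vint (\<lambda>x. (pd k (B 3) x)\<^sup>2))"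
  proof -
    have mean: "hmean (B 3) z = 0" if "z \<in> {0..1}" for z
      by (rule hmean_eq_0[OF sm_has_pd[OF B] sm_has_pd[OF B] sm_has_pd[OF B], of 1 2])
         (use flux that div_B in \<open>auto intro!: flds simp: sum_3\<close>)
    have c: "?l\<^sup>2 * (L / (2 * pi))\<^sup>2 \<le> 1" if "?l \<le> 2 * pi / L" "0 < L" for L
    proof -
      have "?l * (L / (2 * pi)) \<le> 1" using that by (simp add: field_simps)
      moreover have "0 \<le> ?l * (L / (2 * pi))" using that lambda1_pos by simp
      ultimately have "(?l * (L / (2 * pi)))\<^sup>2 \<le> 1" by (simp add: power_le_one)
      then show ?thesis by (simp only: power_mult_distrib)
    qed
    have "?l\<^sup>2 * vint (\<lambda>x. (B 3 x)\<^sup>2) \<le> ?l\<^sup>2 * ((Lx / (2 * pi))\<^sup>2 * vint (\<lambda>x. (pd 1 (B 3) x)\<^sup>2) + (Ly / (2 * pi))\<^sup>2 * vint (\<lambda>x. (pd 2 (B 3) x)\<^sup>2))"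
      by (intro mult_left_mono horizontal_poincare mean flds sm_has_pd B) auto
    also have "\<dots> = (?l\<^sup>2 * (Lx / (2 * pi))\<^sup>2) * vint (\<lambda>x. (pd 1 (B 3) x)\<^sup>2) + (?l\<^sup>2 * (Ly / (2 * pi))\<^sup>2) * vint (\<lambda>x. (pd 2 (B 3) x)\<^sup>2)"
      by (simp add: algebra_simps)
    also have "\<dots> \<le> 1 * vint (\<lambda>x. (pd 1 (B 3) x)\<^sup>2) + 1 * vint (\<lambda>x. (pd 2 (B 3) x)\<^sup>2)"
      using c[OF lambda1_le(2) Lx] c[OF lambda1_le(3) Ly] by (intro add_mono mult_right_mono vint_pd_sq_nonneg)
    also have "\<dots> \<le> (\<Sum>k\<in>UNIV. vint (\<lambda>x. (pd k (B 3) x)\<^sup>2))"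
      using vint_pd_sq_nonneg(1)[of 3 3] by (simp add: sum_3)
    finally show ?thesis .
  qed
  show ?thesis
    unfolding vint_nB K2_def sum_distrib_left
    by (rule sum_mono) (metis dir B3)
qed

text \<open>The argument runs with \<open>nB = |B|^2\<close>, which stays differentiable at zeros of
  the field, and not with \<open>|B|\<close>. Cauchy--Schwarz over components bounds its derivatives
  by \<open>2 |B| |d_k B|\<close>, and \<open>nB ^ 3\<close> is the sixth power of
  \<open>|B|\<close>.\<close>

lemma sobolev_B: "sqrt (vint (\<lambda>x. nB x ^ 3)) \<le> (C_S Lx Ly * sqrt K2) ^ 3"
proof -
  define n1 where "n1 k x = (\<Sum>i\<in>UNIV. 2 * B i x * pd k (B i) x)" for k x
  define m where "m k x = sqrt (\<Sum>i\<in>UNIV. (pd k (B i) x)\<^sup>2)" for k x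
  have h: "has_pd k nB (n1 k)" for k
    unfolding nB_def[abs_def] n1_def[abs_def] sum_3 by (intro has_pd_add has_pd_power2 sm_has_pd B)
  have fn: "fld (n1 k)" for k unfolding n1_def[abs_def] by (intro fld_intros flds)
  have fm: "fld (m k)" for k unfolding m_def[abs_def] by (intro fld_intros flds)
  have le: "\<bar>n1 k x\<bar> \<le> 2 * sqrt (nB x) * m k x" for k x
  proof -
    have "\<bar>n1 k x\<bar> = 2 * \<bar>\<Sum>i\<in>UNIV. B i x * pd k (B i) x\<bar>"
      unfolding n1_def by (simp add: sum_distrib_left[symmetric] mult.assoc abs_mult)
    also have "\<dots> \<le> 2 * (\<Sum>i\<in>UNIV. \<bar>B i x\<bar> * \<bar>pd k (B i) x\<bar>)"
      using sum_abs[of "\<lambda>i. B i x * pd k (B i) x" UNIV] by (simp add: abs_mult)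
    also have "\<dots> \<le> 2 * (L2_set (\<lambda>i. B i x) UNIV * L2_set (\<lambda>i. pd k (B i) x) UNIV)"
      using L2_set_mult_ineq[of "\<lambda>i. B i x" "\<lambda>i. pd k (B i) x" UNIV] by linarith
    finally show ?thesis by (simp add: L2_set_def nB_def m_def)
  qed
  have vm: "vint (\<lambda>x. (m k x)\<^sup>2) = (\<Sum>i\<in>UNIV. vint (\<lambda>x. (pd k (B i) x)\<^sup>2))" for k
    unfolding m_def by (simp add: sum_nonneg vint_sum fld_intros flds)
  show ?thesis
  proof (rule sobolev[OF h h h fld_nB fn fn fn fm fm fm])
    show "0 \<le> nB x" for x by (simp add: nB_def sum_nonneg)
    show "\<bar>n1 1 x\<bar> \<le> 2 * sqrt (nB x) * m 1 x" "\<bar>n1 2 x\<bar> \<le> 2 * sqrt (nB x) * m 2 x" "\<bar>n1 3 x\<bar> \<le> 2 * sqrt (nB x) * m 3 x" for x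
      by (rule le)+
    show "(sqrt K2)\<^sup>2 = vint (\<lambda>x. (m 1 x)\<^sup>2) + vint (\<lambda>x. (m 2 x)\<^sup>2) + vint (\<lambda>x. (m 3 x)\<^sup>2)"
      unfolding vm using K2_nonneg by (simp add: K2_def sum_3)
  qed (use K2_nonneg poincare_B in auto)
qed

section \<open>Testing the momentum equation\<close>

text \<open>For horizontal \<open>k\<close> this is the derivative of the primitive of
  \<open>T\<close>, already commuted inside; \<open>psi2\<close> lists the next derivatives, where a
  vertical one merely undoes the primitive.\<close>

definition psi :: "3 \<Rightarrow> real^3 \<Rightarrow> real" where "psi k = vp (pd k T)"
definition psi2 :: "3 \<Rightarrow> 3 \<Rightarrow> real^3 \<Rightarrow> real" where
  "psi2 j k = (if j = 3 then pd k T else vp (pd j (pd k T)))"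

lemma fld_psi: "fld (psi k)" unfolding psi_def by (intro fld_vp flds)
lemma fld_psi2: "fld (psi2 j k)" unfolding psi2_def by (auto intro!: fld_vp flds)
lemma has_pd_psi: "has_pd j (psi k) (psi2 j k)"
proof -
  have c: "continuous_on slab (pd k T)" "continuous_on slab (pd j (pd k T))"
    using flds unfolding fld_def by auto
  show ?thesis
    unfolding psi_def psi2_def using has_pd_vp_z[OF c(1)] has_pd_vp_xy[OF sm_has_pd[OF sm_pd[OF T]] c] by auto
qed

lemma psi2_commute: "x \<in> slab \<Longrightarrow> psi2 1 2 x = psi2 2 1 x"
  unfolding psi2_def vp_def
  by (auto intro!: integral_cong sm_commute[OF T] simp: slab_def)

text \<open>The third entry has to be \<open>T\<close> itself: \<open>psi 3\<close>, the primitive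
  of the vertical derivative of \<open>T\<close>, differs from it by the value of \<open>T\<close>
  at the bottom.\<close>

definition grad_psi :: "3 \<Rightarrow> real^3 \<Rightarrow> real" where
  "grad_psi k = (if k = 3 then T else psi k)"

lemma fld_grad_psi: "fld (grad_psi k)" unfolding grad_psi_def by (auto intro!: fld_psi flds)

lemma has_pd_vp_T: "has_pd k (vp T) (grad_psi k)"
proof -
  have c: "continuous_on slab T" "continuous_on slab (pd k T)"
    using flds unfolding fld_def by auto
  show ?thesis
    unfolding grad_psi_def psi_def using has_pd_vp_z[OF c(1)] has_pd_vp_xy[OF sm_has_pd[OF T] c] by auto
qed

text \<open>The Coriolis work of \<open>Ra (\<psi>\<^sub>2, - \<psi>\<^sub>1, 0)\<close> cancels the buoyancy up to the null term \<open>Ra u \<bullet> \<nabla>\<psi>\<close>.\<close>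

lemma momentum_test:
  assumes mom: "\<And>x. x \<in> slab \<Longrightarrow> - u 2 x + pd 1 P x - Ek * Lap (u 1) x = \<Lambda> * JB 1 x"
    "\<And>x. x \<in> slab \<Longrightarrow> u 1 x + pd 2 P x - Ek * Lap (u 2) x = \<Lambda> * JB 2 x"
    "\<And>x. x \<in> slab \<Longrightarrow> pd 3 P x - Ek * Lap (u 3) x = \<Lambda> * JB 3 x + Ra * T x"
  shows "\<Lambda> * vint (\<lambda>x. \<Sum>i\<in>UNIV. u i x * JB i x) = Ek * N2
    - \<Lambda> * Ra * vint (\<lambda>x. psi 2 x * JB 1 x - psi 1 x * JB 2 x)
    + Ek * Ra * vint (\<lambda>x. \<Sum>j\<in>UNIV. pd j (u 1) x * psi2 j 2 x - pd j (u 2) x * psi2 j 1 x)"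
proof -
  note fi = fld_intros fld_JB fld_Lap[OF u] fld_psi fld_psi2 flds
  have gradpsi: "vint (\<lambda>x. \<Sum>k\<in>UNIV. u k x * grad_psi k x) = 0"
    by (rule vint_divfree_grad[of u "\<lambda>k. pd k (u k)" "vp T"])
       (use u_wall in \<open>auto intro!: has_pd_vp_T sm_has_pd u flds fld_vp fld_grad_psi div_u\<close>)
  have gradP: "vint (\<lambda>x. \<Sum>k\<in>UNIV. u k x * pd k P x) = 0"
    by (rule vint_divfree_grad[of u "\<lambda>k. pd k (u k)" P])
       (use u_wall in \<open>auto intro!: sm_has_pd u P flds div_u\<close>)
  have jac: "vint (\<lambda>x. pd 1 P x * psi 2 x - pd 2 P x * psi 1 x) = 0"
    by (rule vint_jacobian[OF P has_pd_psi has_pd_psi]) (auto intro!: fi simp: psi2_commute)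
  \<comment> \<open>\<open>psi k\<close> need not vanish at the top; the wall terms disappear
    because the horizontal velocities satisfy Neumann conditions there.\<close>
  have lap: "vint (\<lambda>x. Lap (u i) x * psi k x) = - vint (\<lambda>x. \<Sum>j\<in>UNIV. pd j (u i) x * psi2 j k x)" if "i \<noteq> 3" for i k
  proof -
    have "vint (\<lambda>x. Lap (u i) x * psi k x) = - (\<Sum>j\<in>UNIV. vint (\<lambda>x. pd j (u i) x * psi2 j k x))"
      unfolding Lap_def
      by (rule green) (use u_wall that exhaust_3[of i] in \<open>auto intro!: sm_intros smf has_pd_psi fld_psi fld_psi2\<close>)
    then show ?thesis by (simp add: vint_sum fi)
  qed
  \<comment> \<open>Multiply the three equations by \<open>u 1 + Ra * psi 2\<close>,
    \<open>u 2 - Ra * psi 1\<close>, \<open>u 3\<close>. The Coriolis terms leave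
    \<open>- Ra (u 1 psi 1 + u 2 psi 2)\<close>, and together with the buoyancy
    \<open>- Ra T u 3\<close> this is \<open>- Ra\<close> times the product of \<open>u\<close> and
    \<open>grad_psi\<close>.\<close>
  have eq: "vint (\<lambda>x. \<Lambda> * (\<Sum>i\<in>UNIV. u i x * JB i x) + \<Lambda> * Ra * (psi 2 x * JB 1 x - psi 1 x * JB 2 x))
    = vint (\<lambda>x. (\<Sum>k\<in>UNIV. u k x * pd k P x) + Ra * (pd 1 P x * psi 2 x - pd 2 P x * psi 1 x)
        - Ra * (\<Sum>k\<in>UNIV. u k x * grad_psi k x)
        - Ek * (\<Sum>i\<in>UNIV. Lap (u i) x * u i x) - Ek * Ra * (Lap (u 1) x * psi 2 x - Lap (u 2) x * psi 1 x))"
  proof (rule vint_cong)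
    fix x assume x: "x \<in> slab"
    have "\<Lambda> * (\<Sum>i\<in>UNIV. u i x * JB i x) + \<Lambda> * Ra * (psi 2 x * JB 1 x - psi 1 x * JB 2 x)
      = (u 1 x + Ra * psi 2 x) * (\<Lambda> * JB 1 x) + (u 2 x - Ra * psi 1 x) * (\<Lambda> * JB 2 x) + u 3 x * (\<Lambda> * JB 3 x)"
      by (simp add: sum_3 algebra_simps)
    also have "\<Lambda> * JB 3 x = pd 3 P x - Ek * Lap (u 3) x - Ra * T x" using mom(3)[OF x] by simp
    also have "(u 1 x + Ra * psi 2 x) * (\<Lambda> * JB 1 x) + (u 2 x - Ra * psi 1 x) * (\<Lambda> * JB 2 x) + u 3 x * \<dots>
      = (\<Sum>k\<in>UNIV. u k x * pd k P x) + Ra * (pd 1 P x * psi 2 x - pd 2 P x * psi 1 x)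
        - Ra * (\<Sum>k\<in>UNIV. u k x * grad_psi k x)
        - Ek * (\<Sum>i\<in>UNIV. Lap (u i) x * u i x) - Ek * Ra * (Lap (u 1) x * psi 2 x - Lap (u 2) x * psi 1 x)"
      unfolding mom(1)[OF x, symmetric] mom(2)[OF x, symmetric] by (simp add: sum_3 grad_psi_def algebra_simps)
    finally show "\<Lambda> * (\<Sum>i\<in>UNIV. u i x * JB i x) + \<Lambda> * Ra * (psi 2 x * JB 1 x - psi 1 x * JB 2 x) = \<dots>" .
  qed
  have f1: "fld (\<lambda>x. \<Sum>k\<in>UNIV. u k x * grad_psi k x)"
    by (intro fld_sum fld_mult fld_grad_psi flds)
  have f2: "fld (\<lambda>x. \<Sum>k\<in>UNIV. u k x * pd k P x)" "fld (\<lambda>x. \<Sum>i\<in>UNIV. Lap (u i) x * u i x)"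
    "fld (\<lambda>x. \<Sum>i\<in>UNIV. u i x * JB i x)" "fld (\<lambda>x. psi 2 x * JB 1 x - psi 1 x * JB 2 x)"
    "fld (\<lambda>x. Lap (u 1) x * psi 2 x - Lap (u 2) x * psi 1 x)" "fld (\<lambda>x. pd 1 P x * psi 2 x - pd 2 P x * psi 1 x)"
    by (intro fi)+
  have lhs: "vint (\<lambda>x. \<Lambda> * (\<Sum>i\<in>UNIV. u i x * JB i x) + \<Lambda> * Ra * (psi 2 x * JB 1 x - psi 1 x * JB 2 x))
    = \<Lambda> * vint (\<lambda>x. \<Sum>i\<in>UNIV. u i x * JB i x) + \<Lambda> * Ra * vint (\<lambda>x. psi 2 x * JB 1 x - psi 1 x * JB 2 x)"
    by (subst vint_add) (auto intro!: fld_mult[OF fld_const] f2 simp: vint_cmult)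
  have rhs: "vint (\<lambda>x. (\<Sum>k\<in>UNIV. u k x * pd k P x) + Ra * (pd 1 P x * psi 2 x - pd 2 P x * psi 1 x)
        - Ra * (\<Sum>k\<in>UNIV. u k x * grad_psi k x)
        - Ek * (\<Sum>i\<in>UNIV. Lap (u i) x * u i x) - Ek * Ra * (Lap (u 1) x * psi 2 x - Lap (u 2) x * psi 1 x))
     = Ek * N2 - Ek * Ra * vint (\<lambda>x. Lap (u 1) x * psi 2 x - Lap (u 2) x * psi 1 x)"
  proof -
    note fc = fld_add fld_diff fld_mult[OF fld_const] f1 f2
    have "vint (\<lambda>x. (\<Sum>k\<in>UNIV. u k x * pd k P x) + Ra * (pd 1 P x * psi 2 x - pd 2 P x * psi 1 x)
        - Ra * (\<Sum>k\<in>UNIV. u k x * grad_psi k x)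
        - Ek * (\<Sum>i\<in>UNIV. Lap (u i) x * u i x) - Ek * Ra * (Lap (u 1) x * psi 2 x - Lap (u 2) x * psi 1 x))
     = vint (\<lambda>x. \<Sum>k\<in>UNIV. u k x * pd k P x) + Ra * vint (\<lambda>x. pd 1 P x * psi 2 x - pd 2 P x * psi 1 x)
        - Ra * vint (\<lambda>x. \<Sum>k\<in>UNIV. u k x * grad_psi k x)
        - Ek * vint (\<lambda>x. \<Sum>i\<in>UNIV. Lap (u i) x * u i x) - Ek * Ra * vint (\<lambda>x. Lap (u 1) x * psi 2 x - Lap (u 2) x * psi 1 x)"
      by (subst vint_diff vint_add, (intro fc)+)+ (simp only: vint_cmult)
    then show ?thesis using gradP jac gradpsi vint_u_Lap by simp
  qed
  have "vint (\<lambda>x. Lap (u 1) x * psi 2 x - Lap (u 2) x * psi 1 x)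
    = - vint (\<lambda>x. \<Sum>j\<in>UNIV. pd j (u 1) x * psi2 j 2 x - pd j (u 2) x * psi2 j 1 x)"
    by (simp add: vint_diff fi lap sum_subtractf)
  then show ?thesis using eq lhs rhs by simp
qed

lemma thermal_wind_le:
  "\<bar>vint (\<lambda>x. \<Sum>j\<in>UNIV. pd j (u 1) x * psi2 j 2 x - pd j (u 2) x * psi2 j 1 x)\<bar>
   \<le> sqrt N2 * sqrt (\<Sum>j\<in>UNIV. vint (\<lambda>x. (psi2 j 1 x)\<^sup>2) + vint (\<lambda>x. (psi2 j 2 x)\<^sup>2))"
    (is "_ \<le> _ * sqrt ?G")
proof -
  note fi = fld_intros fld_psi2 flds
  \<comment> \<open>Pairing one velocity gradient with the rotated wind gradient as a single sum
    over component and direction gives one Cauchy--Schwarz with constant 1; the Boolean selects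
    \<open>u 1\<close> or \<open>u 2\<close>.\<close>
  define f where "f a = (case a of (b, j) \<Rightarrow> pd j (u (if b then 1 else 2)))" for a :: "bool \<times> 3"
  define g where "g a = (case a of (b, j) \<Rightarrow> (\<lambda>x. if b then psi2 j 2 x else - psi2 j 1 x))" for a :: "bool \<times> 3"
  have s: "(\<Sum>a\<in>UNIV. h a) = (\<Sum>j\<in>UNIV. h (True, j) + h (False, j))" for h :: "bool \<times> 3 \<Rightarrow> real"
  proof -
    have "(\<Sum>a\<in>UNIV. h a) = (\<Sum>b\<in>UNIV. \<Sum>j\<in>UNIV. h (b, j))"
      unfolding UNIV_Times_UNIV[symmetric] by (rule sum.cartesian_product')
    then show ?thesis by (simp add: UNIV_bool sum.distrib)
  qed
  have ff: "fld (f a)" and fg: "fld (g a)" for a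
    by (cases a; cases "fst a"; auto simp: f_def g_def intro!: fi)+
  have "\<bar>vint (\<lambda>x. \<Sum>a\<in>UNIV. f a x * g a x)\<bar> \<le> sqrt (\<Sum>a\<in>UNIV. vint (\<lambda>x. (f a x)\<^sup>2)) * sqrt (\<Sum>a\<in>UNIV. vint (\<lambda>x. (g a x)\<^sup>2))"
    by (rule vint_sum_mult_le) (auto intro: ff fg)
  moreover have "(\<Sum>a\<in>UNIV. f a x * g a x) = (\<Sum>j\<in>UNIV. pd j (u 1) x * psi2 j 2 x - pd j (u 2) x * psi2 j 1 x)" for x
    unfolding s by (simp add: f_def g_def)
  moreover have "(\<Sum>a\<in>UNIV. vint (\<lambda>x. (g a x)\<^sup>2)) = ?G"
    unfolding s by (simp add: g_def add.commute)
  ultimately have "\<bar>vint (\<lambda>x. \<Sum>j\<in>UNIV. pd j (u 1) x * psi2 j 2 x - pd j (u 2) x * psi2 j 1 x)\<bar>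
      \<le> sqrt (\<Sum>a\<in>UNIV. vint (\<lambda>x. (f a x)\<^sup>2)) * sqrt ?G"
    by simp
  also have "\<dots> \<le> sqrt N2 * sqrt ?G"
  proof (intro mult_right_mono real_sqrt_le_mono)
    show "(\<Sum>a\<in>UNIV. vint (\<lambda>x. (f a x)\<^sup>2)) \<le> N2"
      unfolding s N2_def by (simp add: f_def sum_3 vint_pd_sq_nonneg)
    show "0 \<le> sqrt ?G"
      by (intro real_sqrt_ge_zero sum_nonneg add_nonneg_nonneg vint_nonneg fi) auto
  qed
  finally show ?thesis .
qed

end

section \<open>The temperature perturbation\<close>

lemma has_pd_of_z:
  assumes "\<And>z. z \<in> {0..1} \<Longrightarrow> (h has_real_derivative h' z) (at z within {0..1})"
  shows "has_pd 3 (\<lambda>x. h (x $ 3)) (\<lambda>x. h' (x $ 3))"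
  unfolding has_pd_def
proof
  fix x :: "real^3" assume x: "x \<in> slab"
  have S: "{s. x + s *\<^sub>R axis 3 1 \<in> slab} = {s. x $ 3 + s \<in> {0..1}}" by (auto simp: slab_def axis_def)
  have im: "(+) (x $ 3) ` {s. x $ 3 + s \<in> {0..1}} = {0..1}"
    by (force simp: image_iff intro!: exI[of _ "_ - x $ 3"])
  have "(h has_real_derivative h' (x $ 3)) (at (x $ 3 + 0) within (+) (x $ 3) ` {s. x $ 3 + s \<in> {0..1}})"
    unfolding im using assms x by (simp add: slab_def)
  then have "((\<lambda>s. h (x $ 3 + s)) has_real_derivative h' (x $ 3)) (at 0 within {s. x $ 3 + s \<in> {0..1}})"
    unfolding DERIV_at_within_shift .
  then show "((\<lambda>s. h ((x + s *\<^sub>R axis 3 1) $ 3)) has_real_derivative h' (x $ 3)) (at 0 within {s. x + s *\<^sub>R axis 3 1 \<in> slab})"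
    unfolding S by (simp add: axis_def)
qed

lemma has_pd_of_z_xy: "k \<noteq> 3 \<Longrightarrow> has_pd k (\<lambda>x. h (x $ 3)) (\<lambda>x. 0)"
  unfolding has_pd_def by (simp add: axis_def)

text \<open>\<open>\<theta>t\<close> is the time derivative of \<open>T\<close>, hence also of the
  perturbation since \<open>\<tau>\<close> is steady; it vanishes on the walls because the wall
  temperatures are constant. \<open>\<tau>1\<close> and \<open>\<tau>2\<close> are the first two
  derivatives of \<open>\<tau>\<close>.\<close>

locale heated_fluid = fluid +
  fixes Pe :: real and \<tau> \<tau>1 \<tau>2 :: "real \<Rightarrow> real" and \<theta>t :: "real^3 \<Rightarrow> real"
  assumes Pe: "0 < Pe"
    and \<tau>: "\<And>z. z \<in> {0..1} \<Longrightarrow> (\<tau> has_real_derivative \<tau>1 z) (at z within {0..1})"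
    and \<tau>1: "\<And>z. z \<in> {0..1} \<Longrightarrow> (\<tau>1 has_real_derivative \<tau>2 z) (at z within {0..1})"
    and c\<tau>2: "continuous_on {0..1} \<tau>2"
    and T_wall: "\<And>x. x \<in> S_minus \<union> S_plus \<Longrightarrow> T x = \<tau> (x $ 3)"
    and \<theta>t: "sm \<theta>t" and \<theta>t_wall: "\<And>x. x \<in> S_minus \<union> S_plus \<Longrightarrow> \<theta>t x = 0"
begin

definition \<theta> :: "real^3 \<Rightarrow> real" where "\<theta> x = T x - \<tau> (x $ 3)"
definition d\<theta> :: "3 \<Rightarrow> real^3 \<Rightarrow> real" where "d\<theta> k x = (if k = 3 then pd k T x - \<tau>1 (x $ 3) else pd k T x)"
definition dd\<theta> :: "3 \<Rightarrow> 3 \<Rightarrow> real^3 \<Rightarrow> real" where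
  "dd\<theta> j k x = (if j = 3 \<and> k = 3 then pd j (pd k T) x - \<tau>2 (x $ 3) else pd j (pd k T) x)"
definition lap\<theta> :: "real^3 \<Rightarrow> real" where "lap\<theta> x = (\<Sum>k\<in>UNIV. dd\<theta> k k x)"
definition M2 :: real where "M2 = vint (\<lambda>x. (lap\<theta> x)\<^sup>2)"

lemma c\<tau>: "continuous_on {0..1} \<tau>" "continuous_on {0..1} \<tau>1"
  using DERIV_continuous_on \<tau> \<tau>1 by blast+

lemma fld_\<theta>: "fld \<theta>" unfolding \<theta>_def[abs_def] by (intro fld_diff fld_z c\<tau> flds)
lemma fld_d\<theta>: "fld (d\<theta> k)"
  unfolding d\<theta>_def[abs_def] by (cases "k = 3") (auto intro!: fld_diff[OF _ fld_z] c\<tau> flds)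
lemma fld_dd\<theta>: "fld (dd\<theta> j k)"
  unfolding dd\<theta>_def[abs_def] by (cases "j = 3 \<and> k = 3") (auto intro!: fld_diff[OF _ fld_z] c\<tau>2 flds)
lemma fld_lap\<theta>: "fld lap\<theta>" unfolding lap\<theta>_def[abs_def] by (intro fld_sum fld_dd\<theta>)

lemma has_pd_\<theta>: "has_pd k \<theta> (d\<theta> k)"
proof (cases "k = 3")
  case True
  have "has_pd 3 (\<lambda>x. T x - \<tau> (x $ 3)) (\<lambda>x. pd 3 T x - \<tau>1 (x $ 3))"
    by (intro has_pd_diff has_pd_of_z sm_has_pd T \<tau>)
  then show ?thesis unfolding \<theta>_def[abs_def] d\<theta>_def[abs_def] True by simp
next
  case False
  have "has_pd k (\<lambda>x. T x - \<tau> (x $ 3)) (\<lambda>x. pd k T x - 0)"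
    by (intro has_pd_diff has_pd_of_z_xy sm_has_pd T False)
  then show ?thesis unfolding \<theta>_def[abs_def] d\<theta>_def[abs_def] using False by simp
qed

lemma has_pd_d\<theta>: "has_pd j (d\<theta> k) (dd\<theta> j k)"
proof (cases "k = 3")
  case True
  show ?thesis
  proof (cases "j = 3")
    assume "j = 3"
    have "has_pd 3 (\<lambda>x. pd 3 T x - \<tau>1 (x $ 3)) (\<lambda>x. pd 3 (pd 3 T) x - \<tau>2 (x $ 3))"
      by (intro has_pd_diff has_pd_of_z sm_has_pd sm_pd T \<tau>1)
    then show ?thesis unfolding d\<theta>_def[abs_def] dd\<theta>_def[abs_def] \<open>k = 3\<close> \<open>j = 3\<close> by simp
  next
    assume j: "j \<noteq> 3"
    have "has_pd j (\<lambda>x. pd 3 T x - \<tau>1 (x $ 3)) (\<lambda>x. pd j (pd 3 T) x - 0)"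
      by (intro has_pd_diff has_pd_of_z_xy sm_has_pd sm_pd T j)
    then show ?thesis unfolding d\<theta>_def[abs_def] dd\<theta>_def[abs_def] \<open>k = 3\<close> using j by simp
  qed
next
  case False
  then show ?thesis
    unfolding d\<theta>_def[abs_def] dd\<theta>_def[abs_def] by (auto intro!: sm_has_pd sm_pd T)
qed

lemma dd\<theta>_commute: "x \<in> slab \<Longrightarrow> dd\<theta> j k x = dd\<theta> k j x"
  unfolding dd\<theta>_def using sm_commute[OF T, of x j k] by auto

lemma \<theta>_wall: "x \<in> S_minus \<union> S_plus \<Longrightarrow> \<theta> x = 0"
  using T_wall by (simp add: \<theta>_def)

lemma d\<theta>_wall: "k \<noteq> 3 \<Longrightarrow> x \<in> S_minus \<union> S_plus \<Longrightarrow> d\<theta> k x = 0"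
  using tangential_derivative_0[OF has_pd_\<theta>] \<theta>_wall by blast

lemma d\<theta>_xy: "k \<noteq> 3 \<Longrightarrow> d\<theta> k = pd k T"
  unfolding d\<theta>_def[abs_def] by simp

lemma dd\<theta>_xy: "k \<noteq> 3 \<Longrightarrow> dd\<theta> j k = pd j (pd k T)"
  unfolding dd\<theta>_def[abs_def] by simp

lemma dd\<theta>_wall: "k \<noteq> 3 \<Longrightarrow> x \<in> S_minus \<union> S_plus \<Longrightarrow> dd\<theta> k k x = 0"
  using tangential_derivative_0[OF has_pd_d\<theta>[of k k]] d\<theta>_wall by blast

text \<open>Two integrations by parts give \<open>\<integral> \<theta>\<^sub>k\<^sub>k \<theta>\<^sub>j\<^sub>j = \<integral> \<theta>\<^sub>j\<^sub>k\<^sup>2\<close>; only derivatives of order three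
  that involve a horizontal direction occur, so \<open>\<tau>\<close> need not be smooth.\<close>

lemma vint_cross:
  assumes k: "k \<noteq> 3" and jk: "j \<noteq> k"
  shows "vint (\<lambda>x. dd\<theta> j j x * dd\<theta> k k x) = vint (\<lambda>x. (dd\<theta> k j x)\<^sup>2)"
proof -
  have T3: "sm (pd k T)" "sm (pd k (pd k T))" "sm (pd j (pd k T))" by (intro sm_pd T)+
  have "vint (\<lambda>x. dd\<theta> j j x * dd\<theta> k k x) = - vint (\<lambda>x. d\<theta> j x * pd j (pd k (pd k T)) x)"
    unfolding dd\<theta>_xy[OF k]
    by (rule vint_by_parts[OF has_pd_d\<theta> sm_has_pd[OF T3(2)]])
       (use dd\<theta>_wall[OF k] dd\<theta>_xy[OF k] in \<open>auto intro!: fld_d\<theta> fld_dd\<theta> flds sm_fld[OF sm_pd[OF T3(2)]]\<close>)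
  also have "vint (\<lambda>x. d\<theta> j x * pd j (pd k (pd k T)) x) = vint (\<lambda>x. d\<theta> j x * pd k (pd j (pd k T)) x)"
    by (rule vint_cong) (use sm_commute[OF T3(1)] in simp)
  also have "- \<dots> = vint (\<lambda>x. dd\<theta> k j x * pd j (pd k T) x)"
    by (rule vint_by_parts[OF has_pd_d\<theta> sm_has_pd[OF T3(3)], symmetric])
       (use k in \<open>auto intro!: fld_d\<theta> fld_dd\<theta> flds sm_fld[OF sm_pd[OF T3(3)]]\<close>)
  also have "\<dots> = vint (\<lambda>x. (dd\<theta> k j x)\<^sup>2)"
    by (rule vint_cong) (use dd\<theta>_xy[OF k, of j] dd\<theta>_commute[of _ j k] in \<open>simp add: power2_eq_square\<close>)
  finally show ?thesis .
qed

text \<open>The L2 norm of the Laplacian equals that of the full Hessian, so \<open>M2\<close>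
  controls each second derivative without an elliptic constant.\<close>

lemma M2_eq: "M2 = (\<Sum>j\<in>UNIV. \<Sum>k\<in>UNIV. vint (\<lambda>x. (dd\<theta> j k x)\<^sup>2))"
proof -
  note fi = fld_intros fld_dd\<theta>
  have "M2 = vint (\<lambda>x. (dd\<theta> 1 1 x)\<^sup>2 + (dd\<theta> 2 2 x)\<^sup>2 + (dd\<theta> 3 3 x)\<^sup>2
      + 2 * (dd\<theta> 2 2 x * dd\<theta> 1 1 x) + 2 * (dd\<theta> 3 3 x * dd\<theta> 1 1 x) + 2 * (dd\<theta> 3 3 x * dd\<theta> 2 2 x))"
    unfolding M2_def by (rule vint_cong) (simp add: lap\<theta>_def sum_3 power2_eq_square algebra_simps)
  also have "\<dots> = vint (\<lambda>x. (dd\<theta> 1 1 x)\<^sup>2) + vint (\<lambda>x. (dd\<theta> 2 2 x)\<^sup>2) + vint (\<lambda>x. (dd\<theta> 3 3 x)\<^sup>2)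
      + 2 * vint (\<lambda>x. (dd\<theta> 1 2 x)\<^sup>2) + 2 * vint (\<lambda>x. (dd\<theta> 1 3 x)\<^sup>2) + 2 * vint (\<lambda>x. (dd\<theta> 2 3 x)\<^sup>2)"
    using vint_cross[of 1 2] vint_cross[of 1 3] vint_cross[of 2 3] by (simp add: vint_add vint_cmult fi)
  also have "\<dots> = (\<Sum>j\<in>UNIV. \<Sum>k\<in>UNIV. vint (\<lambda>x. (dd\<theta> j k x)\<^sup>2))"
  proof -
    have "vint (\<lambda>x. (dd\<theta> j k x)\<^sup>2) = vint (\<lambda>x. (dd\<theta> k j x)\<^sup>2)" for j k
      by (rule vint_cong) (simp add: dd\<theta>_commute)
    from this[of 2 1] this[of 3 1] this[of 3 2] show ?thesis by (simp add: sum_3)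
  qed
  finally show ?thesis .
qed

lemma M2_nonneg: "0 \<le> M2"
  unfolding M2_def by (rule vint_nonneg) (auto intro!: fld_intros fld_lap\<theta>)

lemma vint_dd_nonneg: "0 \<le> vint (\<lambda>x. (dd\<theta> j k x)\<^sup>2)"
  by (rule vint_nonneg) (auto intro!: fld_intros fld_dd\<theta>)

text \<open>Wirtinger gives \<open>1 / pi^2\<close>; the weaker 1/2 is recorded because it matches
  \<open>vint_vp_le\<close>, so that all second derivatives in \<open>psi2_le\<close> carry the same
  factor.\<close>

lemma d\<theta>_le: "k \<noteq> 3 \<Longrightarrow> vint (\<lambda>x. (d\<theta> k x)\<^sup>2) \<le> 1/2 * vint (\<lambda>x. (dd\<theta> 3 k x)\<^sup>2)"
proof -
  assume k: "k \<noteq> 3"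
  have "pi\<^sup>2 * vint (\<lambda>x. (d\<theta> k x)\<^sup>2) \<le> vint (\<lambda>x. (dd\<theta> 3 k x)\<^sup>2)"
    by (rule vint_dirichlet[OF has_pd_d\<theta> fld_d\<theta> fld_dd\<theta>]) (use d\<theta>_wall[OF k] in blast)
  moreover have "2 * vint (\<lambda>x. (d\<theta> k x)\<^sup>2) \<le> pi\<^sup>2 * vint (\<lambda>x. (d\<theta> k x)\<^sup>2)"
  proof (rule mult_right_mono)
    have "2 * 2 \<le> pi * pi" using pi_ge_two by (intro mult_mono) auto
    then show "2 \<le> pi\<^sup>2" by (simp add: power2_eq_square)
  qed (auto intro!: vint_nonneg fld_intros fld_d\<theta>)
  ultimately show ?thesis by simp
qed

text \<open>Horizontal derivatives do not see \<open>\<tau>\<close>, so the Hessian entries of the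
  primitive of \<open>T\<close> are primitives of Hessian entries of the perturbation, or, for
  \<open>j = 3\<close>, its horizontal gradient, which satisfies Dirichlet conditions.\<close>

lemma psi2_le: "(\<Sum>j\<in>UNIV. vint (\<lambda>x. (psi2 j 1 x)\<^sup>2) + vint (\<lambda>x. (psi2 j 2 x)\<^sup>2)) \<le> 1/2 * M2"
proof -
  have h: "vint (\<lambda>x. (psi2 j k x)\<^sup>2) \<le> 1/2 * vint (\<lambda>x. (dd\<theta> j k x)\<^sup>2)" if "k \<noteq> 3" for j k
  proof (cases "j = 3")
    case True then show ?thesis using d\<theta>_le[OF that] d\<theta>_xy[OF that] by (simp add: psi2_def)
  next
    case False then show ?thesis using vint_vp_le[OF flds(12), of j k] dd\<theta>_xy[OF that] by (simp add: psi2_def)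
  qed
  have "(\<Sum>j\<in>UNIV. vint (\<lambda>x. (psi2 j 1 x)\<^sup>2) + vint (\<lambda>x. (psi2 j 2 x)\<^sup>2))
    \<le> (\<Sum>j\<in>UNIV. 1/2 * vint (\<lambda>x. (dd\<theta> j 1 x)\<^sup>2) + 1/2 * vint (\<lambda>x. (dd\<theta> j 2 x)\<^sup>2))"
    by (intro sum_mono add_mono h) auto
  also have "\<dots> \<le> 1/2 * M2"
    unfolding M2_eq using vint_dd_nonneg[of 1 3] vint_dd_nonneg[of 2 3] vint_dd_nonneg[of 3 3] by (simp add: sum_3)
  finally show ?thesis .
qed

text \<open>The heat equation tested with the Laplacian of the perturbation. Green's formula turns
  the time derivative into that of the gradient energy; the wall term vanishes with
  \<open>\<theta>t\<close>.\<close>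

lemma temperature_energy:
  assumes heat: "\<And>x. x \<in> slab \<Longrightarrow> Pe * \<theta>t x = lap\<theta> x - Pe * (\<Sum>k\<in>UNIV. u k x * d\<theta> k x) - Pe * (u 3 x * \<tau>1 (x $ 3))"
  shows "Pe * vint (\<lambda>x. \<Sum>k\<in>UNIV. d\<theta> k x * pd k \<theta>t x)
    = - M2 + Pe * vint (\<lambda>x. lap\<theta> x * (\<Sum>k\<in>UNIV. u k x * d\<theta> k x)) + Pe * vint (\<lambda>x. lap\<theta> x * (u 3 x * \<tau>1 (x $ 3)))"
proof -
  have ft: "fld \<theta>t" "fld (pd k \<theta>t)" for k using \<theta>t by (auto intro: sm_fld sm_pd)
  have fz: "fld (\<lambda>x. \<tau>1 (x $ 3))" by (intro fld_z c\<tau>)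
  note fi = fld_intros fld_lap\<theta> fld_d\<theta> flds fz ft
  have "vint (\<lambda>x. lap\<theta> x * \<theta>t x) = - (\<Sum>k\<in>UNIV. vint (\<lambda>x. d\<theta> k x * pd k \<theta>t x))"
    unfolding lap\<theta>_def
    by (rule green) (use \<theta>t_wall in \<open>auto intro!: has_pd_d\<theta> fld_d\<theta> fld_dd\<theta> ft sm_has_pd[OF \<theta>t]\<close>)
  moreover have "Pe * vint (\<lambda>x. lap\<theta> x * \<theta>t x)
     = vint (\<lambda>x. (lap\<theta> x)\<^sup>2 - Pe * (lap\<theta> x * (\<Sum>k\<in>UNIV. u k x * d\<theta> k x)) - Pe * (lap\<theta> x * (u 3 x * \<tau>1 (x $ 3))))"
  proof -
    have "vint (\<lambda>x. lap\<theta> x * (Pe * \<theta>t x)) = vint (\<lambda>x. (lap\<theta> x)\<^sup>2 - Pe * (lap\<theta> x * (\<Sum>k\<in>UNIV. u k x * d\<theta> k x)) - Pe * (lap\<theta> x * (u 3 x * \<tau>1 (x $ 3))))"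
      by (rule vint_cong) (simp only: heat, simp add: power2_eq_square algebra_simps)
    moreover have "vint (\<lambda>x. lap\<theta> x * (Pe * \<theta>t x)) = Pe * vint (\<lambda>x. lap\<theta> x * \<theta>t x)"
      by (simp add: mult.left_commute[of _ Pe] vint_cmult)
    ultimately show ?thesis by simp
  qed
  moreover have "\<dots> = M2 - Pe * vint (\<lambda>x. lap\<theta> x * (\<Sum>k\<in>UNIV. u k x * d\<theta> k x)) - Pe * vint (\<lambda>x. lap\<theta> x * (u 3 x * \<tau>1 (x $ 3)))"
    unfolding M2_def by (subst vint_diff vint_diff, (intro fi)+)+ (simp only: vint_cmult)
  moreover have "vint (\<lambda>x. \<Sum>k\<in>UNIV. d\<theta> k x * pd k \<theta>t x) = (\<Sum>k\<in>UNIV. vint (\<lambda>x. d\<theta> k x * pd k \<theta>t x))"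
    by (rule vint_sum) (auto intro!: fi)
  ultimately show ?thesis by simp
qed

lemma forcing_le:
  "\<bar>vint (\<lambda>x. lap\<theta> x * (u 3 x * \<tau>1 (x $ 3)))\<bar> \<le> sqrt M2 * (sqrt (integral {0..1} (\<lambda>z. (\<tau>1 z)\<^sup>2)) * sqrt N2)"
proof -
  have fz: "fld (\<lambda>x. \<tau>1 (x $ 3))" by (intro fld_z c\<tau>)
  have "\<bar>vint (\<lambda>x. lap\<theta> x * (u 3 x * \<tau>1 (x $ 3)))\<bar> \<le> sqrt M2 * sqrt (vint (\<lambda>x. (u 3 x * \<tau>1 (x $ 3))\<^sup>2))"
    unfolding M2_def by (intro vint_abs_mult_le fld_intros fld_lap\<theta> flds fz)
  also have "vint (\<lambda>x. (u 3 x * \<tau>1 (x $ 3))\<^sup>2) \<le> integral {0..1} (\<lambda>z. (\<tau>1 z)\<^sup>2) * vint (\<lambda>x. (pd 3 (u 3) x)\<^sup>2)"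
    by (rule vint_mult_z_le) (use u_wall in \<open>auto intro!: sm_intros smf c\<tau>\<close>)
  also have "vint (\<lambda>x. (pd 3 (u 3) x)\<^sup>2) \<le> N2"
    using vint_pd_sq_nonneg(2)[of _ 1] vint_pd_sq_nonneg(2)[of _ 2] vint_pd_sq_nonneg(2)[of 1 3] vint_pd_sq_nonneg(2)[of 2 3]
    unfolding N2_def by (simp add: sum_3 add_nonneg_nonneg)
  finally show ?thesis
    using M2_nonneg integral_nonneg[of "\<lambda>z. (\<tau>1 z)\<^sup>2" "{0..1}"]
    by (simp add: real_sqrt_mult mult_left_mono integrable_continuous_real continuous_on_power c\<tau>)
qed

text \<open>Testing the vanishing Laplacian with the perturbation annihilates its gradient, and the
  Dirichlet inequality then annihilates the perturbation. This settles the degenerate case of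
  \<open>dichotomy\<close>.\<close>

lemma lap\<theta>_zero:
  assumes "M2 = 0" and x: "x \<in> box_V Lx Ly" shows "\<theta> x = 0"
proof -
  have lap0: "lap\<theta> y = 0" if "y \<in> box_V Lx Ly" for y
    using vint_eq_0D[of "\<lambda>x. (lap\<theta> x)\<^sup>2" y] assms(1) that unfolding M2_def by (auto intro!: fld_intros fld_lap\<theta>)
  have nn: "0 \<le> vint (\<lambda>x. (d\<theta> k x)\<^sup>2)" for k by (rule vint_nonneg) (auto intro!: fld_intros fld_d\<theta>)
  have "vint (\<lambda>x. lap\<theta> x * \<theta> x) = - (\<Sum>k\<in>UNIV. vint (\<lambda>x. d\<theta> k x * d\<theta> k x))"
    unfolding lap\<theta>_def
    by (rule green) (use \<theta>_wall in \<open>auto intro!: has_pd_d\<theta> has_pd_\<theta> fld_\<theta> fld_d\<theta> fld_dd\<theta>\<close>)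
  moreover have "vint (\<lambda>x. lap\<theta> x * \<theta> x) = integral (box_V Lx Ly) (\<lambda>x. 0)"
    unfolding vint_def by (rule integral_cong) (simp add: lap0)
  ultimately have "vint (\<lambda>x. (d\<theta> 3 x)\<^sup>2) \<le> 0"
    using nn[of 1] nn[of 2] by (simp add: sum_3 power2_eq_square)
  moreover have "pi\<^sup>2 * vint (\<lambda>x. (\<theta> x)\<^sup>2) \<le> vint (\<lambda>x. (d\<theta> 3 x)\<^sup>2)"
    by (rule vint_dirichlet[OF has_pd_\<theta> fld_\<theta> fld_d\<theta>]) (use \<theta>_wall in blast)
  moreover have "0 \<le> vint (\<lambda>x. (\<theta> x)\<^sup>2)" by (rule vint_nonneg) (auto intro!: fld_intros fld_\<theta>)
  ultimately have "pi\<^sup>2 * vint (\<lambda>x. (\<theta> x)\<^sup>2) = 0"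
    by (smt (verit) mult_nonneg_nonneg zero_le_power2)
  then have "vint (\<lambda>x. (\<theta> x)\<^sup>2) = 0" by simp
  then show ?thesis using vint_eq_0D[of "\<lambda>x. (\<theta> x)\<^sup>2" x] x by (auto intro!: fld_intros fld_\<theta>)
qed

end

context fluid
begin

lemma K2_zero:
  assumes "K2 = 0" and x: "x \<in> box_V Lx Ly" shows "B i x = 0"
proof -
  have "0 \<le> vint nB" by (rule vint_nonneg[OF fld_nB]) (simp add: nB_def sum_nonneg)
  then have "vint nB = 0" using poincare_B assms(1) lambda1_pos
    by (metis less_eq_real_def mult_pos_pos not_less zero_less_power)
  then have "nB x = 0" using vint_eq_0D[OF fld_nB _ _ x] by (simp add: nB_def sum_nonneg)
  then have "\<forall>i\<in>UNIV. (B i x)\<^sup>2 = 0" unfolding nB_def by (subst (asm) sum_nonneg_eq_0_iff) auto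
  then show ?thesis by simp
qed

end

section \<open>Hoelder inequalities and Lebesgue norms\<close>

text \<open>Weighted arithmetic-geometric mean with weights 2/p, 1 - 3/p, 1/p, which add up to 1,
  from two applications of the two-term inequality. At \<open>p = 3\<close> the middle weight is 0,
  and \<open>y > 0\<close> ensures that \<open>y powr 0\<close> is 1.\<close>

lemma young3:
  fixes x y z :: real
  assumes p: "3 \<le> p" and nn: "0 \<le> x" "0 < y" "0 \<le> z"
  shows "x powr (2/p) * y powr (1 - 3/p) * z powr (1/p) \<le> 2/p * x + (1 - 3/p) * y + 1/p * z"
proof (cases "x = 0 \<or> z = 0")
  case True
  moreover have "0 \<le> 2/p * x + (1 - 3/p) * y + 1/p * z"
    using assms by (intro add_nonneg_nonneg mult_nonneg_nonneg) auto
  ultimately show ?thesis using p by auto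
next
  case False
  then have pos: "0 < x" "0 < z" using nn by auto
  \<comment> \<open>\<open>r\<close> is the joint weight of \<open>y\<close> and \<open>z\<close>,
    which are first merged into \<open>b\<close>.\<close>
  define r where "r = 1 - 2/p"
  have r: "0 < r" using p by (simp add: r_def field_simps)
  define b where "b = y powr ((1 - 3/p) / r) * z powr ((1/p) / r)"
  have b: "0 < b" using nn pos by (simp add: b_def)
  have "b \<le> (1 - 3/p) / r * y + (1/p) / r * z"
    unfolding b_def
  proof (rule Youngs_inequality_0)
    have "(1 - 3/p) + 1/p = r" using p by (simp add: r_def field_simps)
    then show "(1 - 3/p) / r + (1/p) / r = 1" using r by (simp only: add_divide_distrib[symmetric]) simp
  qed (use r p nn pos in auto)
  then have rb: "r * b \<le> (1 - 3/p) * y + 1/p * z" using r by (simp add: field_simps)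
  have "x powr (2/p) * b powr r \<le> 2/p * x + r * b"
    by (rule Youngs_inequality_0) (use r p pos b in \<open>auto simp: r_def\<close>)
  moreover have "b powr r = y powr (1 - 3/p) * z powr (1/p)"
    unfolding b_def using nn pos r by (simp add: powr_mult powr_powr)
  ultimately show ?thesis using rb by (simp add: mult.assoc)
qed

context cell
begin

lemma fld_powr: "fld f \<Longrightarrow> (\<And>x. x \<in> slab \<Longrightarrow> 0 \<le> f x) \<Longrightarrow> 0 < p \<Longrightarrow> fld (\<lambda>x. f x powr p)"
  unfolding fld_def periodic_xy_def using continuous_on_powr'[OF _ continuous_on_const, of slab f p] by auto

lemma vint_zero_on_box: "(\<And>x. x \<in> box_V Lx Ly \<Longrightarrow> f x = 0) \<Longrightarrow> vint f = 0"
  unfolding vint_def using integral_cong[of "box_V Lx Ly" f "\<lambda>_. 0"] by simp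

text \<open>Pointwise \<open>a^2 n = (a^p)^(2/p) * n^(1 - 3/p) * (n^3)^(1/p)\<close>; integrate
  \<open>young3\<close> after normalising the three integrals to 1. With \<open>n = |B|^2\<close>
  this interpolates the field between L2 and L6.\<close>

lemma hoelder3:
  assumes a: "fld a" "\<And>x. x \<in> slab \<Longrightarrow> 0 \<le> a x" and n: "fld n" "\<And>x. x \<in> slab \<Longrightarrow> 0 \<le> n x" and p: "3 \<le> p"
  shows "vint (\<lambda>x. (a x)\<^sup>2 * n x)
    \<le> vint (\<lambda>x. a x powr p) powr (2/p) * vint n powr (1 - 3/p) * vint (\<lambda>x. n x ^ 3) powr (1/p)"
proof -
  let ?X = "vint (\<lambda>x. a x powr p)" and ?Y = "vint n" and ?Z = "vint (\<lambda>x. n x ^ 3)"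
  have fa: "fld (\<lambda>x. a x powr p)" by (rule fld_powr[OF a]) (use p in auto)
  have fn: "fld (\<lambda>x. n x ^ 3)" by (intro fld_intros n)
  have X0: "0 \<le> ?X" and Y0: "0 \<le> ?Y" and Z0: "0 \<le> ?Z" by (auto intro!: vint_nonneg fa fn n)
  \<comment> \<open>If one of the integrals on the right is zero, its integrand vanishes throughout
    \<open>V\<close> by continuity, and no normalisation is possible or necessary.\<close>
  have triv: ?thesis if z: "\<And>x. x \<in> box_V Lx Ly \<Longrightarrow> a x = 0 \<or> n x = 0"
  proof -
    have "vint (\<lambda>x. (a x)\<^sup>2 * n x) = 0" by (rule vint_zero_on_box) (use z in auto)
    then show ?thesis by simp
  qed
  consider "?X = 0" | "?Y = 0" | "?Z = 0" | "0 < ?X" "0 < ?Y" "0 < ?Z" using X0 Y0 Z0 by linarith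
  then show ?thesis
  proof cases
    case 1
    show ?thesis by (rule triv) (use vint_eq_0D[OF fa _ 1] in auto)
  next
    case 2
    show ?thesis by (rule triv) (use vint_eq_0D[OF n(1) _ 2] n in auto)
  next
    case 3
    show ?thesis by (rule triv) (use vint_eq_0D[OF fn _ 3] n in auto)
  next
    case 4
    let ?C = "?X powr (2/p) * ?Y powr (1 - 3/p) * ?Z powr (1/p)"
    have C: "0 < ?C" using 4 by simp
    have pt: "(a x)\<^sup>2 * n x \<le> ?C * (2/p * (a x powr p / ?X) + (1 - 3/p) * (n x / ?Y) + 1/p * (n x ^ 3 / ?Z))" if x: "x \<in> slab" for x
    proof (cases "n x = 0")
      case True
      then show ?thesis using C X0 a(2)[OF x] p by (auto intro!: mult_nonneg_nonneg)
    next
      case False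
      then have nx: "0 < n x" using n(2)[OF x] by simp
      have "(a x powr p / ?X) powr (2/p) * (n x / ?Y) powr (1 - 3/p) * (n x ^ 3 / ?Z) powr (1/p)
        \<le> 2/p * (a x powr p / ?X) + (1 - 3/p) * (n x / ?Y) + 1/p * (n x ^ 3 / ?Z)"
        by (rule young3[OF p]) (use nx 4 in auto)
      moreover have "(a x powr p / ?X) powr (2/p) = (a x)\<^sup>2 / ?X powr (2/p)"
        using a(2)[OF x] 4 p by (cases "a x = 0") (simp_all add: powr_divide powr_powr)
      moreover have "(n x / ?Y) powr (1 - 3/p) * (n x ^ 3 / ?Z) powr (1/p) = n x / (?Y powr (1 - 3/p) * ?Z powr (1/p))"
      proof -
        have "n x ^ 3 = n x powr 3" using nx by simp
        then have "(n x ^ 3 / ?Z) powr (1/p) = n x powr (3/p) / ?Z powr (1/p)"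
          using nx 4 by (simp only: powr_divide powr_powr) simp
        moreover have "n x powr (1 - 3/p) * n x powr (3/p) = n x" using nx by (simp flip: powr_add)
        ultimately show ?thesis using nx 4 by (simp add: powr_divide)
      qed
      ultimately have "(a x)\<^sup>2 * n x / ?C \<le> 2/p * (a x powr p / ?X) + (1 - 3/p) * (n x / ?Y) + 1/p * (n x ^ 3 / ?Z)"
        by (simp add: mult_ac)
      then show ?thesis using C by (simp add: pos_divide_le_eq mult.commute)
    qed
    have "vint (\<lambda>x. (a x)\<^sup>2 * n x) \<le> vint (\<lambda>x. ?C * (2/p * (a x powr p / ?X) + (1 - 3/p) * (n x / ?Y) + 1/p * (n x ^ 3 / ?Z)))"
      by (intro vint_mono pt fld_mult fld_add fld_const fld_divide fld_power fa a n)
    also have "\<dots> = ?C * (2/p * (?X / ?X) + (1 - 3/p) * (?Y / ?Y) + 1/p * (?Z / ?Z))"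
    proof -
      have d: "vint (\<lambda>x. f x / c) = vint f / c" for f c using vint_cmult[of "1/c" f] by simp
      have "vint (\<lambda>x. 2/p * (a x powr p / ?X) + (1 - 3/p) * (n x / ?Y) + 1/p * (n x ^ 3 / ?Z))
        = vint (\<lambda>x. 2/p * (a x powr p / ?X)) + vint (\<lambda>x. (1 - 3/p) * (n x / ?Y)) + vint (\<lambda>x. 1/p * (n x ^ 3 / ?Z))"
        by (subst vint_add vint_add, (intro fld_mult fld_add fld_const fld_divide fld_power fa a n)+)+ (rule refl)
      then show ?thesis by (simp only: vint_cmult d)
    qed
    also have "\<dots> = ?C" using 4 by (simp add: field_simps)
    finally show ?thesis .
  qed
qed

lemma vint_lebesgue:
  assumes "fld f" shows "(LINT x|lebesgue_on (box_V Lx Ly). f x) = vint f" "integrable (lebesgue_on (box_V Lx Ly)) f"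
proof -
  have i: "integrable (lebesgue_on (box_V Lx Ly)) f"
    unfolding box_V_def by (rule continuous_imp_integrable[OF fld_box[OF assms]])
  then show "integrable (lebesgue_on (box_V Lx Ly)) f" .
  show "(LINT x|lebesgue_on (box_V Lx Ly). f x) = vint f"
    unfolding vint_def by (rule lebesgue_integral_eq_integral[OF i]) (simp add: box_V_def)
qed

lemma Lp_norm_vint:
  assumes a: "fld a" "\<And>x. x \<in> slab \<Longrightarrow> 0 \<le> a x" and e: "\<And>x. x \<in> box_V Lx Ly \<Longrightarrow> norm (f x) = a x" and p: "0 < p"
  shows "Lp_norm (ereal p) (box_V Lx Ly) f = vint (\<lambda>x. a x powr p) powr (1/p)"
proof -
  have "(LINT x|lebesgue_on (box_V Lx Ly). norm (f x) powr p) = (LINT x|lebesgue_on (box_V Lx Ly). a x powr p)"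
    by (rule Bochner_Integration.integral_cong) (simp_all add: e)
  also have "\<dots> = vint (\<lambda>x. a x powr p)" by (rule vint_lebesgue(1)[OF fld_powr[OF a p]])
  finally show ?thesis by (simp add: Lp_norm_def)
qed

text \<open>The endpoint of the Hoelder estimate. The essential supremum is finite because
  \<open>a\<close> is bounded on the compact box; an almost everywhere bound is enough under the
  integral.\<close>

lemma Lp_norm_infinity:
  assumes a: "fld a" "\<And>x. x \<in> slab \<Longrightarrow> 0 \<le> a x" and e: "\<And>x. x \<in> box_V Lx Ly \<Longrightarrow> norm (f x) = a x"
    and n: "fld n" "\<And>x. x \<in> slab \<Longrightarrow> 0 \<le> n x"
  shows "0 \<le> Lp_norm \<infinity> (box_V Lx Ly) f"
    and "vint (\<lambda>x. (a x)\<^sup>2 * n x) \<le> (Lp_norm \<infinity> (box_V Lx Ly) f)\<^sup>2 * vint n"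
proof -
  let ?M = "lebesgue_on (box_V Lx Ly)"
  let ?s = "esssup ?M (\<lambda>x. ereal (norm (f x)))"
  have sp: "space ?M = box_V Lx Ly" by simp
  have L: "Lp_norm \<infinity> (box_V Lx Ly) f = real_of_ereal ?s" by (simp add: Lp_norm_def)
  have "a \<in> borel_measurable ?M"
    using fld_box[OF a(1)] by (intro continuous_imp_measurable_on_sets_lebesgue) (auto simp: box_V_def)
  then have nm: "(\<lambda>x. norm (f x)) \<in> borel_measurable ?M"
    by (subst measurable_cong[where g = a]) (auto simp: e)
  then have m: "(\<lambda>x. ereal (norm (f x))) \<in> borel_measurable ?M" by simp
  have "bounded (a ` cbox 0 per)"
    by (intro compact_imp_bounded compact_continuous_image fld_box a) auto
  then obtain C where C: "\<And>x. x \<in> box_V Lx Ly \<Longrightarrow> a x \<le> C"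
    unfolding bounded_iff box_V_def by (metis abs_le_D1 imageI real_norm_def)
  have le: "?s \<le> ereal C"
    by (rule esssup_I[OF m]) (auto simp: e C)
  \<comment> \<open>The essential supremum of the constant 0 is 0 only on a space of positive
    measure; nonnegativity of the norm hinges on it.\<close>
  have box: "emeasure ?M (space ?M) \<noteq> 0"
  proof -
    have "emeasure ?M (space ?M) = emeasure lborel (cbox 0 per)"
      by (simp add: emeasure_restrict_space box_V_def)
    also have "\<dots> \<noteq> 0"
    proof -
      have "box 0 per \<noteq> {}" using per_pos by (simp add: interval_ne_empty_cart)
      then have "0 < measure lborel (cbox 0 per)" by (simp add: content_pos_lt_eq box_ne_empty)
      then show ?thesis by (metis enn2real_0 less_irrefl measure_def)
    qed
    finally show ?thesis .
  qed
  have "esssup ?M (\<lambda>x. 0) \<le> ?s" by (rule esssup_mono) auto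
  then have s0: "0 \<le> ?s" using esssup_const[OF box, of "0::ereal"] by simp
  then show "0 \<le> Lp_norm \<infinity> (box_V Lx Ly) f" unfolding L by (rule real_of_ereal_pos)
  have fin: "?s = ereal (real_of_ereal ?s)" using s0 le by (cases ?s) auto
  have "AE x in ?M. ereal (norm (f x)) \<le> ?s" by (rule esssup_AE)
  then have ae: "AE x in ?M. (a x)\<^sup>2 * n x \<le> (real_of_ereal ?s)\<^sup>2 * n x"
  proof (rule AE_mp, intro AE_I2 impI)
    fix x assume x: "x \<in> space ?M" and le: "ereal (norm (f x)) \<le> ?s"
    have xs: "x \<in> slab" using x box_V_slab by auto
    have "a x \<le> real_of_ereal ?s" using le fin e x by (metis ereal_less_eq(3) sp)
    then have "(a x)\<^sup>2 \<le> (real_of_ereal ?s)\<^sup>2" using a(2)[OF xs] by (rule power_mono)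
    then show "(a x)\<^sup>2 * n x \<le> (real_of_ereal ?s)\<^sup>2 * n x" using n(2)[OF xs] by (rule mult_right_mono)
  qed
  have f1: "fld (\<lambda>x. (a x)\<^sup>2 * n x)" "fld (\<lambda>x. (real_of_ereal ?s)\<^sup>2 * n x)" by (intro fld_intros a n)+
  have "vint (\<lambda>x. (a x)\<^sup>2 * n x) \<le> vint (\<lambda>x. (real_of_ereal ?s)\<^sup>2 * n x)"
    unfolding vint_lebesgue(1)[OF f1(1), symmetric] vint_lebesgue(1)[OF f1(2), symmetric]
    by (rule integral_mono_AE[OF vint_lebesgue(2)[OF f1(1)] vint_lebesgue(2)[OF f1(2)] ae])
  then show "vint (\<lambda>x. (a x)\<^sup>2 * n x) \<le> (Lp_norm \<infinity> (box_V Lx Ly) f)\<^sup>2 * vint n"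
    unfolding L by (simp add: vint_cmult)
qed

lemma C_S_pos: "0 < C_S Lx Ly"
proof -
  define s' where "s' = sqrt (1/4 + 1 / Lx\<^sup>2 + 1 / Ly\<^sup>2) / lambda1 Lx Ly"
  have "0 \<le> s'" unfolding s'_def
    by (intro divide_nonneg_pos lambda1_pos real_sqrt_ge_zero) simp
  then have "0 < 728/1000 * (2 + s')" by simp
  also have "\<dots> \<le> C_S Lx Ly" using C_S_lower unfolding s'_def .
  finally show ?thesis .
qed

end

section \<open>Work of the Lorentz force against the thermal wind\<close>

context fluid
begin

definition wind :: "real^3 \<Rightarrow> real" where "wind x = sqrt ((psi 1 x)\<^sup>2 + (psi 2 x)\<^sup>2)"

lemma fld_wind: "fld wind" unfolding wind_def[abs_def] by (intro fld_intros fld_psi)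

lemma norm_grad_xy: "x \<in> slab \<Longrightarrow> norm (grad_xy (vertical_primitive T) x) = wind x"
proof -
  assume x: "x \<in> slab"
  have "pd 1 (vp T) x = psi 1 x" "pd 2 (vp T) x = psi 2 x"
    using has_pd_pd[OF has_pd_vp_T x, of 1] has_pd_pd[OF has_pd_vp_T x, of 2] by (simp_all add: grad_psi_def)
  then show ?thesis by (simp add: vertical_primitive_eq_vp grad_xy_def norm_vec_def L2_set_def sum_2 wind_def)
qed

text \<open>Two Lagrange identities: the planar one for the wind, and
  \<open>|J x B|^2 = |J|^2 |B|^2 - (J . B)^2\<close>.\<close>

lemma wind_integrand: "\<bar>psi 2 x * JB 1 x - psi 1 x * JB 2 x\<bar> \<le> (wind x * sqrt (nB x)) * sqrt (\<Sum>i\<in>UNIV. (J i x)\<^sup>2)"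
proof -
  have 1: "(psi 2 x * JB 1 x - psi 1 x * JB 2 x)\<^sup>2 \<le> ((psi 1 x)\<^sup>2 + (psi 2 x)\<^sup>2) * ((JB 1 x)\<^sup>2 + (JB 2 x)\<^sup>2)"
  proof -
    have "((psi 1 x)\<^sup>2 + (psi 2 x)\<^sup>2) * ((JB 1 x)\<^sup>2 + (JB 2 x)\<^sup>2) - (psi 2 x * JB 1 x - psi 1 x * JB 2 x)\<^sup>2
      = (psi 1 x * JB 1 x + psi 2 x * JB 2 x)\<^sup>2" by (simp add: power2_eq_square algebra_simps)
    then show ?thesis by (smt (verit) zero_le_power2)
  qed
  have 2: "(JB 1 x)\<^sup>2 + (JB 2 x)\<^sup>2 \<le> nB x * (\<Sum>i\<in>UNIV. (J i x)\<^sup>2)"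
  proof -
    have "nB x * (\<Sum>i\<in>UNIV. (J i x)\<^sup>2) - ((JB 1 x)\<^sup>2 + (JB 2 x)\<^sup>2) = (JB 3 x)\<^sup>2 + (\<Sum>i\<in>UNIV. J i x * B i x)\<^sup>2"
      by (simp add: nB_def sum_3 JB_def power2_eq_square algebra_simps)
    then show ?thesis by (smt (verit) zero_le_power2)
  qed
  have "(psi 2 x * JB 1 x - psi 1 x * JB 2 x)\<^sup>2 \<le> ((psi 1 x)\<^sup>2 + (psi 2 x)\<^sup>2) * (nB x * (\<Sum>i\<in>UNIV. (J i x)\<^sup>2))"
    by (rule order_trans[OF 1 mult_left_mono[OF 2]]) simp
  then have "sqrt ((psi 2 x * JB 1 x - psi 1 x * JB 2 x)\<^sup>2) \<le> sqrt (((psi 1 x)\<^sup>2 + (psi 2 x)\<^sup>2) * (nB x * (\<Sum>i\<in>UNIV. (J i x)\<^sup>2)))"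
    by (rule real_sqrt_le_mono)
  then show ?thesis by (simp add: wind_def real_sqrt_mult mult.assoc)
qed

text \<open>Cauchy--Schwarz isolates the current, whose L2 norm is \<open>sqrt K2\<close> by
  \<open>vint_J_square\<close>; the second \<open>sqrt K2\<close> comes from the field in the
  product of wind and \<open>|B|\<close>.\<close>

lemma wind_estimate:
  assumes p: "3 \<le> p"
  shows "\<bar>vint (\<lambda>x. psi 2 x * JB 1 x - psi 1 x * JB 2 x)\<bar>
    \<le> A_const Lx Ly p * Lp_norm p (box_V Lx Ly) (grad_xy (vertical_primitive T)) * K2"
proof -
  let ?l = "lambda1 Lx Ly" and ?N = "Lp_norm p (box_V Lx Ly) (grad_xy (vertical_primitive T))"
  have w0: "0 \<le> wind x" for x by (simp add: wind_def)
  have n0: "0 \<le> nB x" for x by (simp add: nB_def sum_nonneg)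
  have l: "0 < ?l" by (rule lambda1_pos)
  have vn: "0 \<le> vint nB" "0 \<le> vint (\<lambda>x. nB x ^ 3)" using n0 by (auto intro!: vint_nonneg fld_intros fld_nB)
  have P: "vint nB \<le> (C_P Lx Ly)\<^sup>2 * K2"
    using poincare_B l by (simp add: C_P_def power_divide field_simps)
  have CP: "0 < C_P Lx Ly" using l by (simp add: C_P_def)
  have key: "vint (\<lambda>x. (wind x)\<^sup>2 * nB x) \<le> (A_const Lx Ly p * ?N)\<^sup>2 * K2 \<and> 0 \<le> A_const Lx Ly p * ?N"
  proof (cases "p = \<infinity>")
    case True
    note Li = Lp_norm_infinity[OF fld_wind w0, of "grad_xy (vertical_primitive T)" nB, OF norm_grad_xy[OF subsetD[OF box_V_slab]] fld_nB n0]
    have "vint (\<lambda>x. (wind x)\<^sup>2 * nB x) \<le> (Lp_norm \<infinity> (box_V Lx Ly) (grad_xy (vertical_primitive T)))\<^sup>2 * vint nB" by (rule Li(2))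
    also have "\<dots> \<le> (Lp_norm \<infinity> (box_V Lx Ly) (grad_xy (vertical_primitive T)))\<^sup>2 * ((C_P Lx Ly)\<^sup>2 * K2)"
      by (rule mult_left_mono[OF P]) simp
    finally show ?thesis using True Li(1) CP by (simp add: A_const_def power_mult_distrib mult_ac)
  next
    case False
    then obtain q where q: "p = ereal q" "3 \<le> q" using p by (cases p) auto
    have N: "?N = vint (\<lambda>x. wind x powr q) powr (1/q)"
      unfolding q(1) by (rule Lp_norm_vint[OF fld_wind w0]) (use q box_V_slab norm_grad_xy in auto)
    have A: "A_const Lx Ly p = C_P Lx Ly powr ((q - 3) / q) * C_S Lx Ly powr (3 / q)"
      by (simp add: A_const_def q Let_def)
    have S: "vint (\<lambda>x. nB x ^ 3) \<le> C_S Lx Ly ^ 6 * K2 ^ 3"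
    proof -
      have "vint (\<lambda>x. nB x ^ 3) = (sqrt (vint (\<lambda>x. nB x ^ 3)))\<^sup>2" using vn by simp
      also have "\<dots> \<le> ((C_S Lx Ly * sqrt K2) ^ 3)\<^sup>2" using vn by (intro power_mono sobolev_B) auto
      also have "\<dots> = C_S Lx Ly ^ 6 * K2 ^ 3"
        using K2_nonneg power_mult[of "sqrt K2" 2 3] by (simp add: power_mult_distrib flip: power_mult)
      finally show ?thesis .
    qed
    have "vint (\<lambda>x. (wind x)\<^sup>2 * nB x) \<le> vint (\<lambda>x. wind x powr q) powr (2/q) * vint nB powr (1 - 3/q) * vint (\<lambda>x. nB x ^ 3) powr (1/q)"
      by (rule hoelder3[OF fld_wind w0 fld_nB n0 q(2)])
    also have "\<dots> = vint (\<lambda>x. wind x powr q) powr (2/q) * (vint nB powr (1 - 3/q) * vint (\<lambda>x. nB x ^ 3) powr (1/q))"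
      by (rule mult.assoc)
    also have "\<dots> \<le> ?N\<^sup>2 * (((C_P Lx Ly)\<^sup>2 * K2) powr (1 - 3/q) * (C_S Lx Ly ^ 6 * K2 ^ 3) powr (1/q))"
    proof (intro mult_mono)
      have "vint (\<lambda>x. wind x powr q) powr (2/q) = ?N\<^sup>2"
      proof -
        have "0 \<le> vint (\<lambda>x. wind x powr q)" by (rule vint_nonneg[OF fld_powr[OF fld_wind w0]]) (use q in auto)
        then show ?thesis unfolding N by (cases "vint (\<lambda>x. wind x powr q) = 0") (simp_all add: powr_powr flip: powr_numeral)
      qed
      then show "vint (\<lambda>x. wind x powr q) powr (2/q) \<le> ?N\<^sup>2" by simp
      show "vint nB powr (1 - 3/q) \<le> ((C_P Lx Ly)\<^sup>2 * K2) powr (1 - 3/q)"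
        using vn P q by (intro powr_mono2) auto
      show "vint (\<lambda>x. nB x ^ 3) powr (1/q) \<le> (C_S Lx Ly ^ 6 * K2 ^ 3) powr (1/q)"
        using vn S q by (intro powr_mono2) auto
    qed auto
    \<comment> \<open>The powers \<open>C_P^(2 (1 - 3/q))\<close> and \<open>C_S^(6/q)\<close> form
      the square of \<open>A_const\<close>, while the exponents of \<open>K2\<close> add up to
      1.\<close>
    also have "((C_P Lx Ly)\<^sup>2 * K2) powr (1 - 3/q) * (C_S Lx Ly ^ 6 * K2 ^ 3) powr (1/q) = (A_const Lx Ly p)\<^sup>2 * K2"
    proof (cases "K2 = 0")
      case True then show ?thesis by simp
    next
      case False
      then have K: "0 < K2" using K2_nonneg by simp
      have sq: "(1 - 3/q) = (q - 3) / q" using q by (simp add: field_simps)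
      have "((C_P Lx Ly)\<^sup>2 * K2) powr (1 - 3/q) = (C_P Lx Ly powr ((q - 3) / q))\<^sup>2 * K2 powr (1 - 3/q)"
      proof -
        have "((C_P Lx Ly)\<^sup>2) powr (1 - 3/q) = (C_P Lx Ly powr ((q - 3) / q))\<^sup>2"
          using CP unfolding sq by (simp add: power2_eq_square powr_mult)
        then show ?thesis using CP K by (simp add: powr_mult)
      qed
      moreover have "(C_S Lx Ly ^ 6 * K2 ^ 3) powr (1/q) = (C_S Lx Ly powr (3 / q))\<^sup>2 * K2 powr (3/q)"
      proof -
        have "(C_S Lx Ly ^ 6) powr (1/q) = (C_S Lx Ly powr (3 / q))\<^sup>2"
        proof -
          have "(C_S Lx Ly ^ 6) powr (1/q) = C_S Lx Ly powr (6/q)"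
            using C_S_pos powr_powr[of "C_S Lx Ly" 6 "1/q"] by simp
          also have "\<dots> = C_S Lx Ly powr (3/q + 3/q)" by simp
          finally show ?thesis by (simp only: powr_add power2_eq_square)
        qed
        moreover have "(K2 ^ 3) powr (1/q) = K2 powr (3/q)"
          using K powr_powr[of K2 3 "1/q"] by simp
        ultimately show ?thesis using C_S_pos K by (simp add: powr_mult)
      qed
      moreover have "K2 powr (1 - 3/q) * K2 powr (3/q) = K2" using K by (simp flip: powr_add)
      ultimately show ?thesis unfolding A by (simp add: power_mult_distrib mult_ac)
    qed
    finally have "vint (\<lambda>x. (wind x)\<^sup>2 * nB x) \<le> (A_const Lx Ly p * ?N)\<^sup>2 * K2"
      by (simp add: power_mult_distrib mult_ac)
    moreover have "0 \<le> A_const Lx Ly p * ?N" unfolding A N by simp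
    ultimately show ?thesis by blast
  qed
  have fJ: "fld (\<lambda>x. sqrt (\<Sum>i\<in>UNIV. (J i x)\<^sup>2))" by (intro fld_intros fld_J)
  have fw: "fld (\<lambda>x. wind x * sqrt (nB x))" by (intro fld_intros fld_wind fld_nB)
  have fl: "fld (\<lambda>x. psi 2 x * JB 1 x - psi 1 x * JB 2 x)" by (intro fld_intros fld_psi fld_JB)
  have "\<bar>vint (\<lambda>x. psi 2 x * JB 1 x - psi 1 x * JB 2 x)\<bar> \<le> vint (\<lambda>x. (wind x * sqrt (nB x)) * sqrt (\<Sum>i\<in>UNIV. (J i x)\<^sup>2))"
  proof -
    have "vint (\<lambda>x. psi 2 x * JB 1 x - psi 1 x * JB 2 x) \<le> vint (\<lambda>x. (wind x * sqrt (nB x)) * sqrt (\<Sum>i\<in>UNIV. (J i x)\<^sup>2))"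
      by (rule vint_mono[OF fl fld_mult[OF fw fJ]]) (rule order_trans[OF abs_ge_self wind_integrand])
    moreover have "vint (\<lambda>x. - (psi 2 x * JB 1 x - psi 1 x * JB 2 x)) \<le> vint (\<lambda>x. (wind x * sqrt (nB x)) * sqrt (\<Sum>i\<in>UNIV. (J i x)\<^sup>2))"
      by (rule vint_mono[OF fld_minus[OF fl] fld_mult[OF fw fJ]]) (rule order_trans[OF abs_ge_minus_self wind_integrand])
    ultimately show ?thesis unfolding vint_minus by linarith
  qed
  also have "\<dots> \<le> sqrt (vint (\<lambda>x. (wind x * sqrt (nB x))\<^sup>2)) * sqrt (vint (\<lambda>x. (sqrt (\<Sum>i\<in>UNIV. (J i x)\<^sup>2))\<^sup>2))"
    by (rule order_trans[OF abs_ge_self vint_abs_mult_le[OF fw fJ]])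
  also have "vint (\<lambda>x. (sqrt (\<Sum>i\<in>UNIV. (J i x)\<^sup>2))\<^sup>2) = K2"
    using vint_J_square by (simp add: sum_nonneg)
  also have "vint (\<lambda>x. (wind x * sqrt (nB x))\<^sup>2) = vint (\<lambda>x. (wind x)\<^sup>2 * nB x)"
    by (simp add: power_mult_distrib n0)
  also have "sqrt (vint (\<lambda>x. (wind x)\<^sup>2 * nB x)) * sqrt K2 \<le> sqrt ((A_const Lx Ly p * ?N)\<^sup>2 * K2) * sqrt K2"
    using key K2_nonneg by (intro mult_right_mono real_sqrt_le_mono) auto
  also have "\<dots> = A_const Lx Ly p * ?N * K2"
    using key K2_nonneg by (simp add: real_sqrt_mult)
  finally show ?thesis .
qed

end

section \<open>Advection of the temperature perturbation\<close>

context heated_fluid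
begin

definition speed :: "real^3 \<Rightarrow> real" where "speed x = sqrt (\<Sum>i\<in>UNIV. (u i x)\<^sup>2)"
definition slope :: "real^3 \<Rightarrow> real" where "slope x = sqrt (\<Sum>i\<in>UNIV. (d\<theta> i x)\<^sup>2)"

lemma fld_speed: "fld speed" unfolding speed_def[abs_def] by (intro fld_intros flds)
lemma fld_slope: "fld slope" unfolding slope_def[abs_def] by (intro fld_intros fld_d\<theta>)

text \<open>\<open>hoelder3\<close> at \<open>p = 3\<close> bounds the L2 norm of the advection by
  the L3 norm of the velocity times the L6 norm of the gradient, and the hypothesis returns the
  latter to \<open>sqrt M2\<close>. The term is thus quadratic in \<open>M\<close> and is absorbed
  by dissipation if \<open>u\<close> is small in L3.\<close>

lemma advection_le:
  assumes C: "vint (\<lambda>x. slope x powr 6) powr (1/6) \<le> C * sqrt M2"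
  shows "\<bar>vint (\<lambda>x. lap\<theta> x * (\<Sum>k\<in>UNIV. u k x * d\<theta> k x))\<bar> \<le> vint (\<lambda>x. speed x powr 3) powr (1/3) * C * M2"
proof -
  have s0: "0 \<le> speed x" "0 \<le> slope x" for x by (simp_all add: speed_def slope_def sum_nonneg)
  have fs: "fld (\<lambda>x. (slope x)\<^sup>2)" by (intro fld_intros fld_slope)
  have fd: "fld (\<lambda>x. \<Sum>k\<in>UNIV. u k x * d\<theta> k x)" by (intro fld_intros fld_d\<theta> flds)
  let ?U = "vint (\<lambda>x. speed x powr 3)" and ?G = "vint (\<lambda>x. slope x powr 6)"
  have pt: "(\<Sum>k\<in>UNIV. u k x * d\<theta> k x)\<^sup>2 \<le> (speed x)\<^sup>2 * (slope x)\<^sup>2" for x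
    unfolding speed_def slope_def using Cauchy_Schwarz_ineq_sum[of "\<lambda>k. u k x" "\<lambda>k. d\<theta> k x" UNIV] by (simp add: sum_nonneg)
  have "vint (\<lambda>x. (\<Sum>k\<in>UNIV. u k x * d\<theta> k x)\<^sup>2) \<le> vint (\<lambda>x. (speed x)\<^sup>2 * (slope x)\<^sup>2)"
    by (rule vint_mono) (auto intro!: fld_intros fld_speed fld_slope fld_d\<theta> flds pt)
  also have "\<dots> \<le> ?U powr (2/3) * vint (\<lambda>x. (slope x)\<^sup>2) powr (1 - 3/3) * vint (\<lambda>x. ((slope x)\<^sup>2) ^ 3) powr (1/3)"
    by (rule hoelder3) (auto intro: fld_speed fs s0)
  also have "\<dots> \<le> ?U powr (2/3) * 1 * ?G powr (1/3)"
  proof (intro mult_mono)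
    have "((slope x)\<^sup>2) ^ 3 = slope x powr 6" for x
      using s0(2)[of x] by (cases "slope x = 0") (simp_all flip: power_mult)
    then show "vint (\<lambda>x. ((slope x)\<^sup>2) ^ 3) powr (1/3) \<le> ?G powr (1/3)" by simp
    \<comment> \<open>The exponent is 0, but the base may be 0 as well, and \<open>0 powr 0\<close>
      is 0: only an inequality holds.\<close>
    show "vint (\<lambda>x. (slope x)\<^sup>2) powr (1 - 3/3) \<le> 1" by (simp add: powr_def)
  qed auto
  also have "\<dots> = (?U powr (1/3) * ?G powr (1/6))\<^sup>2"
    using powr_add[of ?U "1/3" "1/3"] powr_add[of ?G "1/6" "1/6"] by (simp add: power2_eq_square mult_ac)
  finally have le: "vint (\<lambda>x. (\<Sum>k\<in>UNIV. u k x * d\<theta> k x)\<^sup>2) \<le> (?U powr (1/3) * ?G powr (1/6))\<^sup>2" .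
  have "\<bar>vint (\<lambda>x. lap\<theta> x * (\<Sum>k\<in>UNIV. u k x * d\<theta> k x))\<bar> \<le> sqrt M2 * sqrt (vint (\<lambda>x. (\<Sum>k\<in>UNIV. u k x * d\<theta> k x)\<^sup>2))"
    unfolding M2_def by (rule vint_abs_mult_le[OF fld_lap\<theta> fd])
  also have "\<dots> \<le> sqrt M2 * (?U powr (1/3) * ?G powr (1/6))"
    using real_sqrt_le_mono[OF le] M2_nonneg by (intro mult_left_mono) auto
  also have "\<dots> \<le> sqrt M2 * (?U powr (1/3) * (C * sqrt M2))"
    using M2_nonneg C by (intro mult_left_mono) auto
  also have "\<dots> = ?U powr (1/3) * C * M2" using M2_nonneg by (simp add: mult_ac)
  finally show ?thesis .
qed

end

section \<open>Classical derivatives are weak derivatives\<close>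

lemma integral_lebesgue_on_eq_box:
  fixes g :: "real^3 \<Rightarrow> real"
  assumes K: "K \<subseteq> S" "K \<subseteq> cbox l r" and S: "S \<in> sets lebesgue"
    and z: "\<And>x. x \<notin> K \<Longrightarrow> g x = 0" and c: "continuous_on (cbox l r) g"
  shows "(LINT x|lebesgue_on S. g x) = integral (cbox l r) g"
proof -
  have "(LINT x|lebesgue_on S. g x) = (LINT x|lebesgue. indicator S x *\<^sub>R g x)"
    by (rule integral_restrict_space) (use S in auto)
  also have "(\<lambda>x. indicator S x *\<^sub>R g x) = (\<lambda>x. indicator (cbox l r) x *\<^sub>R g x)"
  proof
    fix x show "indicator S x *\<^sub>R g x = indicator (cbox l r) x *\<^sub>R g x"
      using K z[of x] by (cases "x \<in> K") (auto simp: indicator_def)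
  qed
  also have "(LINT x|lebesgue. indicator (cbox l r) x *\<^sub>R g x) = (LINT x|lebesgue_on (cbox l r). g x)"
    by (rule integral_restrict_space[symmetric]) auto
  also have "\<dots> = integral (cbox l r) g"
    by (rule lebesgue_integral_eq_integral[OF continuous_imp_integrable[OF c]]) auto
  finally show ?thesis .
qed

text \<open>Brings the classical perturbation into the space on which the Sobolev--elliptic constant
  is defined. Test functions are compactly supported but not periodic, so the fundamental theorem is
  applied on a box around the support instead of on the cell.\<close>

lemma weak_partial_classical:
  assumes h: "has_pd k f f'" and f: "continuous_on slab f" "continuous_on slab f'"
  shows "weak_partial k f f'"
  unfolding weak_partial_def
proof (intro allI impI, elim conjE exE)
  fix \<phi> :: "real^3 \<Rightarrow> real" and K :: "(real^3) set"
  assume \<phi>: "smooth_on UNIV \<phi>" and K: "compact K" "K \<subseteq> open_slab" and z: "\<forall>x. x \<notin> K \<longrightarrow> \<phi> x = 0"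
  let ?d = "partial UNIV (axis k 1) \<phi>"
  have c\<phi>: "continuous_on S \<phi>" "continuous_on S ?d" for S
    using smooth_on_continuous[OF \<phi>] smooth_on_continuous[OF smooth_on_partial[OF \<phi> axis_Basis]]
    by (auto intro: continuous_on_subset)
  have dz: "?d x = 0" if x: "x \<notin> K" for x
  proof -
    have "((\<lambda>s. \<phi> (x + s *\<^sub>R axis k 1)) has_vector_derivative ?d x) (at 0)"
      using smooth_on_has_partial[OF \<phi> axis_Basis, of x k] by simp
    moreover have "((\<lambda>s. \<phi> (x + s *\<^sub>R axis k 1)) has_vector_derivative 0) (at 0)"
    proof (rule has_vector_derivative_transform_within_open[of "\<lambda>s. 0" _ _ "(\<lambda>s. x + s *\<^sub>R axis k 1) -` (- K)"])
      show "open ((\<lambda>s. x + s *\<^sub>R axis k 1) -` (- K))"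
        by (intro open_vimage continuous_intros open_Compl compact_imp_closed K)
    qed (use x z in auto)
    ultimately show ?thesis by (rule vector_derivative_unique_at)
  qed
  have h\<phi>: "has_pd k \<phi> ?d"
    unfolding has_pd_def
  proof
    fix x :: "real^3"
    have "((\<lambda>s. \<phi> (x + s *\<^sub>R axis k 1)) has_real_derivative ?d x) (at 0)"
      using smooth_on_has_partial[OF \<phi> axis_Basis, of x k] by (simp add: has_real_derivative_iff_has_vector_derivative)
    then show "((\<lambda>s. \<phi> (x + s *\<^sub>R axis k 1)) has_real_derivative ?d x) (at 0 within {s. x + s *\<^sub>R axis k 1 \<in> slab})"
      by (rule has_field_derivative_at_within)
  qed
  obtain R where R: "\<And>x. x \<in> K \<Longrightarrow> norm x < R" and R0: "0 < R"
    using compact_imp_bounded[OF K(1)] unfolding bounded_pos_less by blast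
  \<comment> \<open>The support lies strictly inside in every direction: horizontally since
    \<open>R\<close> exceeds all its norms, vertically since it is contained in the open slab. Hence
    all end values vanish.\<close>
  define l r :: "real^3" where "l = (\<chi> i. if i = 3 then 0 else - R)" and "r = (\<chi> i. if i = 3 then 1 else R)"
  have lr: "l $ i < r $ i" for i using R0 by (simp add: l_def r_def)
  have box_slab: "cbox l r \<subseteq> slab"
  proof
    fix x assume "x \<in> cbox l r"
    then have "l $ 3 \<le> x $ 3 \<and> x $ 3 \<le> r $ 3" unfolding mem_box_cart by blast
    then show "x \<in> slab" by (simp add: slab_def l_def r_def)
  qed
  have K_int: "l $ i < x $ i \<and> x $ i < r $ i" if x: "x \<in> K" for x i
  proof (cases "i = 3")
    case True
    then show ?thesis using K(2) x by (auto simp: open_slab_def l_def r_def)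
  next
    case False
    have "\<bar>x $ i\<bar> < R" using R[OF x] component_le_norm_cart[of x i] by simp
    then show ?thesis using False by (auto simp: l_def r_def)
  qed
  have K_box: "K \<subseteq> cbox l r"
  proof
    fix x assume "x \<in> K"
    then show "x \<in> cbox l r" using K_int unfolding mem_box_cart by (meson less_imp_le)
  qed
  let ?h = "\<lambda>x. f x * \<phi> x" and ?h' = "\<lambda>x. f' x * \<phi> x + f x * ?d x"
  have cf: "continuous_on (cbox l r) f" "continuous_on (cbox l r) f'"
    using f box_slab continuous_on_subset by blast+
  have ch': "continuous_on (cbox l r) ?h'" by (intro continuous_intros cf c\<phi>)
  obtain i j where d: "distinct [i, j, k]" using distinct_complement by blast
  have inner: "integral {l$k..r$k} (\<lambda>c. ?h' (coord3 i j a b c)) = 0"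
    if ab: "a \<in> {l$i..r$i}" "b \<in> {l$j..r$j}" for a b
  proof -
    have mem: "coord3 i j a b c \<in> slab" if "c \<in> {l$k..r$k}" for c
      using coord3_in_cbox[OF d, of a b c l r] ab that box_slab by auto
    have end0: "\<phi> (coord3 i j a b c) = 0" if "c = l$k \<or> c = r$k" for c
    proof -
      have "coord3 i j a b c $ k = c" using d by (auto simp: coord3_def)
      then have "coord3 i j a b c \<notin> K" using K_int[of "coord3 i j a b c" k] that by auto
      then show ?thesis using z by simp
    qed
    have "integral {l$k..r$k} (\<lambda>c. ?h' (coord3 i j a b c)) = ?h (coord3 i j a b (r$k)) - ?h (coord3 i j a b (l$k))"
      by (rule integral_FTC_real) (use lr[of k] in \<open>auto intro!: has_pd_coord3[OF has_pd_mult[OF h h\<phi>] d] mem\<close>)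
    then show ?thesis using end0 by simp
  qed
  have "integral (cbox l r) ?h' = integral {l$i..r$i} (\<lambda>a. 0)"
    unfolding integral_box_pair(2)[OF d ch']
  proof (rule integral_cong)
    fix a assume a: "a \<in> {l$i..r$i}"
    have "integral {l$j..r$j} (\<lambda>b. integral {l$k..r$k} (\<lambda>c. ?h' (coord3 i j a b c))) = integral {l$j..r$j} (\<lambda>b. 0)"
      by (rule integral_cong) (rule inner[OF a])
    then show "integral {l$j..r$j} (\<lambda>b. integral {l$k..r$k} (\<lambda>c. ?h' (coord3 i j a b c))) = 0" by simp
  qed
  then have "integral (cbox l r) ?h' = 0" by simp
  moreover have "integral (cbox l r) ?h' = integral (cbox l r) (\<lambda>x. f' x * \<phi> x) + integral (cbox l r) (\<lambda>x. f x * ?d x)"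
    by (intro integral_add integrable_continuous continuous_intros cf c\<phi>)
  moreover have "open_slab \<in> sets lebesgue"
  proof -
    have "open open_slab"
      unfolding open_slab_def by (intro open_Collect_conj open_Collect_less continuous_intros)
    then show ?thesis by (simp add: borel_open)
  qed
  ultimately show "(LINT x|lebesgue_on open_slab. f x * ?d x) = - (LINT x|lebesgue_on open_slab. f' x * \<phi> x)"
    using integral_lebesgue_on_eq_box[OF K(2) K_box, of "\<lambda>x. f x * ?d x"] integral_lebesgue_on_eq_box[OF K(2) K_box, of "\<lambda>x. f' x * \<phi> x"]
      dz z by (simp add: continuous_on_mult cf c\<phi>)
qed

context cell
begin

lemma in_Lp_2:
  fixes f :: "real^3 \<Rightarrow> 'b::euclidean_space"
  assumes "continuous_on slab f"
  shows "in_Lp 2 (box_V Lx Ly) f"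
proof -
  have c: "continuous_on (cbox 0 per) f"
    using assms box_V_slab continuous_on_subset unfolding box_V_def by blast
  have "continuous_on (cbox 0 per) (\<lambda>x. norm (f x) powr 2)"
    by (rule continuous_on_powr'[OF continuous_on_norm[OF c] continuous_on_const]) auto
  then show ?thesis
    unfolding in_Lp_def box_V_def
    by (intro conjI continuous_imp_measurable_on_sets_lebesgue[OF c] continuous_imp_integrable) auto
qed

end

context heated_fluid
begin

text \<open>In the Hessian the second index is the direction differentiated last, whereas
  \<open>dd\<theta>\<close> has it first; hence the swapped arguments.\<close>

lemma H2_\<theta>: "H2_periodic_zero Lx Ly \<theta> (\<lambda>x. \<chi> i. d\<theta> i x) (\<lambda>x. \<chi> i j. dd\<theta> j i x)"
proof -
  have c: "continuous_on slab \<theta>" "continuous_on slab (d\<theta> i)" "continuous_on slab (dd\<theta> j i)"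
    and p: "periodic_xy Lx Ly \<theta>" "periodic_xy Lx Ly (d\<theta> i)" "periodic_xy Lx Ly (dd\<theta> j i)" for i j
    using fld_\<theta> fld_d\<theta> fld_dd\<theta> by (auto simp: fld_def)
  have cg: "continuous_on slab (\<lambda>x. \<chi> i. d\<theta> i x)" and cH: "continuous_on slab (\<lambda>x. \<chi> i j. dd\<theta> j i x)"
    by (intro continuous_on_vec_lambda c)+
  show ?thesis
    unfolding H2_periodic_zero_def
  proof (intro conjI allI)
    show "\<forall>x\<in>S_minus \<union> S_plus. \<theta> x = 0" using \<theta>_wall by blast
    show "weak_partial i \<theta> (\<lambda>x. (\<chi> i. d\<theta> i x) $ i)" for i
      using weak_partial_classical[OF has_pd_\<theta> c(1,2)] by simp
    show "weak_partial j (\<lambda>x. (\<chi> i. d\<theta> i x) $ i) (\<lambda>x. (\<chi> i j. dd\<theta> j i x) $ i $ j)" for i j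
      using weak_partial_classical[OF has_pd_d\<theta> c(2,3)] by simp
    show "periodic_xy Lx Ly (\<lambda>x. \<chi> i. d\<theta> i x)" "periodic_xy Lx Ly (\<lambda>x. \<chi> i j. dd\<theta> j i x)"
      using p by (auto simp: periodic_xy_def vec_eq_iff)
  qed (auto intro!: in_Lp_2 c p cg cH)
qed

lemma sobolev_elliptic_\<theta>:
  assumes "sobolev_elliptic_constant Lx Ly C"
  shows "vint (\<lambda>x. slope x powr 6) powr (1/6) \<le> C * sqrt M2"
proof -
  have s0: "0 \<le> slope x" for x by (simp add: slope_def sum_nonneg)
  have l2: "\<bar>lap\<theta> x\<bar> powr 2 = (lap\<theta> x)\<^sup>2" for x by (cases "lap\<theta> x = 0") simp_all
  have "Lp_norm (ereal 6) (box_V Lx Ly) (\<lambda>x. \<chi> i. d\<theta> i x) = vint (\<lambda>x. slope x powr 6) powr (1/6)"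
    by (rule Lp_norm_vint[OF fld_slope]) (auto simp: slope_def norm_vec_def L2_set_def sum_nonneg)
  moreover have "Lp_norm (ereal 2) (box_V Lx Ly) (\<lambda>x. \<Sum>i\<in>UNIV. (\<chi> i j. dd\<theta> j i x) $ i $ i) = vint (\<lambda>x. \<bar>lap\<theta> x\<bar> powr 2) powr (1/2)"
    by (rule Lp_norm_vint[OF fld_abs[OF fld_lap\<theta>]]) (auto simp: lap\<theta>_def)
  moreover have "vint (\<lambda>x. \<bar>lap\<theta> x\<bar> powr 2) powr (1/2) = sqrt M2"
    unfolding l2 M2_def[symmetric] using M2_nonneg by (simp add: powr_half_sqrt)
  moreover have "Lp_norm 6 (box_V Lx Ly) (\<lambda>x. \<chi> i. d\<theta> i x) \<le> C * Lp_norm 2 (box_V Lx Ly) (\<lambda>x. \<Sum>i\<in>UNIV. (\<chi> i j. dd\<theta> j i x) $ i $ i)"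
    using assms H2_\<theta> unfolding sobolev_elliptic_constant_def by blast
  ultimately show ?thesis by simp
qed

section \<open>The energy inequality\<close>

text \<open>Since \<open>lambda1 <= pi\<close>, the constant is at least 1/pi + 2/pi = 3/pi > 3/4.
  The root of 1/2 is the factor that \<open>psi2_le\<close> yields in the viscous coupling.\<close>

lemma C_P2_lower: "sqrt (1/2) \<le> C_P2 Lx Ly"
proof -
  have "1 / pi \<le> C_P Lx Ly"
    unfolding C_P_def using lambda1_pos lambda1_le(1) by (intro divide_left_mono) auto
  moreover have "3/4 \<le> 3 / pi" using pi_less_4 pi_gt_zero by (simp add: field_simps)
  moreover have "sqrt (1/2) \<le> sqrt ((3/4)\<^sup>2)" by (rule real_sqrt_le_mono) (simp add: power2_eq_square)
  ultimately show ?thesis by (simp add: C_P2_def b_2_def)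
qed

text \<open>Here \<open>b\<close> stands for the time derivative of \<open>B\<close>. The work of
  the Lorentz force on the flow occurs in \<open>mag\<close> and in the momentum balance
  \<open>M\<close>; eliminating it leaves four integrals, each bounded by its own estimate.\<close>

lemma energy_inequality:
  assumes pos: "0 < Ek" "0 < \<Lambda>" "0 < Ra" "0 < Rm"
    and mom: "\<And>x. x \<in> slab \<Longrightarrow> - u 2 x + pd 1 P x - Ek * Lap (u 1) x = \<Lambda> * JB 1 x"
    "\<And>x. x \<in> slab \<Longrightarrow> u 1 x + pd 2 P x - Ek * Lap (u 2) x = \<Lambda> * JB 2 x"
    "\<And>x. x \<in> slab \<Longrightarrow> pd 3 P x - Ek * Lap (u 3) x = \<Lambda> * JB 3 x + Ra * T x"
    and ind: "\<And>x. x \<in> slab \<Longrightarrow> b 1 x = dF 2 3 x - dF 3 2 x + 1 / Rm * Lap (B 1) x"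
    "\<And>x. x \<in> slab \<Longrightarrow> b 2 x = dF 3 1 x - dF 1 3 x + 1 / Rm * Lap (B 2) x"
    "\<And>x. x \<in> slab \<Longrightarrow> b 3 x = dF 1 2 x - dF 2 1 x + 1 / Rm * Lap (B 3) x"
    and heat: "\<And>x. x \<in> slab \<Longrightarrow> Pe * \<theta>t x = lap\<theta> x - Pe * (\<Sum>k\<in>UNIV. u k x * d\<theta> k x) - Pe * (u 3 x * \<tau>1 (x $ 3))"
    and p: "3 \<le> p" and C: "sobolev_elliptic_constant Lx Ly C"
  shows "\<Lambda> * vint (\<lambda>x. \<Sum>i\<in>UNIV. B i x * b i x) + Pe * vint (\<lambda>x. \<Sum>k\<in>UNIV. d\<theta> k x * pd k \<theta>t x)
    \<le> - Ek * N2 - (1 - Pe * C * vint (\<lambda>x. speed x powr 3) powr (1/3)) * M2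
      + (Ek * Ra * C_P2 Lx Ly + Pe * sqrt (integral {0..1} (\<lambda>z. (\<tau>1 z)\<^sup>2))) * (sqrt N2 * sqrt M2)
      - \<Lambda> * (1 / Rm - Ra * A_const Lx Ly p * Lp_norm p (box_V Lx Ly) (grad_xy (vertical_primitive T))) * K2"
proof -
  let ?W = "vint (\<lambda>x. \<Sum>j\<in>UNIV. pd j (u 1) x * psi2 j 2 x - pd j (u 2) x * psi2 j 1 x)"
  let ?Y = "vint (\<lambda>x. psi 2 x * JB 1 x - psi 1 x * JB 2 x)"
  let ?X = "vint (\<lambda>x. lap\<theta> x * (\<Sum>k\<in>UNIV. u k x * d\<theta> k x))"
  let ?Z = "vint (\<lambda>x. lap\<theta> x * (u 3 x * \<tau>1 (x $ 3)))"
  let ?A = "A_const Lx Ly p * Lp_norm p (box_V Lx Ly) (grad_xy (vertical_primitive T))"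
  note fi = fld_intros fld_dF fld_Lap[OF B] fld_JB flds
  have mag: "vint (\<lambda>x. \<Sum>i\<in>UNIV. B i x * b i x) = - vint (\<lambda>x. \<Sum>i\<in>UNIV. u i x * JB i x) - 1 / Rm * K2"
  proof -
    have "vint (\<lambda>x. \<Sum>i\<in>UNIV. B i x * b i x) = vint (\<lambda>x. (B 1 x * (dF 2 3 x - dF 3 2 x) + B 2 x * (dF 3 1 x - dF 1 3 x) + B 3 x * (dF 1 2 x - dF 2 1 x))
       + 1 / Rm * (\<Sum>i\<in>UNIV. Lap (B i) x * B i x))"
      by (rule vint_cong) (simp add: sum_3 ind algebra_simps)
    also have "\<dots> = vint (\<lambda>x. B 1 x * (dF 2 3 x - dF 3 2 x) + B 2 x * (dF 3 1 x - dF 1 3 x) + B 3 x * (dF 1 2 x - dF 2 1 x))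
       + vint (\<lambda>x. 1 / Rm * (\<Sum>i\<in>UNIV. Lap (B i) x * B i x))"
      by (rule vint_add) (intro fi)+
    also have "vint (\<lambda>x. 1 / Rm * (\<Sum>i\<in>UNIV. Lap (B i) x * B i x)) = 1 / Rm * vint (\<lambda>x. \<Sum>i\<in>UNIV. Lap (B i) x * B i x)"
      by (rule vint_cmult)
    finally show ?thesis unfolding vint_B_curl_F vint_B_Lap by simp
  qed
  have M: "\<Lambda> * vint (\<lambda>x. \<Sum>i\<in>UNIV. u i x * JB i x) = Ek * N2 - \<Lambda> * Ra * ?Y + Ek * Ra * ?W"
    by (rule momentum_test[OF mom])
  have Y: "\<bar>?Y\<bar> \<le> ?A * K2" by (rule wind_estimate[OF p])
  have W: "\<bar>?W\<bar> \<le> C_P2 Lx Ly * (sqrt N2 * sqrt M2)"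
  proof -
    have "\<bar>?W\<bar> \<le> sqrt N2 * sqrt (\<Sum>j\<in>UNIV. vint (\<lambda>x. (psi2 j 1 x)\<^sup>2) + vint (\<lambda>x. (psi2 j 2 x)\<^sup>2))"
      by (rule thermal_wind_le)
    also have "\<dots> \<le> sqrt N2 * sqrt (1/2 * M2)"
      using psi2_le N2_nonneg by (intro mult_left_mono real_sqrt_le_mono) auto
    also have "\<dots> = sqrt (1/2) * (sqrt N2 * sqrt M2)" by (simp only: real_sqrt_mult mult_ac)
    also have "\<dots> \<le> C_P2 Lx Ly * (sqrt N2 * sqrt M2)"
      using C_P2_lower N2_nonneg M2_nonneg by (intro mult_right_mono) auto
    finally show ?thesis .
  qed
  have X: "\<bar>?X\<bar> \<le> vint (\<lambda>x. speed x powr 3) powr (1/3) * C * M2"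
    by (rule advection_le[OF sobolev_elliptic_\<theta>[OF C]])
  have Z: "\<bar>?Z\<bar> \<le> sqrt M2 * (sqrt (integral {0..1} (\<lambda>z. (\<tau>1 z)\<^sup>2)) * sqrt N2)" by (rule forcing_le)
  have "\<Lambda> * Ra * ?Y \<le> \<Lambda> * Ra * (?A * K2)" using Y pos by (intro mult_left_mono) auto
  moreover have "Ek * Ra * (- ?W) \<le> Ek * Ra * (C_P2 Lx Ly * (sqrt N2 * sqrt M2))"
    using W pos by (intro mult_left_mono) auto
  moreover have "Pe * ?X \<le> Pe * (vint (\<lambda>x. speed x powr 3) powr (1/3) * C * M2)"
    using X Pe by (intro mult_left_mono) auto
  moreover have "Pe * ?Z \<le> Pe * (sqrt M2 * (sqrt (integral {0..1} (\<lambda>z. (\<tau>1 z)\<^sup>2)) * sqrt N2))"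
    using Z Pe by (intro mult_left_mono) auto
  moreover have "Pe * vint (\<lambda>x. \<Sum>k\<in>UNIV. d\<theta> k x * pd k \<theta>t x) = - M2 + Pe * ?X + Pe * ?Z"
    by (rule temperature_energy[OF heat])
  moreover have "\<Lambda> * vint (\<lambda>x. \<Sum>i\<in>UNIV. B i x * b i x) = - (Ek * N2 - \<Lambda> * Ra * ?Y + Ek * Ra * ?W) - \<Lambda> * (1 / Rm * K2)"
    unfolding mag M[symmetric] by (simp add: algebra_simps)
  ultimately show ?thesis by (simp add: algebra_simps)
qed

text \<open>With \<open>a\<close> the size of the advection term and \<open>s\<close> the norm of
  the slope of \<open>\<tau>\<close>, rescaling the norms to \<open>n = sqrt Ek * N\<close> and
  \<open>m = \<alpha> * M\<close> makes the diagonal of the form \<open>- n^2 - m^2\<close>. The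
  cross coefficient becomes \<open>\<beta> / \<alpha>\<close>, and
  \<open>\<beta> < 2 * \<alpha>\<close> is precisely the failure of the second alternative.\<close>

lemma dichotomy:
  assumes pos: "0 < Ek" "0 < \<Lambda>" "0 < Ra"
    and a: "a < 1" and s: "0 \<le> s" and D: "0 \<le> D"
    and le: "D \<le> - Ek * N2 - (1 - a) * M2 + (Ek * Ra * C_P2 Lx Ly + Pe * s) * (sqrt N2 * sqrt M2) - \<Lambda> * (1 / Rm - R) * K2"
    and nontriv: "\<exists>x\<in>box_V Lx Ly. (\<exists>i. B i x \<noteq> 0) \<or> \<theta> x \<noteq> 0"
  shows "R \<ge> 1 / Rm \<or> C_P2 Lx Ly * Ra * sqrt Ek / 2 + Pe * s / (2 * sqrt Ek) \<ge> sqrt (1 - a)"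
proof (rule ccontr)
  assume neg: "\<not> ?thesis"
  define \<alpha> where "\<alpha> = sqrt (1 - a)"
  define \<beta> where "\<beta> = C_P2 Lx Ly * Ra * sqrt Ek + Pe * s / sqrt Ek"
  define n where "n = sqrt Ek * sqrt N2"
  define m where "m = \<alpha> * sqrt M2"
  have \<alpha>: "0 < \<alpha>" "\<alpha>\<^sup>2 = 1 - a" using a by (simp_all add: \<alpha>_def)
  have \<beta>: "\<beta> < 2 * \<alpha>" using neg by (simp add: \<alpha>_def \<beta>_def add_divide_distrib)
  have CP: "0 \<le> C_P2 Lx Ly" by (rule order_trans[OF _ C_P2_lower]) simp
  have \<beta>0: "0 \<le> \<beta>" unfolding \<beta>_def using CP pos Pe s by simp
  have \<kappa>: "0 < 1 / Rm - R" using neg by simp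
  have n2: "n\<^sup>2 = Ek * N2" unfolding n_def using pos N2_nonneg by (simp add: power_mult_distrib)
  have m2: "m\<^sup>2 = (1 - a) * M2" unfolding m_def using \<alpha> M2_nonneg by (simp add: power_mult_distrib)
  have cross: "(Ek * Ra * C_P2 Lx Ly + Pe * s) * (sqrt N2 * sqrt M2) = \<beta> / \<alpha> * (n * m)"
  proof -
    have "Ek * Ra * C_P2 Lx Ly + Pe * s = \<beta> * sqrt Ek"
      unfolding \<beta>_def using pos by (simp add: algebra_simps)
    then show ?thesis unfolding n_def m_def using \<alpha>(1) by simp
  qed
  have "\<beta> / \<alpha> * (n * m) \<le> \<beta> / \<alpha> * ((n\<^sup>2 + m\<^sup>2) / 2)"
  proof (rule mult_left_mono)
    have "0 \<le> (n - m)\<^sup>2" by simp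
    then show "n * m \<le> (n\<^sup>2 + m\<^sup>2) / 2" by (simp add: power2_eq_square algebra_simps)
  qed (use \<alpha> \<beta>0 in simp)
  moreover have "0 \<le> - n\<^sup>2 - m\<^sup>2 + \<beta> / \<alpha> * (n * m) - \<Lambda> * (1 / Rm - R) * K2"
    using order_trans[OF D le] unfolding cross n2 m2 by simp
  moreover have "(1 - \<beta> / (2 * \<alpha>)) * (n\<^sup>2 + m\<^sup>2) = n\<^sup>2 + m\<^sup>2 - \<beta> / \<alpha> * ((n\<^sup>2 + m\<^sup>2) / 2)"
    by (simp add: left_diff_distrib)
  ultimately have "(1 - \<beta> / (2 * \<alpha>)) * (n\<^sup>2 + m\<^sup>2) + \<Lambda> * (1 / Rm - R) * K2 \<le> 0"
    by linarith
  moreover have c: "0 < 1 - \<beta> / (2 * \<alpha>)" using \<alpha> \<beta> by (simp add: field_simps)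
  moreover have "0 \<le> \<Lambda> * (1 / Rm - R) * K2" using pos \<kappa> K2_nonneg by simp
  moreover have "0 \<le> (1 - \<beta> / (2 * \<alpha>)) * (n\<^sup>2 + m\<^sup>2)" using c by simp
  ultimately have "(1 - \<beta> / (2 * \<alpha>)) * (n\<^sup>2 + m\<^sup>2) = 0" "\<Lambda> * (1 / Rm - R) * K2 = 0" by linarith+
  \<comment> \<open>Two nonnegative terms with positive coefficients add up to something
    nonpositive, so the Laplacian of the perturbation and the magnetic gradient vanish, which
    nontriviality forbids.\<close>
  then have "m\<^sup>2 = 0" "K2 = 0" using c \<kappa> pos by (auto simp: sum_power2_eq_zero_iff)
  then have "M2 = 0" "K2 = 0" using m2 a by auto
  then show False using nontriv K2_zero lap\<theta>_zero by blast
qed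

end

section \<open>From the vector equations to components\<close>

lemma integral_cbox2:
  fixes f :: "real^2 \<Rightarrow> real"
  assumes c: "continuous_on (cbox 0 (vector [a, b])) f"
  shows "integral (cbox 0 (vector [a, b])) f = integral (cbox (0, 0) (a, b)) (\<lambda>p. f (vector [fst p, snd p]))"
  (is "_ = integral _ (\<lambda>p. f (?g p))")
proof -
  have "integral (cbox 0 (vector [a, b])) f = integral (cbox ((0 :: real^2) $ 1, (0 :: real^2) $ 2) ((vector [a, b] :: real^2) $ 1, (vector [a, b] :: real^2) $ 2)) (\<lambda>p. f (?g p))"
  proof (rule integral_reindex[where h = "\<lambda>x. (x$1, x$2)", OF _ _ _ _ _ c])
    have g: "?g = (\<lambda>p. \<chi> m. if m = 1 then fst p else snd p)" by (simp add: fun_eq_iff vec_eq_iff forall_2)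
    show "continuous_on UNIV ?g"
      unfolding g
    proof (rule continuous_on_vec_lambda)
      show "continuous_on UNIV (\<lambda>p. if m = 1 then fst p else snd p :: real)" for m :: 2
        by (cases "m = 1") (auto intro!: continuous_intros)
    qed
    show "?g (x $ 1, x $ 2) = x" for x by (simp add: vec_eq_iff forall_2)
    show "(x $ 1, x $ 2) \<in> cbox (u $ 1, u $ 2) (v $ 1, v $ 2) \<longleftrightarrow> x \<in> cbox u v" for x u v :: "real^2"
      by (auto simp: cbox_Pair_eq mem_box_cart forall_2)
  next
    fix u v :: "real \<times> real"
    assume ne: "cbox u v \<noteq> {}" "cbox (?g u) (?g v) \<noteq> {}"
    then have le: "fst u \<le> fst v" "snd u \<le> snd v" by (cases u, cases v, auto simp: cbox_Pair_eq)+
    show "measure lborel (cbox (?g u) (?g v)) = measure lborel (cbox u v)"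
      using le by (subst content_cbox_cart[OF ne(2)]) (cases u, cases v, simp add: UNIV_2 content_Pair)
  qed simp
  then show ?thesis by simp
qed

text \<open>Assembles a vector derivative from those of its components. It serves the products
  \<open>T u\<close> and \<open>u x B\<close>, whose components are differentiated by the product
  rule.\<close>

lemma pd_vec:
  assumes "\<And>i. has_pd j (\<lambda>x. f x $ i) (g i)" and x: "x \<in> slab"
  shows "pd j f x $ i = g i x"
proof -
  have "((\<lambda>s. f (x + s *\<^sub>R axis j 1)) has_vector_derivative (\<chi> i. g i x)) (at 0 within {s. x + s *\<^sub>R axis j 1 \<in> slab})"
    unfolding has_vector_derivative_def
    by (subst has_derivative_componentwise_within)
       (use has_pdD[OF assms(1) x] in \<open>auto simp: Basis_vec_def inner_axis has_field_derivative_def mult.commute[of _ "g _ x"]\<close>)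
  then have "pd j f x = (\<chi> i. g i x)"
    unfolding pd_def partial_def by (rule vector_derivative_within[OF slab_line_nontrivial[OF x]])
  then show ?thesis by simp
qed

lemma laplacian_component:
  fixes f :: "real^3 \<Rightarrow> real^3"
  assumes f: "smooth_on slab f" and x: "x \<in> slab"
  shows "laplacian f x $ i = (\<Sum>k\<in>UNIV. pd k (pd k (\<lambda>x. f x $ i)) x)"
proof -
  have "pd k (pd k f) x $ i = pd k (pd k (\<lambda>x. f x $ i)) x" for k
    unfolding pd_component[OF smooth_on_pd[OF f] x]
    by (rule pd_cong[OF _ x]) (rule pd_component[OF f])
  then show ?thesis by (simp add: laplacian_def)
qed

lemma cross3_components:
  "cross3 a b $ 1 = a $ 2 * b $ 3 - a $ 3 * b $ 2"
  "cross3 a b $ 2 = a $ 3 * b $ 1 - a $ 1 * b $ 3"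
  "cross3 a b $ 3 = a $ 1 * b $ 2 - a $ 2 * b $ 1"
  by (simp_all add: cross3_def)

section \<open>Instants of a solution and the rate of change of its energy\<close>

locale mhd_solution = cell Lx Ly + spacetime Lx Ly I for Lx Ly I +
  fixes Ek \<Lambda> Ra Rm Pe Tm Tp :: real and Q \<tau> :: "real \<Rightarrow> real"
    and u B :: "real \<Rightarrow> real^3 \<Rightarrow> real^3" and P T :: "real \<Rightarrow> real^3 \<Rightarrow> real"
  assumes pos: "0 < Ek" "0 < \<Lambda>" "0 < Ra" "0 < Rm" "0 < Pe"
    and sol: "viscous_inertialess_solution Lx Ly Ek \<Lambda> Ra Rm Pe Q Tm Tp I u B P T"
    and exact: "\<And>t. t \<in> I \<Longrightarrow> exact_flux Lx Ly (B t)"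
    and cond: "conductive_state Q Tm Tp \<tau>"
begin

lemma smooth: "smooth_field Lx Ly I u" "smooth_field Lx Ly I B" "sf P" "sf T"
  using sol by (auto simp: viscous_inertialess_solution_def)

lemma sf_u: "sf (\<lambda>t x. u t x $ i)" and sf_B: "sf (\<lambda>t x. B t x $ i)"
  using smooth_field_component smooth by blast+

lemma sm_sf: "sf F \<Longrightarrow> t \<in> I \<Longrightarrow> sm (F t)"
  using sf_slice by (simp add: sm_def)

lemma smooth_slice: "t \<in> I \<Longrightarrow> smooth_on slab (u t)" "t \<in> I \<Longrightarrow> smooth_on slab (B t)"
  using smooth_on_time_slice[of "\<lambda>(t, x). u t x" t] smooth_on_time_slice[of "\<lambda>(t, x). B t x" t] smooth
  by (auto simp: smooth_field_def)

lemma pde: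
  assumes "t \<in> I" "x \<in> slab"
  shows "cross3 e_z (u t x) + grad (P t) x - Ek *\<^sub>R laplacian (u t) x
      = \<Lambda> *\<^sub>R cross3 (curl (B t) x) (B t x) + (Ra * T t x) *\<^sub>R e_z"
    and "divergence (u t) x = 0"
    and "time_deriv I B t x - curl (\<lambda>y. cross3 (u t y) (B t y)) x = (1 / Rm) *\<^sub>R laplacian (B t) x"
    and "divergence (B t) x = 0"
    and "time_deriv I T t x + divergence (\<lambda>y. T t y *\<^sub>R u t y) x = (1 / Pe) * laplacian (T t) x + Q (x $ 3) / Pe"
  using sol assms unfolding viscous_inertialess_solution_def by blast+

lemma walls:
  assumes t: "t \<in> I" and x: "x \<in> S_minus \<union> S_plus"
  shows "u t x $ 3 = 0" "curl (u t) x $ 1 = 0" "curl (u t) x $ 2 = 0" "B t x $ 1 = 0" "B t x $ 2 = 0"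
    and "T t x = (if x \<in> S_minus then Tm else Tp)"
proof -
  have bc: "\<forall>(S, n) \<in> {(S_minus, - e_z), (S_plus, e_z)}. \<forall>x\<in>S.
          u t x \<bullet> n = 0 \<and> cross3 (curl (u t) x) n = 0 \<and> cross3 (B t x) n = 0"
    "\<forall>x\<in>S_minus. T t x = Tm" "\<forall>x\<in>S_plus. T t x = Tp"
    using sol t unfolding viscous_inertialess_solution_def by blast+
  obtain n where n: "n = e_z \<or> n = - e_z" "u t x \<bullet> n = 0" "cross3 (curl (u t) x) n = 0" "cross3 (B t x) n = 0"
    using bc(1) x by fastforce
  show "u t x $ 3 = 0" using n(1,2) by (auto simp: inner_axis)
  have c: "v $ 1 = 0 \<and> v $ 2 = 0" if "cross3 v n = 0" for v
    using that n(1) by (auto simp: vec_eq_iff forall_3 cross3_components axis_def)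
  show "curl (u t) x $ 1 = 0" "curl (u t) x $ 2 = 0" "B t x $ 1 = 0" "B t x $ 2 = 0"
    using c[OF n(3)] c[OF n(4)] by auto
  show "T t x = (if x \<in> S_minus then Tm else Tp)" using bc(2,3) x by auto
qed

lemma pdc: "t \<in> I \<Longrightarrow> x \<in> slab \<Longrightarrow> pd j (u t) x $ i = pd j (\<lambda>x. u t x $ i) x"
  "t \<in> I \<Longrightarrow> x \<in> slab \<Longrightarrow> pd j (B t) x $ i = pd j (\<lambda>x. B t x $ i) x"
  using pd_component smooth_slice by blast+

lemma hmean_B:
  assumes t: "t \<in> I" shows "hmean (\<lambda>x. B t x $ 3) 0 = 0"
proof -
  have f: "fld (\<lambda>x. B t x $ 3)" by (rule sm_fld[OF sm_sf[OF sf_B t]])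
  then have c: "continuous_on slab (\<lambda>x. B t x $ 3)" by (simp add: fld_def)
  have cc: "continuous_on S (\<lambda>y :: real^2. B t (vector [y $ 1, y $ 2, 0]) $ 3)" for S
    unfolding vector_coord3
    by (rule continuous_on_compose2[OF c]) (auto intro!: continuous_intros)
  have "0 = integral (cbox 0 (vector [Lx, Ly])) (\<lambda>y :: real^2. - e_z \<bullet> B t (vector [y $ 1, y $ 2, 0]))"
    using exact[OF t] by (simp add: exact_flux_def wall_flux_def)
  also have "\<dots> = - integral (cbox 0 (vector [Lx, Ly])) (\<lambda>y :: real^2. B t (vector [y $ 1, y $ 2, 0]) $ 3)"
    by (simp add: inner_axis')
  also have "integral (cbox 0 (vector [Lx, Ly])) (\<lambda>y :: real^2. B t (vector [y $ 1, y $ 2, 0]) $ 3) = hmean (\<lambda>x. B t x $ 3) 0"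
    unfolding integral_cbox2[OF cc] hmean_def by (simp add: vector_coord3)
  finally show ?thesis by simp
qed

lemma \<tau>_deriv:
  assumes z: "z \<in> {0..1}"
  shows "(\<tau> has_real_derivative z_deriv \<tau> z) (at z within {0..1})"
    and "(z_deriv \<tau> has_real_derivative - Q z) (at z within {0..1})"
proof -
  have c: "\<tau> differentiable (at z within {0..1})" "z_deriv \<tau> differentiable (at z within {0..1})" "z_deriv (z_deriv \<tau>) z = - Q z"
    using cond z by (auto simp: conductive_state_def eq_neg_iff_add_eq_0)
  show "(\<tau> has_real_derivative z_deriv \<tau> z) (at z within {0..1})"
    using c(1) unfolding vector_derivative_works has_real_derivative_iff_has_vector_derivative z_deriv_def .
  show "(z_deriv \<tau> has_real_derivative - Q z) (at z within {0..1})"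
    using c(2) unfolding vector_derivative_works has_real_derivative_iff_has_vector_derivative c(3)[symmetric]
    unfolding z_deriv_def .
qed

lemma heat_equation:
  assumes t: "t \<in> I" and x: "x \<in> slab"
  shows "Pe * time_deriv I T t x = (\<Sum>k\<in>UNIV. pd k (pd k (T t)) x) + Q (x $ 3) - Pe * (\<Sum>k\<in>UNIV. u t x $ k * pd k (T t) x)"
proof -
  have "divergence (\<lambda>y. T t y *\<^sub>R u t y) x = (\<Sum>k\<in>UNIV. pd k (T t) x * u t x $ k + T t x * pd k (\<lambda>x. u t x $ k) x)"
    unfolding divergence_def
  proof (rule sum.cong[OF refl])
    fix k :: 3
    show "pd k (\<lambda>y. T t y *\<^sub>R u t y) x $ k = pd k (T t) x * u t x $ k + T t x * pd k (\<lambda>x. u t x $ k) x"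
      by (rule pd_vec[where g = "\<lambda>i x. pd k (T t) x * u t x $ i + T t x * pd k (\<lambda>x. u t x $ i) x", OF _ x])
         (simp, intro has_pd_mult sm_has_pd sm_sf[OF smooth(4) t] sm_sf[OF sf_u t])
  qed
  also have "\<dots> = (\<Sum>k\<in>UNIV. u t x $ k * pd k (T t) x) + T t x * divergence (u t) x"
    unfolding divergence_def using pdc(1)[OF t x] by (simp add: sum.distrib sum_distrib_left mult.commute)
  finally have "divergence (\<lambda>y. T t y *\<^sub>R u t y) x = (\<Sum>k\<in>UNIV. u t x $ k * pd k (T t) x)"
    using pde(2)[OF t x] by simp
  then have h: "time_deriv I T t x + (\<Sum>k\<in>UNIV. u t x $ k * pd k (T t) x) = (1 / Pe) * laplacian (T t) x + Q (x $ 3) / Pe"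
    using pde(5)[OF t x] by simp
  have "Pe * (time_deriv I T t x + (\<Sum>k\<in>UNIV. u t x $ k * pd k (T t) x)) = laplacian (T t) x + Q (x $ 3)"
    unfolding h using pos by (simp add: field_simps)
  then show ?thesis by (simp add: laplacian_def algebra_simps)
qed

text \<open>The heat equation expresses \<open>Q\<close> along a vertical line through continuous
  fields. As the second derivative of \<open>\<tau>\<close> is \<open>- Q\<close>, it follows that
  \<open>\<tau>\<close> is twice continuously differentiable, as \<open>heated_fluid\<close>
  requires.\<close>

lemma continuous_Q: assumes t: "t \<in> I" shows "continuous_on {0..1} Q"
proof -
  let ?R = "\<lambda>x. Pe * time_deriv I T t x + Pe * (\<Sum>k\<in>UNIV. u t x $ k * pd k (T t) x) - (\<Sum>k\<in>UNIV. pd k (pd k (T t)) x)"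
  have "fld ?R"
    by (intro fld_diff fld_add fld_sum fld_mult fld_const sm_fld sm_pd sm_sf[OF _ t] sf_time_deriv sf_u smooth)
  then have c: "continuous_on slab ?R" by (simp add: fld_def)
  have "continuous_on {0..1} (\<lambda>z. ?R (coord3 1 2 0 0 z))"
    by (rule continuous_on_compose2[OF c]) (auto intro!: continuous_intros)
  then show ?thesis
    by (rule continuous_on_eq) (use heat_equation[OF t] in \<open>simp del: coord3_12_slab, simp\<close>)
qed

lemma heated_fluid:
  assumes t: "t \<in> I"
  shows "heated_fluid Lx Ly (\<lambda>i x. u t x $ i) (\<lambda>i x. B t x $ i) (P t) (T t) Pe \<tau> (z_deriv \<tau>) (\<lambda>z. - Q z) (time_deriv I T t)"
proof
  show "sm (\<lambda>x. u t x $ i)" "sm (\<lambda>x. B t x $ i)" for i by (rule sm_sf[OF sf_u t], rule sm_sf[OF sf_B t])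
  show "sm (P t)" "sm (T t)" "sm (time_deriv I T t)" by (intro sm_sf smooth sf_time_deriv t)+
  show "(\<Sum>k\<in>UNIV. pd k (\<lambda>x. u t x $ k) x) = 0" "(\<Sum>k\<in>UNIV. pd k (\<lambda>x. B t x $ k) x) = 0" if "x \<in> slab" for x
    using pde(2,4)[OF t that] pdc[OF t that] by (simp_all add: divergence_def)
  show u3: "u t x $ 3 = 0" if "x \<in> S_minus \<union> S_plus" for x using walls(1)[OF t that] .
  \<comment> \<open>The tangential curl mixes vertical derivatives of the horizontal velocities with
    horizontal derivatives of \<open>u 3\<close>; the latter vanish on the walls, so the stress-free
    condition becomes Neumann.\<close>
  have tan: "pd k (\<lambda>x. u t x $ 3) x = 0" if "x \<in> S_minus \<union> S_plus" "k \<noteq> 3" for x k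
    by (rule tangential_derivative_0[OF sm_has_pd[OF sm_sf[OF sf_u t]] that(2) _ that(1)]) (use u3 in blast)
  show "pd 3 (\<lambda>x. u t x $ 1) x = 0" "pd 3 (\<lambda>x. u t x $ 2) x = 0" if x: "x \<in> S_minus \<union> S_plus" for x
    using walls(2,3)[OF t x] tan[OF x, of 1] tan[OF x, of 2] pdc(1)[OF t walls_slab[OF x]] by (simp_all add: curl_def)
  show "B t x $ 1 = 0" "B t x $ 2 = 0" if "x \<in> S_minus \<union> S_plus" for x using walls(4,5)[OF t that] by auto
  show "hmean (\<lambda>x. B t x $ 3) 0 = 0" by (rule hmean_B[OF t])
  show "0 < Pe" by (rule pos)
  show "(\<tau> has_real_derivative z_deriv \<tau> z) (at z within {0..1})" "(z_deriv \<tau> has_real_derivative - Q z) (at z within {0..1})"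
    if "z \<in> {0..1}" for z by (rule \<tau>_deriv[OF that])+
  show "continuous_on {0..1} (\<lambda>z. - Q z)" by (intro continuous_intros continuous_Q[OF t])
  show "T t x = \<tau> (x $ 3)" if x: "x \<in> S_minus \<union> S_plus" for x
  proof (cases "x \<in> S_minus")
    case True
    then show ?thesis using walls(6)[OF t x] cond by (simp add: conductive_state_def S_minus_def)
  next
    case False
    then have "x \<in> S_plus" using x by blast
    then show ?thesis using walls(6)[OF t x] False cond by (simp add: conductive_state_def S_plus_def)
  qed
  show "time_deriv I T t x = 0" if x: "x \<in> S_minus \<union> S_plus" for x
  proof -
    have "((\<lambda>s. T s x) has_vector_derivative 0) (at t within I) \<longleftrightarrow>
       ((\<lambda>s. if x \<in> S_minus then Tm else Tp) has_vector_derivative 0) (at t within I)"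
      by (rule has_vector_derivative_within_cong) (use walls(6)[OF _ x] t in auto)
    then have "((\<lambda>s. T s x) has_vector_derivative 0) (at t within I)" by simp
    then show ?thesis unfolding time_deriv_def by (rule vector_derivative_within[OF I_perfect[OF t]])
  qed
qed

text \<open>\<open>h\<close> is the gradient of \<open>\<tau>\<close>. Differentiation under the
  integral sign yields one derivative of the energy within \<open>I\<close>; uniqueness of such
  derivatives identifies it with the given \<open>D\<close>, even at an endpoint of
  \<open>I\<close>.\<close>

lemma combined_energy_deriv:
  assumes t: "t \<in> I"
    and D: "((\<lambda>t. combined_energy Lx Ly \<Lambda> Pe (B t) (\<lambda>x. T t x - \<tau> (x $ 3))) has_real_derivative D) (at t within I)"
  defines "h k x \<equiv> if k = 3 then z_deriv \<tau> (x $ 3) else 0"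
  shows "D = \<Lambda> * vint (\<lambda>x. \<Sum>i\<in>UNIV. B t x $ i * time_deriv I (\<lambda>t x. B t x $ i) t x)
    + Pe * vint (\<lambda>x. \<Sum>k\<in>UNIV. (pd k (T t) x - h k x) * pd k (time_deriv I T t) x)"
proof -
  have fh: "fld (h k)" for k
  proof (cases "k = 3")
    case True
    have "continuous_on {0..1} (z_deriv \<tau>)" by (rule DERIV_continuous_on) (rule \<tau>_deriv(2))
    then show ?thesis unfolding h_def using True fld_z by simp
  next
    case False then show ?thesis unfolding h_def using fld_const by simp
  qed
  define E where "E t = \<Lambda> / 2 * (\<Sum>i\<in>UNIV. vint (\<lambda>x. (B t x $ i - 0)\<^sup>2)) + Pe / 2 * (\<Sum>k\<in>UNIV. vint (\<lambda>x. (pd k (T t) x - h k x)\<^sup>2))" for t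
  have eq: "combined_energy Lx Ly \<Lambda> Pe (B s) (\<lambda>x. T s x - \<tau> (x $ 3)) = E s" if s: "s \<in> I" for s
  proof -
    interpret hf: heated_fluid Lx Ly "\<lambda>i x. u s x $ i" "\<lambda>i x. B s x $ i" "P s" "T s" Pe \<tau> "z_deriv \<tau>" "\<lambda>z. - Q z" "time_deriv I T s"
      by (rule heated_fluid[OF s])
    have fB: "fld (\<lambda>x. B s x $ i)" for i by (rule sm_fld[OF sm_sf[OF sf_B s]])
    have fT: "fld (pd k (T s))" for k by (rule sm_fld[OF sm_pd[OF sm_sf[OF smooth(4) s]]])
    have "(LINT x|lebesgue_on (box_V Lx Ly). (norm (B s x))\<^sup>2) = (LINT x|lebesgue_on (box_V Lx Ly). (\<Sum>i\<in>UNIV. (B s x $ i)\<^sup>2))"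
      by (simp add: norm_vec_def L2_set_def sum_nonneg)
    also have "\<dots> = vint (\<lambda>x. \<Sum>i\<in>UNIV. (B s x $ i)\<^sup>2)" by (rule vint_lebesgue(1)) (intro fld_intros fB)
    also have "\<dots> = (\<Sum>i\<in>UNIV. vint (\<lambda>x. (B s x $ i)\<^sup>2))" by (rule vint_sum) (auto intro!: fld_intros fB)
    finally have 1: "(LINT x|lebesgue_on (box_V Lx Ly). (norm (B s x))\<^sup>2) = (\<Sum>i\<in>UNIV. vint (\<lambda>x. (B s x $ i)\<^sup>2))" .
    have "(LINT x|lebesgue_on (box_V Lx Ly). (norm (grad (\<lambda>x. T s x - \<tau> (x $ 3)) x))\<^sup>2)
      = (LINT x|lebesgue_on (box_V Lx Ly). (\<Sum>k\<in>UNIV. (pd k (T s) x - h k x)\<^sup>2))"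
    proof (rule Bochner_Integration.integral_cong[OF refl])
      fix x assume "x \<in> space (lebesgue_on (box_V Lx Ly))"
      then have x: "x \<in> slab" using box_V_slab by auto
      have "pd k (\<lambda>x. T s x - \<tau> (x $ 3)) x = pd k (T s) x - h k x" for k
        using has_pd_pd[OF hf.has_pd_\<theta> x, of k] unfolding hf.\<theta>_def[abs_def] hf.d\<theta>_def h_def by auto
      then show "(norm (grad (\<lambda>x. T s x - \<tau> (x $ 3)) x))\<^sup>2 = (\<Sum>k\<in>UNIV. (pd k (T s) x - h k x)\<^sup>2)"
        by (simp add: grad_def norm_vec_def L2_set_def sum_nonneg)
    qed
    also have "\<dots> = vint (\<lambda>x. \<Sum>k\<in>UNIV. (pd k (T s) x - h k x)\<^sup>2)" by (rule vint_lebesgue(1)) (intro fld_intros fT fh)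
    also have "\<dots> = (\<Sum>k\<in>UNIV. vint (\<lambda>x. (pd k (T s) x - h k x)\<^sup>2))" by (rule vint_sum) (auto intro!: fld_intros fT fh)
    finally show ?thesis unfolding combined_energy_def 1 E_def by simp
  qed
  have slab: "cbox 0 per \<subseteq> slab" using box_V_slab by (simp add: box_V_def)
  have dB: "((\<lambda>t. vint (\<lambda>x. (B t x $ i - 0)\<^sup>2)) has_real_derivative vint (\<lambda>x. 2 * (B t x $ i - 0) * time_deriv I (\<lambda>t x. B t x $ i) t x)) (at t within I)" for i
    unfolding vint_def box_V_def
    by (rule integral_square_time_deriv[OF sf_B t slab continuous_on_const])
  have dT: "((\<lambda>t. vint (\<lambda>x. (pd k (T t) x - h k x)\<^sup>2)) has_real_derivative vint (\<lambda>x. 2 * (pd k (T t) x - h k x) * time_deriv I (\<lambda>t. pd k (T t)) t x)) (at t within I)" for k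
    unfolding vint_def box_V_def
    by (rule integral_square_time_deriv[OF sf_pd[OF smooth(4)] t slab fld_box[OF fh]])
  have "(E has_vector_derivative
      \<Lambda> / 2 * (\<Sum>i\<in>UNIV. vint (\<lambda>x. 2 * (B t x $ i - 0) * time_deriv I (\<lambda>t x. B t x $ i) t x))
      + Pe / 2 * (\<Sum>k\<in>UNIV. vint (\<lambda>x. 2 * (pd k (T t) x - h k x) * time_deriv I (\<lambda>t. pd k (T t)) t x))) (at t within I)" (is "(_ has_vector_derivative ?D) _")
    unfolding E_def[abs_def] has_real_derivative_iff_has_vector_derivative[symmetric] by (intro DERIV_add DERIV_cmult DERIV_sum dB dT)
  moreover have "(E has_vector_derivative D) (at t within I)"
    using D has_vector_derivative_within_cong[of I "\<lambda>t. combined_energy Lx Ly \<Lambda> Pe (B t) (\<lambda>x. T t x - \<tau> (x $ 3))" E t D] eq t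
    unfolding has_real_derivative_iff_has_vector_derivative by blast
  ultimately have "D = ?D"
    using vector_derivative_within[OF I_perfect[OF t], of E D] vector_derivative_within[OF I_perfect[OF t], of E ?D] by simp
  also have "?D = \<Lambda> * (\<Sum>i\<in>UNIV. vint (\<lambda>x. B t x $ i * time_deriv I (\<lambda>t x. B t x $ i) t x))
      + Pe * (\<Sum>k\<in>UNIV. vint (\<lambda>x. (pd k (T t) x - h k x) * pd k (time_deriv I T t) x))"
  proof -
    have "vint (\<lambda>x. 2 * (B t x $ i - 0) * time_deriv I (\<lambda>t x. B t x $ i) t x) = 2 * vint (\<lambda>x. B t x $ i * time_deriv I (\<lambda>t x. B t x $ i) t x)" for i
      by (simp add: mult.assoc vint_cmult)
    moreover have "vint (\<lambda>x. 2 * (pd k (T t) x - h k x) * time_deriv I (\<lambda>t. pd k (T t)) t x)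
      = 2 * vint (\<lambda>x. (pd k (T t) x - h k x) * pd k (time_deriv I T t) x)" for k
      unfolding vint_cmult[symmetric]
      by (rule vint_cong) (simp add: sf_pd_time_deriv[OF smooth(4) t])
    ultimately show ?thesis by (simp add: sum_distrib_left[symmetric])
  qed
  also have "(\<Sum>i\<in>UNIV. vint (\<lambda>x. B t x $ i * time_deriv I (\<lambda>t x. B t x $ i) t x)) = vint (\<lambda>x. \<Sum>i\<in>UNIV. B t x $ i * time_deriv I (\<lambda>t x. B t x $ i) t x)"
    by (rule vint_sum[symmetric]) (auto intro!: fld_mult sm_fld[OF sm_sf[OF sf_B t]] sm_fld[OF sm_sf[OF sf_time_deriv[OF sf_B] t]])
  also have "(\<Sum>k\<in>UNIV. vint (\<lambda>x. (pd k (T t) x - h k x) * pd k (time_deriv I T t) x)) = vint (\<lambda>x. \<Sum>k\<in>UNIV. (pd k (T t) x - h k x) * pd k (time_deriv I T t) x)"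
    by (rule vint_sum[symmetric]) (auto intro!: fld_mult fld_diff fh sm_fld[OF sm_pd[OF sm_sf[OF smooth(4) t]]]
      sm_fld[OF sm_pd[OF sm_sf[OF sf_time_deriv[OF smooth(4)] t]]])
  finally show ?thesis .
qed

lemma alternative:
  assumes C: "sobolev_elliptic_constant Lx Ly C" and p: "3 \<le> p" and t: "t \<in> I"
    and nontriv: "\<exists>x\<in>box_V Lx Ly. B t x \<noteq> 0 \<or> T t x - \<tau> (x $ 3) \<noteq> 0"
    and small: "Pe * C * Lp_norm 3 (box_V Lx Ly) (u t) < 1"
    and D: "((\<lambda>t. combined_energy Lx Ly \<Lambda> Pe (B t) (\<lambda>x. T t x - \<tau> (x $ 3))) has_real_derivative D) (at t within I)" "0 \<le> D"
  shows "Ra * A_const Lx Ly p * Lp_norm p (box_V Lx Ly) (grad_xy (vertical_primitive (T t))) \<ge> 1 / Rm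
       \<or> C_P2 Lx Ly * Ra * sqrt Ek / 2 + Pe * Lp_norm 2 {0..1} (z_deriv \<tau>) / (2 * sqrt Ek)
           \<ge> sqrt (1 - Pe * C * Lp_norm 3 (box_V Lx Ly) (u t))"
proof -
  interpret hf: heated_fluid Lx Ly "\<lambda>i x. u t x $ i" "\<lambda>i x. B t x $ i" "P t" "T t" Pe \<tau> "z_deriv \<tau>" "\<lambda>z. - Q z" "time_deriv I T t"
    by (rule heated_fluid[OF t])
  define b where "b i x = time_deriv I (\<lambda>t x. B t x $ i) t x" for i x
  have J: "curl (B t) x $ i = hf.J i x" if "x \<in> slab" for x i
    using pdc(2)[OF t that] exhaust_3[of i] by (auto simp: curl_def hf.J_def)
  have JB: "cross3 (curl (B t) x) (B t x) $ i = hf.JB i x" if "x \<in> slab" for x i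
    using J[OF that] exhaust_3[of i] by (auto simp: hf.JB_def cross3_components)
  have Lapu: "laplacian (u t) x $ i = hf.Lap (\<lambda>x. u t x $ i) x" and LapB: "laplacian (B t) x $ i = hf.Lap (\<lambda>x. B t x $ i) x"
    if "x \<in> slab" for x i
    unfolding hf.Lap_def by (rule laplacian_component[OF smooth_slice(1)[OF t] that], rule laplacian_component[OF smooth_slice(2)[OF t] that])
  have mom: "(cross3 e_z (u t x)) $ i + pd i (P t) x - Ek * hf.Lap (\<lambda>x. u t x $ i) x = \<Lambda> * hf.JB i x + Ra * T t x * e_z $ i" if "x \<in> slab" for x i
    using arg_cong[OF pde(1)[OF t that], of "\<lambda>v. v $ i"] JB[OF that, of i] Lapu[OF that, of i] by (simp add: grad_def)
  have dF: "pd k (\<lambda>y. cross3 (u t y) (B t y)) x $ i = hf.dF k i x" if "x \<in> slab" for x i k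
  proof (rule pd_vec[OF _ that])
    fix i
    have "(\<lambda>x. cross3 (u t x) (B t x) $ i) = hf.F i"
      using exhaust_3[of i] by (auto simp: hf.F_def cross3_components)
    then show "has_pd k (\<lambda>x. cross3 (u t x) (B t x) $ i) (hf.dF k i)" using hf.has_pd_F by simp
  qed
  have ind: "b i x = curl (\<lambda>y. cross3 (u t y) (B t y)) x $ i + 1 / Rm * hf.Lap (\<lambda>x. B t x $ i) x" if "x \<in> slab" for x i
    using arg_cong[OF pde(3)[OF t that], of "\<lambda>v. v $ i"] LapB[OF that, of i] time_deriv_component[OF smooth(2) t that, of i]
    by (simp add: b_def algebra_simps)
  \<comment> \<open>Because the second derivative of \<open>\<tau>\<close> is \<open>- Q\<close>,
    the source is absorbed into the Laplacian of the perturbation, and the vertical advection of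
    \<open>\<tau>\<close> splits off as a forcing.\<close>
  have heat: "Pe * time_deriv I T t x = hf.lap\<theta> x - Pe * (\<Sum>k\<in>UNIV. u t x $ k * hf.d\<theta> k x) - Pe * (u t x $ 3 * z_deriv \<tau> (x $ 3))" if "x \<in> slab" for x
    using heat_equation[OF t that] by (simp add: hf.lap\<theta>_def hf.dd\<theta>_def hf.d\<theta>_def sum_3 algebra_simps)
  let ?U = "vint (\<lambda>x. hf.speed x powr 3) powr (1/3)" and ?s = "sqrt (integral {0..1} (\<lambda>z. (z_deriv \<tau> z)\<^sup>2))"
  let ?G = "Lp_norm p (box_V Lx Ly) (grad_xy (vertical_primitive (T t)))"
  have U: "Lp_norm 3 (box_V Lx Ly) (u t) = ?U"
  proof -
    have "Lp_norm (ereal 3) (box_V Lx Ly) (u t) = ?U"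
      by (rule Lp_norm_vint[OF hf.fld_speed]) (auto simp: hf.speed_def norm_vec_def L2_set_def sum_nonneg)
    then show ?thesis by simp
  qed
  have c\<tau>: "continuous_on {0..1} (z_deriv \<tau>)" by (rule DERIV_continuous_on) (rule \<tau>_deriv(2))
  have S: "Lp_norm 2 {0..1} (z_deriv \<tau>) = ?s"
  proof -
    have c2: "continuous_on {0..1} (\<lambda>z. (z_deriv \<tau> z)\<^sup>2)" by (intro continuous_intros c\<tau>)
    have "norm (z_deriv \<tau> z) powr 2 = (z_deriv \<tau> z)\<^sup>2" for z by (cases "z_deriv \<tau> z = 0") simp_all
    then have "Lp_norm (ereal 2) {0..1} (z_deriv \<tau>) = (LINT z|lebesgue_on {0..1}. (z_deriv \<tau> z)\<^sup>2) powr (1/2)"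
      by (simp add: Lp_norm_def)
    also have "(LINT z|lebesgue_on {0..1}. (z_deriv \<tau> z)\<^sup>2) = integral {0..1} (\<lambda>z. (z_deriv \<tau> z)\<^sup>2)"
      by (rule lebesgue_integral_eq_integral[OF continuous_imp_integrable_real[OF c2]]) simp
    also have "\<dots> powr (1/2) = ?s"
      by (rule powr_half_sqrt) (intro integral_nonneg integrable_continuous_real c2, simp)
    finally show ?thesis by simp
  qed
  have "D = \<Lambda> * vint (\<lambda>x. \<Sum>i\<in>UNIV. B t x $ i * b i x) + Pe * vint (\<lambda>x. \<Sum>k\<in>UNIV. hf.d\<theta> k x * pd k (time_deriv I T t) x)"
  proof -
    have "pd k (T t) x - (if k = 3 then z_deriv \<tau> (x $ 3) else 0) = hf.d\<theta> k x" for k x by (simp add: hf.d\<theta>_def)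
    then show ?thesis using combined_energy_deriv[OF t D(1)] by (simp add: b_def)
  qed
  also have "\<dots> \<le> - Ek * hf.N2 - (1 - Pe * C * ?U) * hf.M2 + (Ek * Ra * C_P2 Lx Ly + Pe * ?s) * (sqrt hf.N2 * sqrt hf.M2)
      - \<Lambda> * (1 / Rm - Ra * A_const Lx Ly p * ?G) * hf.K2"
  proof (rule hf.energy_inequality[OF pos(1-4) _ _ _ _ _ _ heat p C])
    fix x assume x: "x \<in> slab"
    show "- u t x $ 2 + pd 1 (P t) x - Ek * hf.Lap (\<lambda>x. u t x $ 1) x = \<Lambda> * hf.JB 1 x"
      "u t x $ 1 + pd 2 (P t) x - Ek * hf.Lap (\<lambda>x. u t x $ 2) x = \<Lambda> * hf.JB 2 x"
      "pd 3 (P t) x - Ek * hf.Lap (\<lambda>x. u t x $ 3) x = \<Lambda> * hf.JB 3 x + Ra * T t x"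
      using mom[OF x, of 1] mom[OF x, of 2] mom[OF x, of 3] by (simp_all add: cross3_components axis_def)
    show "b 1 x = hf.dF 2 3 x - hf.dF 3 2 x + 1 / Rm * hf.Lap (\<lambda>x. B t x $ 1) x"
      "b 2 x = hf.dF 3 1 x - hf.dF 1 3 x + 1 / Rm * hf.Lap (\<lambda>x. B t x $ 2) x"
      "b 3 x = hf.dF 1 2 x - hf.dF 2 1 x + 1 / Rm * hf.Lap (\<lambda>x. B t x $ 3) x"
      using ind[OF x] dF[OF x] by (simp_all add: curl_def)
  qed
  finally have le: "D \<le> \<dots>" .
  have "\<exists>x\<in>box_V Lx Ly. (\<exists>i. B t x $ i \<noteq> 0) \<or> hf.\<theta> x \<noteq> 0"
    using nontriv by (auto simp: hf.\<theta>_def vec_eq_iff)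
  then show ?thesis
    using hf.dichotomy[OF pos(1-3) _ _ D(2) le] small unfolding U S by (simp add: integral_nonneg integrable_continuous_real continuous_on_power c\<tau>)
qed

end

theorem theorem4p9:
  fixes Lx Ly Ek \<Lambda> Ra Rm Pe Tm Tp C_S0 t\<^sub>0 D :: real
    and Q \<tau> :: "real \<Rightarrow> real"
    and I :: "real set"
    and u B :: "real \<Rightarrow> real^3 \<Rightarrow> real^3"
    and P T \<theta> :: "real \<Rightarrow> real^3 \<Rightarrow> real"
    and p :: ereal
  assumes "Lx > 0" "Ly > 0"
    and "Ek > 0" "\<Lambda> > 0" "Ra > 0" "Rm > 0" "Pe > 0"
    and "sobolev_elliptic_constant Lx Ly C_S0"
    and "is_interval I" "interior I \<noteq> {}"
    and "viscous_inertialess_solution Lx Ly Ek \<Lambda> Ra Rm Pe Q Tm Tp I u B P T"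
    and "\<forall>t\<in>I. exact_flux Lx Ly (B t)"
    and "conductive_state Q Tm Tp \<tau>"
    and "\<theta> = (\<lambda>t x. T t x - \<tau> (x $ 3))"
    and "3 \<le> p"
    and "t\<^sub>0 \<in> I"
    and "\<exists>x\<in>box_V Lx Ly. B t\<^sub>0 x \<noteq> 0 \<or> \<theta> t\<^sub>0 x \<noteq> 0"
    and "Pe * C_S0 * Lp_norm 3 (box_V Lx Ly) (u t\<^sub>0) < 1"
    and "((\<lambda>t. combined_energy Lx Ly \<Lambda> Pe (B t) (\<theta> t)) has_real_derivative D) (at t\<^sub>0 within I)"
    and "D \<ge> 0"
  shows "Ra * A_const Lx Ly p
           * Lp_norm p (box_V Lx Ly) (grad_xy (vertical_primitive (T t\<^sub>0))) \<ge> 1 / Rm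
       \<or> C_P2 Lx Ly * Ra * sqrt Ek / 2
           + Pe * Lp_norm 2 {0..1} (z_deriv \<tau>) / (2 * sqrt Ek)
           \<ge> sqrt (1 - Pe * C_S0 * Lp_norm 3 (box_V Lx Ly) (u t\<^sub>0))"
proof -
  interpret mhd_solution Lx Ly I Ek \<Lambda> Ra Rm Pe Tm Tp Q \<tau> u B P T
    by unfold_locales (use assms in auto)
  show ?thesis
    using alternative[of C_S0 p t\<^sub>0 D] assms by simp
qed

end
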